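(* Let $k \ge 1$ be an integer. Let $Y$ and $X$ be independent random variables, where $Y \sim \mathrm{Gamma}(k,1)$ and $X$ is a positive random variable with $X \sim \mathrm{HM}_k$. Then $Y \cdot X \sim \mathrm{GGC}$ and $Y/X \sim \mathrm{GGC}$.
   Context: Gamma distribution: for $u,t>0$, $\mathrm{Gamma}(u,t)$ is the distribution on $(0,\infty)$ with density $x \mapsto \Gamma(u)^{-1} t^u x^{u-1} e^{-xt}$. Hyperbolic monotonicity of order $k$: let $f$ be a nonnegative function on $(0,\infty)$. For each fixed $u>0$ the function $v \mapsto f(uv)f(u/v)$, $v>0$, is invariant under $v \mapsto v^{-1}$ and hence is a function $h(w)=h_u(w)$ of $w = v+v^{-1} \in [2,\infty)$. The function $f$ is called $\mathrm{HM}_k$ (hyperbolically monotone of order $k$, $k\ge 1$ an integer) if for every $u>0$ one has $(-1)^j h^{(j)}(w) \ge 0$ for $j=0,1,\dots,k-1$ and $(-1)^{k-1}h^{(k-1)}(w)$ is non-increasing in $w$. For $k=1$ this means that $h$ is non-increasing. Equivalently (this also fixes the meaning of the highest derivative where $h^{(k-2)}$ has kinks), for every $u>0$, $$h(w) = f(uv)f(u/v) = c_u + \int_{(w,\infty)} (\lambda-w)^{k-1} H_u(d\lambda)$$ (or possibly with $[w,\infty)$ in place of $(w,\infty)$), with a constant $c_u\ge 0$ and a nonnegative measure $H_u$. We write $X \sim \mathrm{HM}_k$ if the positive random variable $X$ has a probability density function on $(0,\infty)$ that is $\mathrm{HM}_k$. Generalized gamma convolution (GGC): a probability distribution on $[0,\infty)$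 whose Laplace transform is of the form $$\phi(s) = \exp\left(-as + \int_{(0,\infty)} \log\left(\frac{t}{t+s}\right)U(dt)\right), \quad s \ge 0,$$ where $a \ge 0$ and $U$ is a nonnegative measure on $(0,\infty)$, finite on compact subsets of $(0,\infty)$, with $\int_{(0,1)} |\log t|\,U(dt) < \infty$ and $\int_{(1,\infty)} t^{-1}U(dt) < \infty$. We write $Z \sim \mathrm{GGC}$ if the distribution of the random variable $Z$ is a GGC. *)

theory Defs
  imports "HOL-Probability.Probability"
begin

definition gamma_density :: "real \<Rightarrow> real \<Rightarrow> real \<Rightarrow> real" where
  "gamma_density u t x =
    (if 0 < x then inverse (Gamma u) * t powr u * x powr (u - 1) * exp (- x * t) else 0)"

(* D j is the j-th derivative of h on [2,\<infinity>), one-sided at 2.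
   Only intended for k \<ge> 1, as are the predicates below. *)
definition monotone_order_deriv :: "nat \<Rightarrow> (real \<Rightarrow> real) \<Rightarrow> bool" where
  "monotone_order_deriv k h \<longleftrightarrow>
    (\<exists>D :: nat \<Rightarrow> real \<Rightarrow> real.
      D 0 = h \<and>
      (\<forall>j < k - 1. \<forall>w \<ge> 2. (D j has_real_derivative D (Suc j) w) (at w within {2..})) \<and>
      (\<forall>j < k. \<forall>w \<ge> 2. 0 \<le> (- 1) ^ j * D j w) \<and>
      antimono_on {2..} (\<lambda>w. (- 1) ^ (k - 1) * D (k - 1) w))"

(* The choice between the open and the closed interval of integration only matters
   for k = 1. *)
definition monotone_order_integral :: "nat \<Rightarrow> (real \<Rightarrow> real) \<Rightarrow> bool" where
  "monotone_order_integral k h \<longleftrightarrow>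
    (\<exists>(c :: real) (H :: real measure).
      0 \<le> c \<and> sets H = sets borel \<and>
      ((\<forall>w \<ge> 2. set_integrable H {w<..} (\<lambda>l. (l - w) ^ (k - 1)) \<and>
                 h w = c + (LINT l:{w<..}|H. (l - w) ^ (k - 1))) \<or>
       (\<forall>w \<ge> 2. set_integrable H {w..} (\<lambda>l. (l - w) ^ (k - 1)) \<and>
                 h w = c + (LINT l:{w..}|H. (l - w) ^ (k - 1)))))"

(* Hyperbolic monotonicity of order k.  For k \<ge> 2 the integral form extends the
   derivative form to functions whose (k-2)-nd derivative has kinks; for k = 1 the
   derivative form says that h is nonnegative and non-increasing, with no one-sided
   continuity required at jumps.  Hence both forms are admitted.  The values of h below 2
   are irrelevant, since v + 1/v \<ge> 2. *)
definition HM :: "nat \<Rightarrow> (real \<Rightarrow> real) \<Rightarrow> bool" where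
  "HM k f \<longleftrightarrow>
    (\<forall>x > 0. 0 \<le> f x) \<and>
    (\<forall>u > 0. \<exists>h :: real \<Rightarrow> real.
      (\<forall>v > 0. h (v + 1 / v) = f (u * v) * f (u / v)) \<and>
      (monotone_order_deriv k h \<or> monotone_order_integral k h))"

definition HM_distributed :: "'a measure \<Rightarrow> nat \<Rightarrow> ('a \<Rightarrow> real) \<Rightarrow> bool" where
  "HM_distributed M k X \<longleftrightarrow>
    (AE \<omega> in M. 0 < X \<omega>) \<and>
    (\<exists>f. HM k f \<and>
      distributed M lborel X (\<lambda>x. ennreal (if 0 < x then f x else 0)))"

(* The Thorin measure U on (0,\<infinity>) is encoded as a Borel measure on the real line that
   gives no mass to (-\<infinity>,0].  Its conditions make ln (t / (t + s)) integrable for every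
   s \<ge> 0, so the Bochner integral in the exponent is never a default value. *)
definition GGC :: "real measure \<Rightarrow> bool" where
  "GGC \<mu> \<longleftrightarrow>
    prob_space \<mu> \<and> sets \<mu> = sets borel \<and> (AE x in \<mu>. 0 \<le> x) \<and>
    (\<exists>(a :: real) (U :: real measure).
      0 \<le> a \<and>
      sets U = sets borel \<and> emeasure U {..0} = 0 \<and>
      (\<forall>K. compact K \<and> K \<subseteq> {0<..} \<longrightarrow> emeasure U K < \<infinity>) \<and>
      (\<integral>\<^sup>+ t\<in>{0<..<1}. ennreal \<bar>ln t\<bar> \<partial>U) < \<infinity> \<and>
      (\<integral>\<^sup>+ t\<in>{1<..}. ennreal (1 / t) \<partial>U) < \<infinity> \<and>
      (\<forall>s \<ge> 0. (LINT x|\<mu>. exp (- s * x)) =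
                exp (- a * s + (LINT t:{0<..}|U. ln (t / (t + s))))))"

end

theory Submission
  imports Defs "HOL-Complex_Analysis.Complex_Analysis" "HOL-Real_Asymp.Real_Asymp"
begin

text \<open>
Let \<open>k = n + 1\<close> and let \<open>\<phi>(z)\<close> be the expectation of \<open>1 / (1 + z V)\<^sup>k\<close>, where \<open>V\<close> is \<open>X\<close> or \<open>1 / X\<close>.
Integrating out the gamma variable shows that \<open>\<phi>\<close> restricted to \<open>(0, \<infinity>)\<close> is the Laplace transform of
\<open>Y V\<close>, while \<open>\<phi>\<close> itself is holomorphic on the plane slit along the negative axis.  Whether the law of
\<open>Y V\<close> is a generalized gamma convolution is decided by one property of this extension: the modulus of
\<open>\<phi>\<close> grows when one moves along a circle from the positive towards the negative axis.  For a genuine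
product of factors \<open>t / (t + z)\<close> with \<open>t > 0\<close> this is visible factor by factor.

The density hypothesis gives this growth (\<open>HM_modulus_mono\<close>).  Write
\<open>\<bar>\<phi>(z)\<bar>\<^sup>2 = \<phi>(z) \<phi>(cnj z)\<close> as a double integral against \<open>f(x) f(y)\<close> and pass to \<open>x = u v\<close>, \<open>y = u / v\<close>.
For fixed \<open>u\<close> the weight becomes \<open>h(v + 1 / v)\<close>, where \<open>h\<close> is a mixture of the
truncated powers \<open>(l - w)\<^sup>n\<close> on \<open>w < l\<close>.  So everything reduces to one truncated power, integrated
against a rational kernel in \<open>v\<close> that depends on \<open>z = r cis \<theta>\<close>.  When \<open>cis \<theta>\<close> is replaced by
a real \<open>t > 0\<close>, a Moebius substitution turns that integral into
\<open>\<integral> (x (1 - x))\<^sup>n / (C(x) + t + 1 / t)\<^sup>k dx\<close> over \<open>[0, 1]\<close> with \<open>C(x) \<ge> 2\<close>.  Both sides are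
holomorphic in \<open>t\<close>, so the identity persists at \<open>t = cis \<theta>\<close>, where \<open>t + 1 / t = 2 cos \<theta>\<close>; the right
hand side is then real and grows as \<open>\<theta>\<close> runs from \<open>0\<close> to \<open>\<pi>\<close>.  The transition from truncated
powers to \<open>h\<close> is a statement about the stop-loss order of measures.  It is made with nonnegative
integrals, separately for each \<open>u\<close>, so \<open>h\<close> may depend on \<open>u\<close> in any way.  The case
\<open>V = 1 / X\<close> is the same after the inversion \<open>z \<mapsto> 1 / z\<close>, which replaces \<open>f(x)\<close> by \<open>x\<^sup>k f(x)\<close>, and this
does not affect hyperbolic monotonicity.

Conversely, growth of the modulus produces the Thorin measure (\<open>thorin_of_monotone_modulus\<close>).  It says
that \<open>F(z) = - z \<phi>'(z) / \<phi>(z)\<close> maps the upper half-plane into itself.  Since \<open>F\<close> also preserves the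
positive axis, the Schwarz lemma gives \<open>arg F(z) \<le> arg z\<close>, and hence \<open>F(q\<^sup>2) / q\<close> has nonnegative
real part on the right half-plane.  The Herglotz representation, obtained from the Poisson
formula and Helly selection, becomes
\<open>F(s) / s = \<integral> 2 / ((1 - c) s + (1 + c)) \<nu>(dc)\<close> for a finite measure \<open>\<nu>\<close> on \<open>[- 1, 1]\<close>.  Integrating in \<open>s\<close>
recovers \<open>- ln \<phi>(s)\<close>: the mass at \<open>c = 1\<close> is the drift, each \<open>c\<close> in \<open>(- 1, 1)\<close> contributes a
logarithm with \<open>t = (1 + c) / (1 - c)\<close>, and \<open>c = - 1\<close> is excluded because \<open>\<phi>(0) = 1\<close>.
\<close>

section \<open>The slit plane\<close>

lemma connected_slit_plane: "connected (- \<real>\<^sub>\<le>\<^sub>0 :: complex set)"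
proof -
  have "(- \<real>\<^sub>\<le>\<^sub>0 :: complex set) = - (complex_of_real ` {..0})"
    by (auto simp: nonpos_Reals_def)
  then show ?thesis
    using starlike_imp_connected[OF starlike_slotted_complex_plane_left[of 0]] by simp
qed

lemma open_slit_plane: "open (- \<real>\<^sub>\<le>\<^sub>0 :: complex set)"
  by (simp add: open_Compl closed_nonpos_Reals_complex)

lemma cis_in_slit_plane:
  assumes "\<bar>\<theta>\<bar> < pi"
  shows "cis \<theta> \<in> - \<real>\<^sub>\<le>\<^sub>0"
proof
  assume "cis \<theta> \<in> \<real>\<^sub>\<le>\<^sub>0"
  then have "cos \<theta> \<le> 0" "sin \<theta> = 0" by (auto simp: complex_nonpos_Reals_iff)
  then have "\<theta> = 0"
    using assms sin_gt_zero[of \<theta>] sin_gt_zero[of "- \<theta>"] by (cases "\<theta> > 0"; cases "\<theta> < 0") auto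
  then show False using \<open>cos \<theta> \<le> 0\<close> by simp
qed

lemma square_in_slit_plane:
  assumes "0 < Re w"
  shows "w\<^sup>2 \<in> - \<real>\<^sub>\<le>\<^sub>0"
proof
  assume "w\<^sup>2 \<in> \<real>\<^sub>\<le>\<^sub>0"
  then have "(Re w)\<^sup>2 - (Im w)\<^sup>2 \<le> 0" "Re w * Im w = 0"
    by (auto simp: complex_nonpos_Reals_iff power2_eq_square)
  with assms show False by auto
qed

text \<open>
A zero would make \<open>t\<close> a root of the real quadratic \<open>\<beta> t\<^sup>2 + \<alpha> t + 1\<close>.  Its discriminant is
nonnegative and its coefficients are nonnegative, so both roots are negative reals.
\<close>
lemma slit_quadratic_nonzero:
  fixes t :: complex and \<alpha> \<beta> :: real
  assumes "t \<in> - \<real>\<^sub>\<le>\<^sub>0" "0 \<le> \<alpha>" "0 < \<beta>" "4 * \<beta> \<le> \<alpha>\<^sup>2"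
  shows "of_real \<alpha> + of_real \<beta> * t + 1 / t \<noteq> 0"
proof
  assume *: "of_real \<alpha> + of_real \<beta> * t + 1 / t = 0"
  have t0: "t \<noteq> 0" using assms(1) by auto
  have q: "of_real \<beta> * t\<^sup>2 + of_real \<alpha> * t + 1 = 0"
  proof -
    have "t * (of_real \<alpha> + of_real \<beta> * t + 1 / t) = of_real \<beta> * t\<^sup>2 + of_real \<alpha> * t + 1"
      using t0 by (simp add: field_simps power2_eq_square)
    then show ?thesis using * by simp
  qed
  define x y where "x = Re t" and "y = Im t"
  have re: "\<beta> * (x\<^sup>2 - y\<^sup>2) + \<alpha> * x + 1 = 0" and im: "y * (2 * \<beta> * x + \<alpha>) = 0"
    using arg_cong[OF q, of Re] arg_cong[OF q, of Im]
    by (simp_all add: x_def y_def power2_eq_square algebra_simps)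
  have "y = 0"
  proof (rule ccontr)
    assume y: "y \<noteq> 0"
    then have "\<alpha> = - 2 * \<beta> * x" using im by auto
    then have "4 * \<beta> \<le> 4 * \<beta>\<^sup>2 * x\<^sup>2" using assms(4) by (simp add: power2_eq_square algebra_simps)
    then have "\<beta> * 1 \<le> \<beta> * (\<beta> * x\<^sup>2)" by (simp add: power2_eq_square algebra_simps)
    then have 1: "1 \<le> \<beta> * x\<^sup>2" using assms(3) mult_le_cancel_left_pos by blast
    have "\<beta> * (x\<^sup>2 - y\<^sup>2) - 2 * \<beta> * x * x + 1 = 0" using re \<open>\<alpha> = _\<close> by simp
    then have "\<beta> * y\<^sup>2 = 1 - \<beta> * x\<^sup>2" by (simp add: power2_eq_square algebra_simps)
    then have "\<beta> * y\<^sup>2 \<le> 0" using 1 by simp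
    moreover have "\<beta> * y\<^sup>2 > 0" using y assms(3) by simp
    ultimately show False by simp
  qed
  moreover have "x < 0"
  proof (rule ccontr)
    assume "\<not> x < 0"
    then have "0 \<le> \<beta> * x\<^sup>2" "0 \<le> \<alpha> * x" using assms by auto
    then show False using re \<open>y = 0\<close> by simp
  qed
  ultimately show False using assms(1) by (auto simp: complex_nonpos_Reals_iff x_def y_def)
qed

text \<open>
The domination used in every limit under the integral sign: \<open>1 / (1 + y v)\<close> and \<open>v / (1 + y v)\<close> stay
bounded, uniformly in \<open>v \<ge> 0\<close> and locally uniformly in \<open>y\<close>.  For large \<open>v\<close> this holds because
\<open>1 + y v = v (y - (- 1 / v))\<close> and \<open>- 1 / v\<close> lies on the slit.
\<close>
lemma slit_plane_linear_lower_bound: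
  fixes z :: complex
  assumes z: "z \<in> - \<real>\<^sub>\<le>\<^sub>0"
  obtains \<delta> where "0 < \<delta>" "ball z \<delta> \<subseteq> - \<real>\<^sub>\<le>\<^sub>0"
    "\<And>y v. y \<in> ball z \<delta> \<Longrightarrow> 0 \<le> v \<Longrightarrow> \<delta> * (1 + v) \<le> norm (1 + y * of_real v)"
proof -
  obtain e where e: "e > 0" "ball z e \<subseteq> - \<real>\<^sub>\<le>\<^sub>0" using open_slit_plane z openE by blast
  define B where "B = norm z + e"
  have B: "B > 0" using e by (simp add: B_def add_nonneg_pos)
  \<comment> \<open>\<open>1 / C\<close> balances the two bounds \<open>(e / 2) v\<close> and \<open>1 - B v\<close> for the modulus.\<close>
  define C where "C = 1 + 2 * B / e + 2 / e"
  have C: "C > 0" using e B by (auto simp: C_def intro!: add_pos_pos)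
  define \<delta> where "\<delta> = min (e/2) (1 / C)"
  have \<delta>: "0 < \<delta>" "\<delta> \<le> e/2" "\<delta> \<le> 1 / C" using e C by (auto simp: \<delta>_def)
  show ?thesis
  proof (rule that[OF \<delta>(1)])
    show "ball z \<delta> \<subseteq> - \<real>\<^sub>\<le>\<^sub>0" using e \<delta> subset_ball[of \<delta> e z] by auto
    fix y and v :: real assume y: "y \<in> ball z \<delta>" and v: "0 \<le> v"
    define m where "m = norm (1 + y * of_real v)"
    have dy: "dist z y < e/2" using y \<delta> by auto
    have 1: "(e/2) * v \<le> m"
    proof (cases "v = 0")
      case False
      define x where "x = complex_of_real (- (1 / v))"
      have "x \<in> \<real>\<^sub>\<le>\<^sub>0" unfolding x_def using v by (subst nonpos_Reals_of_real_iff) auto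
      then have "x \<notin> ball z e" using e by auto
      then have "e \<le> dist z x" by simp
      also have "dist z x \<le> dist z y + dist y x" by (rule dist_triangle)
      finally have "e/2 \<le> dist y x" using dy by linarith
      then have "e/2 * v \<le> dist y x * v" using v by (intro mult_right_mono)
      also have "\<dots> = norm ((y - x) * of_real v)" using v by (simp add: dist_norm norm_mult)
      also have "(y - x) * of_real v = 1 + y * of_real v" using False by (simp add: x_def algebra_simps)
      finally show ?thesis by (simp add: m_def)
    qed (simp add: m_def)
    have 2: "1 - B * v \<le> m"
    proof -
      have "norm y \<le> norm z + dist z y" by (metis dist_norm norm_minus_commute norm_triangle_sub)
      then have "norm y \<le> B" using dy e by (simp add: B_def)
      then have "norm (y * of_real v) \<le> B * v" using v by (simp add: norm_mult mult_right_mono)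
      moreover have "norm (1 :: complex) \<le> m + norm (y * of_real v)"
        unfolding m_def by (metis add_diff_cancel_right' norm_triangle_ineq4)
      ultimately show ?thesis by simp
    qed
    have "v \<le> (2 / e) * m" using 1 e by (simp add: field_simps)
    moreover from this have "B * v \<le> B * ((2 / e) * m)" using B by (intro mult_left_mono) auto
    ultimately have "1 + v \<le> m * C" using 2 by (simp add: C_def algebra_simps)
    then have "(1 + v) / C \<le> m" using C by (simp add: field_simps)
    moreover have "\<delta> * (1 + v) \<le> 1 / C * (1 + v)" using \<delta> v by (intro mult_right_mono) auto
    ultimately show "\<delta> * (1 + v) \<le> norm (1 + y * of_real v)" by (simp add: m_def)
  qed
qed

section \<open>The hyperbolic kernel and a beta integral\<close>

lemma two_le_add_inverse:
  fixes y :: real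
  assumes "0 < y"
  shows "2 \<le> y + 1 / y"
proof -
  have "0 \<le> (y - 1)\<^sup>2 / y" using assms by simp
  also have "(y - 1)\<^sup>2 / y = y + 1/y - 2" using assms by (simp add: field_simps power2_eq_square)
  finally show ?thesis by simp
qed

lemma hyperbolic_discriminant:
  fixes v z :: real
  assumes "0 < z"
  shows "4 * v\<^sup>2 \<le> ((z + 1/z) * v)\<^sup>2"
proof -
  have "0 \<le> (z - 1/z)\<^sup>2 * v\<^sup>2" by simp
  also have "\<dots> = ((z + 1/z) * v)\<^sup>2 - 4 * v\<^sup>2"
    using assms by (simp add: field_simps power2_eq_square)
  finally show ?thesis by simp
qed

lemma hyperbolic_denominator_nonzero:
  fixes v z \<theta> :: real
  assumes "0 < v" "0 < z" "\<bar>\<theta>\<bar> < pi"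
  shows "of_real ((z + 1/z) * v) + of_real (v\<^sup>2) * cis \<theta> + cis (- \<theta>) \<noteq> 0"
proof -
  have "of_real ((z + 1/z) * v) + of_real (v\<^sup>2) * cis \<theta> + 1 / cis \<theta> \<noteq> 0"
    using assms by (intro slit_quadratic_nonzero cis_in_slit_plane hyperbolic_discriminant) auto
  then show ?thesis by (simp add: cis_inverse divide_inverse)
qed

text \<open>
With \<open>z = r u\<close> this is the real part of \<open>((1 + r cis \<theta> x) (1 + r cis (- \<theta>) y))\<close> to the power \<open>- (n + 1)\<close> at
\<open>x = u v\<close>, \<open>y = u / v\<close>, up to the positive factor \<open>(v / z)\<close> to the power \<open>n + 1\<close>.
\<close>
definition hyperbolic_kernel :: "nat \<Rightarrow> real \<Rightarrow> real \<Rightarrow> real \<Rightarrow> real" where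
  "hyperbolic_kernel n z \<theta> v = Re (1 / (of_real ((z + 1/z) * v) + of_real (v\<^sup>2) * cis \<theta> + cis (- \<theta>)) ^ Suc n)"

lemma hyperbolic_kernel_measurable[measurable]: "hyperbolic_kernel n z \<theta> \<in> borel_measurable borel"
  unfolding hyperbolic_kernel_def[abs_def] by measurable

lemma hyperbolic_kernel_continuous:
  assumes "0 < z" "\<bar>\<theta>\<bar> < pi"
  shows "continuous_on {0<..} (hyperbolic_kernel n z \<theta>)"
  unfolding hyperbolic_kernel_def[abs_def]
  by (intro continuous_intros) (use hyperbolic_denominator_nonzero[OF _ assms] in auto)

text \<open>
The substitution is the Moebius map of \<open>[0, 1]\<close> onto \<open>[a, b]\<close> with
\<open>(v - a) / (b - v) = (x / (1 - x)) ((a + p) / (b + p))\<close>.  It sends the three linear factors \<open>b - v\<close>,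
\<open>v - a\<close>, \<open>v + p\<close> to \<open>1 - x\<close>, \<open>x\<close> and a constant over a common denominator, which cancels; only
\<open>v + q\<close> keeps a numerator depending on \<open>x\<close>.
\<close>
lemma beta_integral_moebius:
  fixes a b p q :: real
  assumes ab: "0 < a" "a < b" and pq: "0 < p" "0 < q"
  shows "integral {a..b} (\<lambda>v. ((b - v) * (v - a)) ^ n / ((v + p) * (v + q)) ^ Suc n) =
         (b - a) ^ (2 * n + 1) * integral {0..1} (\<lambda>x. (x * (1 - x)) ^ n /
            (x * ((a + p) * (b + q)) + (1 - x) * ((a + q) * (b + p))) ^ Suc n)"
proof -
  define f where "f v = ((b - v) * (v - a)) ^ n / ((v + p) * (v + q)) ^ Suc n" for v
  define D where "D x = (1 - x) * (b + p) + x * (a + p)" for x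
  define g where "g x = (a * (1 - x) * (b + p) + b * x * (a + p)) / D x" for x
  define R where "R x = x * ((a + p) * (b + q)) + (1 - x) * ((a + q) * (b + p))" for x
  have Dpos: "D x > 0" if "x \<in> {0..1}" for x
  proof (cases "x = 1")
    case False
    then have "(1 - x) * (b + p) > 0" "x * (a + p) \<ge> 0" using that ab pq by auto
    then show ?thesis by (simp add: D_def)
  qed (use ab pq in \<open>simp add: D_def\<close>)
  have ga: "g x - a = (b - a) * x * (a + p) / D x" and gb: "b - g x = (b - a) * (1 - x) * (b + p) / D x"
    and gp: "g x + p = (a + p) * (b + p) / D x" and gq: "g x + q = R x / D x"
    if "x \<in> {0..1}" for x
    using Dpos[OF that] by (simp_all add: g_def field_simps R_def) (simp_all add: D_def algebra_simps)
  have gd: "(g has_field_derivative ((b - a) * (a + p) * (b + p) / (D x)\<^sup>2)) (at x within {0..1})"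
    if "x \<in> {0..1}" for x
    unfolding g_def using Dpos[OF that]
    by (auto intro!: derivative_eq_intros simp: D_def) (simp add: field_simps power2_eq_square)
  have Rpos: "R x > 0" if "x \<in> {0..1}" for x
  proof (cases "x = 1")
    case False
    then have "(1 - x) * ((a + q) * (b + p)) > 0" "x * ((a + p) * (b + q)) \<ge> 0" using that ab pq by auto
    then show ?thesis by (simp add: R_def)
  qed (use ab pq in \<open>simp add: R_def\<close>)
  have "((\<lambda>x. ((b - a) * (a + p) * (b + p) / (D x)\<^sup>2) *\<^sub>R f (g x)) has_integral integral {g 0..g 1} f) {0..1}"
  proof (rule has_integral_substitution[where c = a and d = b])
    show "g 0 \<le> g 1" using ab pq by (simp add: g_def D_def)
    show "g ` {0..1} \<subseteq> {a..b}"
    proof safe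
      fix x :: real assume x: "x \<in> {0..1}"
      have "0 \<le> g x - a" "0 \<le> b - g x"
        unfolding ga[OF x] gb[OF x] using x ab pq Dpos[OF x] by auto
      then show "g x \<in> {a..b}" by simp
    qed
    show "continuous_on {a..b} f"
      unfolding f_def using ab pq by (auto intro!: continuous_intros simp: add_pos_pos less_imp_neq[symmetric])
  qed (use gd in auto)
  moreover have "((b - a) * (a + p) * (b + p) / (D x)\<^sup>2) *\<^sub>R f (g x) =
      (b - a) ^ (2 * n + 1) * ((x * (1 - x)) ^ n / R x ^ Suc n)" if x: "x \<in> {0..1}" for x
  proof -
    have D: "D x \<noteq> 0" "R x \<noteq> 0" using Dpos[OF x] Rpos[OF x] by auto
    define C where "C = (a + p) * (b + p) / (D x)\<^sup>2"
    have C: "C \<noteq> 0" using ab pq D by (simp add: C_def)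
    have "f (g x) = (((b - a) * (1 - x) * (b + p) / D x) * ((b - a) * x * (a + p) / D x)) ^ n /
        (((a + p) * (b + p) / D x) * (R x / D x)) ^ Suc n"
      by (simp add: f_def ga[OF x] gb[OF x] gp[OF x] gq[OF x])
    also have "\<dots> = ((b - a)\<^sup>2 * (x * (1 - x)) * C) ^ n / (C * R x) ^ Suc n"
      unfolding C_def by (simp add: power2_eq_square mult_ac)
    finally have "(b - a) * C * f (g x) = (b - a) * C * (((b - a)\<^sup>2 * (x * (1 - x)) * C) ^ n / (C * R x) ^ Suc n)"
      by simp
    also have "\<dots> = (b - a) ^ (2 * n + 1) * ((x * (1 - x)) ^ n / R x ^ Suc n)"
      using D C by (simp add: power_mult_distrib power_mult)
    finally show ?thesis by (simp add: C_def mult_ac)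
  qed
  ultimately have "((\<lambda>x. (b - a) ^ (2 * n + 1) * ((x * (1 - x)) ^ n / R x ^ Suc n)) has_integral integral {g 0..g 1} f) {0..1}"
    by (rule has_integral_eq[rotated])
  moreover have "g 0 = a" "g 1 = b" using ab pq by (simp_all add: g_def D_def)
  ultimately have "integral {a..b} f = integral {0..1} (\<lambda>x. (b - a) ^ (2 * n + 1) * ((x * (1 - x)) ^ n / R x ^ Suc n))"
    by (simp add: integral_unique)
  also have "\<dots> = (b - a) ^ (2 * n + 1) * integral {0..1} (\<lambda>x. (x * (1 - x)) ^ n / R x ^ Suc n)"
    by (rule integral_mult_right)
  finally show ?thesis unfolding f_def[abs_def] R_def .
qed

lemma has_field_derivative_divide_power:
  fixes g :: "complex \<Rightarrow> complex"
  assumes "(g has_field_derivative g') (at z within A)" "g z \<noteq> 0"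
  shows "((\<lambda>z. c / g z ^ Suc n) has_field_derivative (- of_nat (Suc n) * c * g' / g z ^ (n + 2))) (at z within A)"
proof -
  have "((\<lambda>z. g z ^ Suc n) has_field_derivative (of_nat (Suc n) * (g' * g z ^ n))) (at z within A)"
    using DERIV_power[OF assms(1), of "Suc n"] by simp
  then have "((\<lambda>z. c / g z ^ Suc n) has_field_derivative
      (0 * g z ^ Suc n - c * (of_nat (Suc n) * (g' * g z ^ n))) / (g z ^ Suc n * g z ^ Suc n)) (at z within A)"
    using assms(2) by (intro DERIV_divide) auto
  moreover have "(0 * g z ^ Suc n - c * (of_nat (Suc n) * (g' * g z ^ n))) / (g z ^ Suc n * g z ^ Suc n)
     = - of_nat (Suc n) * c * g' / g z ^ (n + 2)"
    using assms(2) by (simp add: power_add divide_simps) (simp add: power2_eq_square algebra_simps)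
  ultimately show ?thesis by (simp only:)
qed

text \<open>
Both sides of the identity below have this shape, with \<open>(\<alpha>, \<beta>) = ((z + 1 / z) v, v\<^sup>2)\<close> and
\<open>\<beta> = 1\<close> respectively.
\<close>
lemma holomorphic_beta_integral:
  fixes w \<alpha> \<beta> :: "real \<Rightarrow> real"
  assumes cont: "continuous_on {a..b} w" "continuous_on {a..b} \<alpha>" "continuous_on {a..b} \<beta>"
    and nz: "\<And>v. v \<in> {a..b} \<Longrightarrow> 0 \<le> \<alpha> v \<and> 0 < \<beta> v \<and> 4 * \<beta> v \<le> (\<alpha> v)\<^sup>2"
  shows "(\<lambda>t. integral {a..b} (\<lambda>v. of_real (w v) / (of_real (\<alpha> v) + of_real (\<beta> v) * t + 1 / t) ^ Suc n))
           holomorphic_on (- \<real>\<^sub>\<le>\<^sub>0)"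
proof -
  let ?D = "\<lambda>t v. of_real (\<alpha> v) + of_real (\<beta> v) * t + 1 / t :: complex"
  let ?f = "\<lambda>t v. of_real (w v) / ?D t v ^ Suc n"
  let ?f' = "\<lambda>t v. - of_nat (Suc n) * of_real (w v) * (of_real (\<beta> v) - 1 / t ^ 2) / ?D t v ^ (n + 2)"
  have D: "?D t v \<noteq> 0" if "t \<in> - \<real>\<^sub>\<le>\<^sub>0" "v \<in> {a..b}" for t v
    using slit_quadratic_nonzero[OF that(1)] nz[OF that(2)] by blast
  have "(\<lambda>t. integral {a..b} (?f t)) field_differentiable at t" if t: "t \<in> - \<real>\<^sub>\<le>\<^sub>0" for t
  proof -
    obtain e where e: "e > 0" "ball t e \<subseteq> - \<real>\<^sub>\<le>\<^sub>0"
      using open_slit_plane t openE by blast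
    have "(\<lambda>t. integral (cbox a b) (?f t)) holomorphic_on ball t e"
    proof (rule leibniz_rule_holomorphic[where fx = ?f'])
      show "((\<lambda>x. ?f x v) has_field_derivative ?f' x v) (at x within ball t e)"
        if "x \<in> ball t e" "v \<in> cbox a b" for x v
      proof -
        have "x \<in> - \<real>\<^sub>\<le>\<^sub>0" using that e by auto
        then have x: "?D x v \<noteq> 0" "x \<noteq> 0" using D[of x v] that by auto
        have 1: "((\<lambda>x. ?D x v) has_field_derivative (of_real (\<beta> v) - 1 / x ^ 2)) (at x within ball t e)"
          using x by (auto intro!: derivative_eq_intros simp: power2_eq_square)
        show ?thesis
          by (rule has_field_derivative_divide_power[OF 1 x(1)])
      qed
      show "(?f x) integrable_on cbox a b" if "x \<in> ball t e" for x
        using D that e cont by (intro integrable_continuous) (auto intro!: continuous_intros)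
      have c: "continuous_on (ball t e \<times> cbox a b) (\<lambda>x. g (snd x))" if "continuous_on {a..b} g" for g :: "real \<Rightarrow> real"
        using that by (auto intro!: continuous_on_compose2[OF that] continuous_intros)
      show "continuous_on (ball t e \<times> cbox a b) (\<lambda>(x, v). ?f' x v)"
        unfolding case_prod_unfold using D e
        by (intro continuous_intros c cont) auto
    qed auto
    then show ?thesis using e by (auto simp: holomorphic_on_open field_differentiable_def)
  qed
  then show ?thesis by (simp add: holomorphic_on_def field_differentiable_at_within)
qed

lemma hk_integral_of_real:
  fixes f :: "real \<Rightarrow> real"
  shows "integral S (\<lambda>x. complex_of_real (f x)) = of_real (integral S f)"
proof (cases "f integrable_on S")
  case True
  then show ?thesis using integral_linear[OF True bounded_linear_of_real] by (simp add: o_def)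
next
  case False
  have "\<not> (\<lambda>x. complex_of_real (f x)) integrable_on S"
    using False integrable_linear[OF _ bounded_linear_Re, of "\<lambda>x. complex_of_real (f x)" S] by (auto simp: o_def)
  then show ?thesis using False by (simp add: not_integrable_integral)
qed

lemma beta_denominator_ge_2:
  fixes b z x :: real
  assumes "0 < b" "0 < z" "x \<in> {0..1}"
  shows "2 \<le> x * (b * z + 1 / (b * z)) + (1 - x) * (b / z + z / b)"
proof -
  have "x * 2 \<le> x * (b * z + 1 / (b * z))"
    using assms two_le_add_inverse[of "b * z"] by (intro mult_left_mono) auto
  moreover have "(1 - x) * 2 \<le> (1 - x) * (b / z + z / b)"
    using assms two_le_add_inverse[of "b / z"] by (intro mult_left_mono) auto
  ultimately show ?thesis by argo
qed

text \<open>
For real \<open>t > 0\<close> one has \<open>(z + 1 / z) v + v\<^sup>2 t + 1 / t = t (v + z / t) (v + 1 / (z t))\<close>, so this is the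
previous substitution with \<open>a = 1 / b\<close>; the products of the end points with \<open>p\<close> and \<open>q\<close> then combine to \<open>t + 1 / t\<close> plus a
constant.  The Moebius map is not real for complex \<open>t\<close>, hence analytic continuation.
\<close>
lemma hyperbolic_integral_slit_plane:
  fixes b z :: real and t :: complex
  assumes b: "1 < b" and z: "0 < z" and t: "t \<in> - \<real>\<^sub>\<le>\<^sub>0"
  shows "integral {1/b..b} (\<lambda>v. of_real (((b - v) * (v - 1/b)) ^ n) /
            (of_real ((z + 1/z) * v) + of_real (v\<^sup>2) * t + 1 / t) ^ Suc n) =
         of_real ((b - 1/b) ^ (2 * n + 1)) * integral {0..1} (\<lambda>x. of_real ((x * (1 - x)) ^ n) /
            (of_real (x * (b * z + 1 / (b * z)) + (1 - x) * (b / z + z / b)) + of_real 1 * t + 1 / t) ^ Suc n)"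
    (is "?L t = ?R t")
proof -
  let ?S = "- \<real>\<^sub>\<le>\<^sub>0 :: complex set"
  have hL: "?L holomorphic_on ?S"
  proof (rule holomorphic_beta_integral)
    fix v assume v: "v \<in> {1/b..b}"
    have "v > 0" using v b by (auto intro: less_le_trans[of 0 "1/b" v])
    then show "0 \<le> (z + 1/z) * v \<and> 0 < v\<^sup>2 \<and> 4 * v\<^sup>2 \<le> ((z + 1/z) * v)\<^sup>2"
      using z hyperbolic_discriminant[OF z] by simp
  qed (auto intro!: continuous_intros)
  have hR: "?R holomorphic_on ?S"
  proof (rule holomorphic_on_mult[OF holomorphic_on_const holomorphic_beta_integral])
    fix x :: real assume x: "x \<in> {0..1}"
    have "2 \<le> x * (b * z + 1 / (b * z)) + (1 - x) * (b / z + z / b)" (is "_ \<le> ?c")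
      using beta_denominator_ge_2[OF _ z x] b by simp
    moreover from this have "2\<^sup>2 \<le> ?c\<^sup>2" by (intro power_mono) auto
    ultimately show "0 \<le> ?c \<and> (0::real) < 1 \<and> 4 * 1 \<le> ?c\<^sup>2" by simp
  qed (auto intro!: continuous_intros)
  have real: "?L (of_real r) = ?R (of_real r)" if r: "0 < r" for r
  proof -
    have q0: "(r :: real) \<noteq> 0" "z \<noteq> 0" "b \<noteq> 0" using r z b by auto
    have "integral {1/b..b} (\<lambda>v. ((b - v) * (v - 1/b)) ^ n / ((v + z / r) * (v + 1 / (z * r))) ^ Suc n) =
         (b - 1/b) ^ (2 * n + 1) * integral {0..1} (\<lambda>x. (x * (1 - x)) ^ n /
            (x * ((1/b + z / r) * (b + 1 / (z * r))) + (1 - x) * ((1/b + 1 / (z * r)) * (b + z / r))) ^ Suc n)"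
    proof (rule beta_integral_moebius)
      show "1 / b < b" using b less_trans[of "1/b" 1 b] by simp
    qed (use b z r in auto)
    moreover have "(v + z / r) * (v + 1 / (z * r)) = ((z + 1/z) * v + v\<^sup>2 * r + 1 / r) / r" for v
      using q0 by (simp add: field_simps power2_eq_square)
    moreover have "x * ((1/b + z / r) * (b + 1 / (z * r))) + (1 - x) * ((1/b + 1 / (z * r)) * (b + z / r))
        = (x * (b * z + 1 / (b * z)) + (1 - x) * (b / z + z / b) + 1 * r + 1 / r) / r" for x
      using q0 by (simp add: field_simps power2_eq_square)
    ultimately have "integral {1/b..b} (\<lambda>v. ((b - v) * (v - 1/b)) ^ n / ((z + 1/z) * v + v\<^sup>2 * r + 1 / r) ^ Suc n * r ^ Suc n) =
         (b - 1/b) ^ (2 * n + 1) * integral {0..1} (\<lambda>x. (x * (1 - x)) ^ n /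
            (x * (b * z + 1 / (b * z)) + (1 - x) * (b / z + z / b) + 1 * r + 1 / r) ^ Suc n * r ^ Suc n)"
      by (simp only: power_divide divide_divide_eq_right times_divide_eq_left)
    then have eq: "integral {1/b..b} (\<lambda>v. ((b - v) * (v - 1/b)) ^ n / ((z + 1/z) * v + v\<^sup>2 * r + 1 / r) ^ Suc n) =
         (b - 1/b) ^ (2 * n + 1) * integral {0..1} (\<lambda>x. (x * (1 - x)) ^ n /
            (x * (b * z + 1 / (b * z)) + (1 - x) * (b / z + z / b) + 1 * r + 1 / r) ^ Suc n)"
      using q0 by (simp only: integral_mult_left) simp
    have c: "of_real w / (of_real \<alpha> + of_real \<beta> * of_real r + 1 / of_real r) ^ Suc n =
        complex_of_real (w / (\<alpha> + \<beta> * r + 1 / r) ^ Suc n)" for w \<alpha> \<beta> :: real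
      by simp
    show ?thesis
      unfolding c hk_integral_of_real
      unfolding of_real_mult[symmetric] of_real_eq_iff by (rule eq)
  qed
  have "?L t - ?R t = 0"
  proof (rule analytic_continuation[where f = "\<lambda>t. ?L t - ?R t" and S = ?S and U = "of_real ` {0<..}" and \<xi> = 1])
    show "(\<lambda>t. ?L t - ?R t) holomorphic_on ?S" using hL hR by (rule holomorphic_on_diff)
    show "of_real ` {0<..} \<subseteq> ?S" by (auto simp: complex_nonpos_Reals_iff)
    show "(1::complex) islimpt of_real ` {0<..}"
      unfolding islimpt_approachable
    proof safe
      fix e :: real assume "e > 0"
      then have "dist (complex_of_real (1 + e/2)) 1 = e/2" by (simp add: dist_norm)
      moreover have "complex_of_real (1 + e/2) \<in> complex_of_real ` {0<..}" using \<open>e > 0\<close> by (intro imageI) simp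
      ultimately show "\<exists>x'\<in>complex_of_real ` {0<..}. x' \<noteq> 1 \<and> dist x' 1 < e"
        using \<open>e > 0\<close> by (intro bexI[of _ "of_real (1 + e/2)"]) auto
    qed
  qed (use real t open_slit_plane connected_slit_plane in auto)
  then show ?thesis by simp
qed

lemma hyperbolic_kernel_integral:
  fixes b z \<theta> :: real
  assumes b: "1 < b" and z: "0 < z" and \<theta>: "\<bar>\<theta>\<bar> < pi"
  shows "integral {1/b..b} (\<lambda>v. ((b - v) * (v - 1/b)) ^ n * hyperbolic_kernel n z \<theta> v) =
         (b - 1/b) ^ (2 * n + 1) * integral {0..1} (\<lambda>x. (x * (1 - x)) ^ n /
            (x * (b * z + 1 / (b * z)) + (1 - x) * (b / z + z / b) + 2 * cos \<theta>) ^ Suc n)"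
proof -
  define t where "t = cis \<theta>"
  have "t \<in> - \<real>\<^sub>\<le>\<^sub>0" unfolding t_def by (rule cis_in_slit_plane[OF \<theta>])
  have ti: "1 / t = cis (- \<theta>)" by (simp add: t_def cis_inverse divide_inverse)
  have tsum: "t + 1 / t = of_real (2 * cos \<theta>)" unfolding ti by (simp add: t_def complex_eq_iff)
  define f where "f v = of_real (((b - v) * (v - 1/b)) ^ n) /
            (of_real ((z + 1/z) * v) + of_real (v\<^sup>2) * t + 1 / t) ^ Suc n" for v
  have "f integrable_on {1/b..b}"
  proof (rule integrable_continuous_interval)
    have "of_real ((z + 1/z) * v) + of_real (v\<^sup>2) * t + 1 / t \<noteq> 0" if v: "v \<in> {1/b..b}" for v
    proof -
      have "0 < v" using v b by (auto intro: less_le_trans[of 0 "1/b" v])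
      from hyperbolic_denominator_nonzero[OF this z \<theta>] show ?thesis by (simp add: t_def[symmetric] ti)
    qed
    then show "continuous_on {1/b..b} f"
      unfolding f_def by (intro continuous_intros) auto
  qed
  then have "integral {1/b..b} (\<lambda>v. Re (f v)) = Re (integral {1/b..b} f)"
    using integral_linear[OF _ bounded_linear_Re] by (simp add: o_def)
  also have "integral {1/b..b} f = of_real ((b - 1/b) ^ (2 * n + 1)) * integral {0..1} (\<lambda>x. of_real ((x * (1 - x)) ^ n) /
            (of_real (x * (b * z + 1 / (b * z)) + (1 - x) * (b / z + z / b)) + of_real 1 * t + 1 / t) ^ Suc n)"
    unfolding f_def by (rule hyperbolic_integral_slit_plane[OF b z \<open>t \<in> _\<close>])
  also have "(\<lambda>x. of_real ((x * (1 - x)) ^ n) /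
            (of_real (x * (b * z + 1 / (b * z)) + (1 - x) * (b / z + z / b)) + of_real 1 * t + 1 / t) ^ Suc n) =
         (\<lambda>x. complex_of_real ((x * (1 - x)) ^ n /
            (x * (b * z + 1 / (b * z)) + (1 - x) * (b / z + z / b) + 2 * cos \<theta>) ^ Suc n))"
    (is "?l = ?r")
  proof
    fix x
    have "of_real (x * (b * z + 1 / (b * z)) + (1 - x) * (b / z + z / b)) + of_real 1 * t + 1 / t =
        complex_of_real (x * (b * z + 1 / (b * z)) + (1 - x) * (b / z + z / b) + 2 * cos \<theta>)"
      using tsum by (simp add: add.assoc)
    then show "?l x = ?r x" by (simp only: of_real_divide of_real_power)
  qed
  also have "Re (of_real ((b - 1/b) ^ (2 * n + 1)) * integral {0..1} ?r) = (b - 1/b) ^ (2 * n + 1) * integral {0..1} (\<lambda>x. (x * (1 - x)) ^ n /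
            (x * (b * z + 1 / (b * z)) + (1 - x) * (b / z + z / b) + 2 * cos \<theta>) ^ Suc n)"
    unfolding hk_integral_of_real by (simp only: of_real_mult[symmetric] Re_complex_of_real)
  finally have 1: "integral {1/b..b} (\<lambda>v. Re (f v)) = (b - 1/b) ^ (2 * n + 1) * integral {0..1} (\<lambda>x. (x * (1 - x)) ^ n /
            (x * (b * z + 1 / (b * z)) + (1 - x) * (b / z + z / b) + 2 * cos \<theta>) ^ Suc n)" .
  have "Re (f v) = ((b - v) * (v - 1/b)) ^ n * hyperbolic_kernel n z \<theta> v" for v
  proof -
    have "Re (of_real r * (1 / w)) = r * Re (1 / w)" for r w
      by (simp only: times_complex.sel Re_complex_of_real Im_complex_of_real mult_zero_left diff_0_right)
    then show ?thesis unfolding hyperbolic_kernel_def f_def ti[symmetric] t_def[symmetric] by (simp only: times_divide_eq_right mult_1_right)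
  qed
  then show ?thesis using 1 by simp
qed

text \<open>
The point of the whole computation: after the substitution \<open>\<theta>\<close> enters only through \<open>2 cos \<theta>\<close>
in a positive denominator.
\<close>
lemma hyperbolic_kernel_integral_mono:
  fixes b z \<theta> \<theta>' :: real
  assumes b: "1 < b" and z: "0 < z" and \<theta>: "0 \<le> \<theta>" "\<theta> \<le> \<theta>'" "\<theta>' < pi"
  shows "integral {1/b..b} (\<lambda>v. ((b - v) * (v - 1/b)) ^ n * hyperbolic_kernel n z \<theta> v) \<le>
         integral {1/b..b} (\<lambda>v. ((b - v) * (v - 1/b)) ^ n * hyperbolic_kernel n z \<theta>' v)"
proof -
  define C where "C x = x * (b * z + 1 / (b * z)) + (1 - x) * (b / z + z / b)" for x
  have C: "2 \<le> C x" if "x \<in> {0..1}" for x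
    unfolding C_def using beta_denominator_ge_2[OF _ z that] b by simp
  have cosgt: "- 1 < cos y" if "0 \<le> y" "y < pi" for y
    using cos_monotone_0_pi[of y pi] that by simp
  have pos: "0 < C x + 2 * cos y" if "x \<in> {0..1}" "0 \<le> y" "y < pi" for x y
    using C[OF that(1)] cosgt[OF that(2,3)] by linarith
  have int: "(\<lambda>x. (x * (1 - x)) ^ n / (C x + 2 * cos y) ^ Suc n) integrable_on {0..1}" if "0 \<le> y" "y < pi" for y
  proof (rule integrable_continuous_interval)
    have "continuous_on {0..1} C" unfolding C_def by (intro continuous_intros)
    then show "continuous_on {0..1} (\<lambda>x. (x * (1 - x)) ^ n / (C x + 2 * cos y) ^ Suc n)"
      using pos[OF _ that] by (auto intro!: continuous_intros simp: less_imp_neq[symmetric])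
  qed
  have "integral {0..1} (\<lambda>x. (x * (1 - x)) ^ n / (C x + 2 * cos \<theta>) ^ Suc n) \<le>
        integral {0..1} (\<lambda>x. (x * (1 - x)) ^ n / (C x + 2 * cos \<theta>') ^ Suc n)"
  proof (intro integral_le int)
    fix x :: real assume x: "x \<in> {0..1}"
    have "cos \<theta>' \<le> cos \<theta>" using \<theta> by (intro cos_monotone_0_pi_le) auto
    then show "(x * (1 - x)) ^ n / (C x + 2 * cos \<theta>) ^ Suc n \<le> (x * (1 - x)) ^ n / (C x + 2 * cos \<theta>') ^ Suc n"
      using pos[OF x, of \<theta>'] pos[OF x, of \<theta>] x \<theta>
      by (intro divide_left_mono power_mono mult_pos_pos zero_less_power) auto
  qed (use \<theta> in auto)
  moreover have "0 \<le> (b - 1/b) ^ (2 * n + 1)" using b by (intro zero_le_power) (simp add: field_simps less_1_mult less_imp_le)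
  ultimately show ?thesis
    using \<theta> by (subst (1 2) hyperbolic_kernel_integral[OF b z, folded C_def]) (auto intro: mult_left_mono)
qed

section \<open>Functions of monotonicity order k and the stop-loss order\<close>

lemma sigma_finite_of_locally_finite:
  fixes \<alpha> :: "real measure"
  assumes [measurable_cong]: "sets \<alpha> = sets borel" and fin: "\<And>l. emeasure \<alpha> {..l} < \<infinity>"
  shows "sigma_finite_measure \<alpha>"
proof
  have "\<Union> (range (\<lambda>m::nat. {..real m})) = UNIV"
    by (auto simp: real_arch_simple)
  then show "\<exists>A. countable A \<and> A \<subseteq> sets \<alpha> \<and> \<Union> A = space \<alpha> \<and> (\<forall>a\<in>A. emeasure \<alpha> a \<noteq> \<infinity>)"
    using fin sets_eq_imp_space_eq[OF assms(1)]
    by (intro exI[of _ "range (\<lambda>m::nat. {..real m})"]) (auto simp: assms(1) less_top[symmetric])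
qed

definition stop_loss :: "nat \<Rightarrow> real \<Rightarrow> real \<Rightarrow> ennreal" where
  "stop_loss n l w = (if w < l then ennreal ((l - w) ^ n) else 0)"

lemma stop_loss_measurable[measurable]: "(\<lambda>(l, w). stop_loss n l w) \<in> borel_measurable (borel \<Otimes>\<^sub>M borel)"
  "stop_loss n l \<in> borel_measurable borel"
  unfolding stop_loss_def by measurable

text \<open>
The measures to be compared are laws of \<open>v + 1 / v \<ge> 2\<close>.  Without atoms, the jumps of a monotone
function and the end points of intervals have measure zero, so that open and closed intervals give the
same mixtures of truncated powers.
\<close>
definition diffuse_above_2 :: "real measure \<Rightarrow> bool" where
  "diffuse_above_2 \<alpha> \<longleftrightarrow> sets \<alpha> = sets borel \<and> (\<forall>l. emeasure \<alpha> {..l} < \<infinity>) \<and>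
     (AE w in \<alpha>. 2 < w) \<and> (\<forall>l. AE w in \<alpha>. w \<noteq> l)"

text \<open>
The stop-loss order of degree \<open>n\<close>, reflected so that \<open>w\<close> lies below the retention \<open>l\<close>; the case
\<open>n = 0\<close> compares distribution functions.
\<close>
definition stop_loss_le :: "nat \<Rightarrow> real measure \<Rightarrow> real measure \<Rightarrow> bool" where
  "stop_loss_le n \<alpha> \<beta> \<longleftrightarrow> diffuse_above_2 \<alpha> \<and> diffuse_above_2 \<beta> \<and>
     (\<forall>l>2. (\<integral>\<^sup>+w. stop_loss n l w \<partial>\<alpha>) \<le> (\<integral>\<^sup>+w. stop_loss n l w \<partial>\<beta>))"

lemma diffuse_above_2D:
  assumes "diffuse_above_2 \<alpha>"
  shows "sets \<alpha> = sets borel" "emeasure \<alpha> {..l} < \<infinity>" "AE w in \<alpha>. 2 < w" "AE w in \<alpha>. w \<noteq> l" "sigma_finite_measure \<alpha>"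
  using assms by (auto simp: diffuse_above_2_def intro: sigma_finite_of_locally_finite)

text \<open>
Constants are increasing limits of normalised truncated powers \<open>(1 - w / l)\<^sup>n\<close> as \<open>l\<close> grows.
\<close>
lemma stop_loss_le_total:
  assumes "stop_loss_le n \<alpha> \<beta>"
  shows "(\<integral>\<^sup>+w. c \<partial>\<alpha>) \<le> (\<integral>\<^sup>+w. c \<partial>\<beta>)"
proof -
  have \<alpha>: "diffuse_above_2 \<alpha>" and \<beta>: "diffuse_above_2 \<beta>"
    and base: "\<And>l. 2 < l \<Longrightarrow> (\<integral>\<^sup>+w. stop_loss n l w \<partial>\<alpha>) \<le> (\<integral>\<^sup>+w. stop_loss n l w \<partial>\<beta>)"
    using assms by (auto simp: stop_loss_le_def)
  define q where "q m w = ennreal ((1 / (real m + 3)) ^ n) * stop_loss n (real m + 3) w" for m w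
  have q_eq: "q m w = (if w < real m + 3 then ennreal ((1 - w / (real m + 3)) ^ n) else 0)" for m w
  proof -
    have "1 - w / (real m + 3) = 1 / (real m + 3) * (real m + 3 - w)" by (simp add: field_simps)
    then have "(1 - w / (real m + 3)) ^ n = (1 / (real m + 3)) ^ n * (real m + 3 - w) ^ n"
      by (simp only: power_mult_distrib)
    then show ?thesis by (simp add: q_def stop_loss_def ennreal_mult')
  qed
  have q_meas[measurable]: "q m \<in> borel_measurable borel" for m unfolding q_def by measurable
  have q_inc: "q m w \<le> q (Suc m) w" if "2 < w" for m w
    unfolding q_eq using that by (auto intro!: ennreal_leI power_mono divide_left_mono)
  have q_sup: "(SUP m. q m w) = 1" if w: "2 < w" for w
  proof (rule LIMSEQ_unique[OF LIMSEQ_SUP])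
    show "incseq (\<lambda>m. q m w)" by (rule incseq_SucI) (rule q_inc[OF w])
    have "(\<lambda>m. ennreal ((1 - w / (real m + 3)) ^ n)) \<longlonglongrightarrow> ennreal ((1 - 0) ^ n)"
      by (intro tendsto_ennrealI tendsto_intros) real_asymp
    moreover have "\<forall>\<^sub>F m in sequentially. q m w = ennreal ((1 - w / (real m + 3)) ^ n)"
    proof -
      obtain N :: nat where "w < real N" using reals_Archimedean2 by blast
      then show ?thesis unfolding q_eq eventually_sequentially by (intro exI[of _ N]) auto
    qed
    ultimately show "(\<lambda>m. q m w) \<longlonglongrightarrow> 1" by (simp add: tendsto_cong)
  qed
  have total: "(\<integral>\<^sup>+w. 1 \<partial>\<gamma>) = (SUP m. \<integral>\<^sup>+w. q m w \<partial>\<gamma>)" if \<gamma>: "diffuse_above_2 \<gamma>" for \<gamma>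
  proof -
    note [measurable_cong] = diffuse_above_2D(1)[OF \<gamma>]
    have "(\<integral>\<^sup>+w. 1 \<partial>\<gamma>) = (\<integral>\<^sup>+w. (SUP m. q m w) \<partial>\<gamma>)"
      using diffuse_above_2D(3)[OF \<gamma>] by (intro nn_integral_cong_AE) (auto elim!: eventually_mono simp: q_sup)
    also have "\<dots> = (SUP m. \<integral>\<^sup>+w. q m w \<partial>\<gamma>)"
      using diffuse_above_2D(3)[OF \<gamma>]
      by (intro nn_integral_monotone_convergence_SUP_AE) (auto elim!: eventually_mono simp: q_inc)
    finally show ?thesis .
  qed
  note [measurable_cong] = diffuse_above_2D(1)[OF \<alpha>] diffuse_above_2D(1)[OF \<beta>]
  have "(\<integral>\<^sup>+w. q m w \<partial>\<alpha>) \<le> (\<integral>\<^sup>+w. q m w \<partial>\<beta>)" for m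
    unfolding q_def by (simp add: nn_integral_cmult base mult_left_mono)
  then have "(\<integral>\<^sup>+w. 1 \<partial>\<alpha>) \<le> (\<integral>\<^sup>+w. 1 \<partial>\<beta>)"
    unfolding total[OF \<alpha>] total[OF \<beta>] by (intro SUP_mono) auto
  then have "c * (\<integral>\<^sup>+w. 1 \<partial>\<alpha>) \<le> c * (\<integral>\<^sup>+w. 1 \<partial>\<beta>)" by (rule mult_left_mono) simp
  then show ?thesis by simp
qed

text \<open>
Tonelli's theorem; the \<open>\<sigma>\<close>-finiteness of \<open>\<alpha>\<close> and \<open>\<beta>\<close> comes from the local finiteness in
\<open>diffuse_above_2\<close>.
\<close>
lemma stop_loss_le_mixture:
  assumes le: "stop_loss_le n \<alpha> \<beta>" and \<nu>: "sigma_finite_measure \<nu>"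
    and q[measurable]: "(\<lambda>(x, w). q x w) \<in> borel_measurable (\<nu> \<Otimes>\<^sub>M borel)"
    and each: "\<And>x. x \<in> space \<nu> \<Longrightarrow> (\<integral>\<^sup>+w. q x w \<partial>\<alpha>) \<le> (\<integral>\<^sup>+w. q x w \<partial>\<beta>)"
  shows "(\<integral>\<^sup>+w. (\<integral>\<^sup>+x. q x w \<partial>\<nu>) \<partial>\<alpha>) \<le> (\<integral>\<^sup>+w. (\<integral>\<^sup>+x. q x w \<partial>\<nu>) \<partial>\<beta>)"
proof -
  have swap: "(\<integral>\<^sup>+w. (\<integral>\<^sup>+x. q x w \<partial>\<nu>) \<partial>\<gamma>) = (\<integral>\<^sup>+x. (\<integral>\<^sup>+w. q x w \<partial>\<gamma>) \<partial>\<nu>)" if \<gamma>: "diffuse_above_2 \<gamma>" for \<gamma>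
  proof -
    note [measurable_cong] = diffuse_above_2D(1)[OF \<gamma>]
    interpret pair_sigma_finite \<nu> \<gamma>
      using \<nu> diffuse_above_2D(5)[OF \<gamma>] by (simp add: pair_sigma_finite_def)
    show ?thesis by (rule Fubini') measurable
  qed
  show ?thesis
    using le each unfolding stop_loss_le_def by (auto simp: swap intro: nn_integral_mono)
qed

text \<open>
Layer-cake decomposition: the superlevel sets of a non-increasing function are initial
intervals, so each layer is a \<open>stop_loss 0\<close> function up to one point, or constant.
\<close>
lemma stop_loss_le_antimono:
  assumes le: "stop_loss_le 0 \<alpha> \<beta>" and nonneg: "\<And>w. 2 \<le> w \<Longrightarrow> 0 \<le> h w" and anti: "antimono_on {2..} h"
  shows "(\<integral>\<^sup>+w. ennreal (h w) \<partial>\<alpha>) \<le> (\<integral>\<^sup>+w. ennreal (h w) \<partial>\<beta>)"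
proof -
  have \<alpha>: "diffuse_above_2 \<alpha>" and \<beta>: "diffuse_above_2 \<beta>"
    and base: "\<And>l. 2 < l \<Longrightarrow> (\<integral>\<^sup>+w. stop_loss 0 l w \<partial>\<alpha>) \<le> (\<integral>\<^sup>+w. stop_loss 0 l w \<partial>\<beta>)"
    using le by (auto simp: stop_loss_le_def)
  \<comment> \<open>Below \<open>2\<close> nothing is known about \<open>h\<close>; freezing it at \<open>2\<close> makes it monotone everywhere and hence Borel.\<close>
  define g where "g w = h (max 2 w)" for w
  have g_anti: "antimono g" using anti by (auto simp: g_def monotone_on_def)
  have [measurable]: "g \<in> borel_measurable borel"
  proof -
    have "(\<lambda>w. - g w) \<in> borel_measurable borel"
      using g_anti by (intro borel_measurable_mono) (auto simp: monotone_on_def)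
    then show ?thesis by simp
  qed
  define q :: "real \<Rightarrow> real \<Rightarrow> ennreal" where "q y w = (if 0 < y \<and> y < g w then 1 else 0)" for y w
  have cake: "ennreal (h w) = (\<integral>\<^sup>+y. q y w \<partial>lborel)" if "2 < w" for w
  proof -
    have "(\<integral>\<^sup>+y. q y w \<partial>lborel) = (\<integral>\<^sup>+y. indicator {0<..<g w} y \<partial>lborel)"
      unfolding q_def by (intro nn_integral_cong) (auto split: split_indicator)
    also have "\<dots> = ennreal (g w)" using nonneg[of "max 2 w"] by (simp add: g_def)
    finally show ?thesis using that by (simp add: g_def)
  qed
  have layer: "(\<integral>\<^sup>+w. ennreal (h w) \<partial>\<gamma>) = (\<integral>\<^sup>+w. (\<integral>\<^sup>+y. q y w \<partial>lborel) \<partial>\<gamma>)" if "diffuse_above_2 \<gamma>" for \<gamma>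
    using diffuse_above_2D(3)[OF that] by (intro nn_integral_cong_AE) (auto elim!: eventually_mono simp: cake)
  show ?thesis unfolding layer[OF \<alpha>] layer[OF \<beta>]
  proof (rule stop_loss_le_mixture[OF le])
    show "sigma_finite_measure lborel" by (rule lborel.sigma_finite_measure_axioms)
    show "(\<lambda>(y, w). q y w) \<in> borel_measurable (lborel \<Otimes>\<^sub>M borel)" unfolding q_def by measurable
    fix y :: real
    \<comment> \<open>The layer at height \<open>y\<close> is empty above \<open>2\<close>, everything, or an initial interval with end point \<open>l\<close>.\<close>
    consider (low) "\<forall>w>2. q y w = 0" | (all) "\<forall>w. q y w = 1" | (mid) l where "2 < l" "\<forall>w. w \<noteq> l \<longrightarrow> q y w = stop_loss 0 l w"
    proof -
      define I where "I = {w. 0 < y \<and> y < g w}"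
      have down: "w' \<in> I" if "w \<in> I" "w' \<le> w" for w w'
        using that g_anti by (auto simp: I_def monotone_on_def intro: less_le_trans)
      have qI: "q y w = (if w \<in> I then 1 else 0)" for w by (simp add: q_def I_def)
      show ?thesis
      proof (cases "\<exists>w>2. w \<in> I")
        case False
        then show ?thesis using low by (auto simp: qI)
      next
        case True
        then obtain w0 where w0: "w0 > 2" "w0 \<in> I" by blast
        show ?thesis
        proof (cases "bdd_above I")
          case False
          have "w \<in> I" for w
          proof -
            obtain u where "u \<in> I" "w < u" using False by (auto simp: bdd_above_def not_le)
            then show ?thesis using down by auto
          qed
          then show ?thesis using all by (auto simp: qI)
        next
          case bdd: True
          define l where "l = Sup I"
          have "2 < l" using w0 cSup_upper[OF w0(2) bdd] by (simp add: l_def)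
          moreover have "w \<in> I" if "w < l" for w
            using less_cSupD[of I w] that w0(2) down by (auto simp: l_def intro: less_imp_le)
          moreover have "w \<notin> I" if "l < w" for w
            using cSup_upper[OF _ bdd, of w] that by (auto simp: l_def)
          ultimately show ?thesis using mid[of l] by (auto simp: qI stop_loss_def not_less_iff_gr_or_eq)
        qed
      qed
    qed
    then show "(\<integral>\<^sup>+w. q y w \<partial>\<alpha>) \<le> (\<integral>\<^sup>+w. q y w \<partial>\<beta>)"
    proof cases
      case low
      have "(\<integral>\<^sup>+w. q y w \<partial>\<alpha>) = (\<integral>\<^sup>+w. 0 \<partial>\<alpha>)"
        using diffuse_above_2D(3)[OF \<alpha>] low by (intro nn_integral_cong_AE) (auto elim!: eventually_mono)
      then show ?thesis by simp
    next
      case all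
      then show ?thesis using stop_loss_le_total[OF le, of 1] by simp
    next
      case (mid l)
      have "(\<integral>\<^sup>+w. q y w \<partial>\<gamma>) = (\<integral>\<^sup>+w. stop_loss 0 l w \<partial>\<gamma>)" if "diffuse_above_2 \<gamma>" for \<gamma>
        using diffuse_above_2D(4)[OF that, of l] mid(2) by (intro nn_integral_cong_AE) (auto elim!: eventually_mono)
      then show ?thesis using base[OF mid(1)] \<alpha> \<beta> by simp
    qed
  qed
qed

lemma nn_integral_stop_loss:
  "(\<integral>\<^sup>+x. (if w < x then 1 else 0) * stop_loss n l x \<partial>lborel) = ennreal (1 / real (Suc n)) * stop_loss (Suc n) l w"
proof (cases "w < l")
  case True
  have "(\<integral>\<^sup>+x. (if w < x then 1 else 0) * stop_loss n l x \<partial>lborel) = (\<integral>\<^sup>+x. ennreal ((l - x) ^ n) * indicator {w..l} x \<partial>lborel)"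
    using AE_lborel_singleton[of l] AE_lborel_singleton[of w]
    by (intro nn_integral_cong_AE) (auto elim!: eventually_elim2 simp: stop_loss_def split: split_indicator)
  also have "\<dots> = ennreal (- ((l - l) ^ Suc n / real (Suc n)) - (- ((l - w) ^ Suc n / real (Suc n))))"
  proof (rule nn_integral_FTC_Icc)
    fix x :: real assume "x \<in> {w..l}"
    have "((\<lambda>x. (l - x) ^ Suc n) has_real_derivative (real (Suc n) * (l - x) ^ n * (- 1))) (at x)"
      by (auto intro!: derivative_eq_intros simp del: power_Suc)
    from DERIV_minus[OF DERIV_cdivide[OF this, of "real (Suc n)"]]
    show "((\<lambda>x. - ((l - x) ^ Suc n / real (Suc n))) has_real_derivative (l - x) ^ n) (at x)"
      by (simp del: of_nat_Suc power_Suc)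
  qed (use True in auto)
  also have "\<dots> = ennreal (1 / real (Suc n)) * stop_loss (Suc n) l w"
    using True by (simp add: stop_loss_def ennreal_mult'[symmetric] del: of_nat_Suc power_Suc)
  finally show ?thesis .
next
  case False
  then have "(\<integral>\<^sup>+x. (if w < x then 1 else 0) * stop_loss n l x \<partial>lborel) = (\<integral>\<^sup>+x. 0 \<partial>(lborel :: real measure))"
    by (intro nn_integral_cong) (auto simp: stop_loss_def)
  then show ?thesis using False by (simp add: stop_loss_def)
qed

text \<open>
Integrating \<open>p\<close> against this measure is the same as integrating \<open>w \<mapsto> \<integral> p\<close> over \<open>(w, \<infinity>)\<close> against
\<open>\<alpha>\<close>.  So passing to it trades one antiderivative of the integrand for one order of the stop-loss comparison.
\<close>
definition tail_measure :: "real measure \<Rightarrow> real measure" where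
  "tail_measure \<alpha> = density lborel (\<lambda>x. \<integral>\<^sup>+w. (if w < x then 1 else 0) \<partial>\<alpha>)"

lemma tail_measure_props:
  assumes \<alpha>: "diffuse_above_2 \<alpha>"
  shows tail_measure_integral: "f \<in> borel_measurable borel \<Longrightarrow>
      (\<integral>\<^sup>+x. f x \<partial>tail_measure \<alpha>) = (\<integral>\<^sup>+w. (\<integral>\<^sup>+x. (if w < x then 1 else 0) * f x \<partial>lborel) \<partial>\<alpha>)"
    and tail_measure_diffuse: "diffuse_above_2 (tail_measure \<alpha>)"
proof -
  note [measurable_cong] = diffuse_above_2D(1)[OF \<alpha>]
  interpret sigma_finite_measure \<alpha> by (rule diffuse_above_2D(5)[OF \<alpha>])
  interpret P: pair_sigma_finite \<alpha> lborel
    by (simp add: pair_sigma_finite_def sigma_finite_measure_axioms lborel.sigma_finite_measure_axioms)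
  define a where "a x = (\<integral>\<^sup>+w. (if w < x then 1 else 0) \<partial>\<alpha>)" for x :: real
  have a_meas[measurable]: "a \<in> borel_measurable borel" unfolding a_def by measurable
  have a_le: "a x \<le> emeasure \<alpha> {..l}" if "x \<le> l" for x l
  proof -
    have "a x \<le> (\<integral>\<^sup>+w. indicator {..l} w \<partial>\<alpha>)" unfolding a_def using that
      by (intro nn_integral_mono) (auto split: split_indicator)
    then show ?thesis by (simp add: diffuse_above_2D(1)[OF \<alpha>])
  qed
  have a_0: "a x = 0" if "x \<le> 2" for x
  proof -
    have "a x = (\<integral>\<^sup>+w. 0 \<partial>\<alpha>)" unfolding a_def using diffuse_above_2D(3)[OF \<alpha>] that
      by (intro nn_integral_cong_AE) (auto elim!: eventually_mono)
    then show ?thesis by simp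
  qed
  have T: "tail_measure \<alpha> = density lborel a" unfolding tail_measure_def a_def[abs_def] ..
  show "(\<integral>\<^sup>+x. f x \<partial>tail_measure \<alpha>) = (\<integral>\<^sup>+w. (\<integral>\<^sup>+x. (if w < x then 1 else 0) * f x \<partial>lborel) \<partial>\<alpha>)"
    if [measurable]: "f \<in> borel_measurable borel"
  proof -
    have "(\<integral>\<^sup>+x. f x \<partial>tail_measure \<alpha>) = (\<integral>\<^sup>+x. a x * f x \<partial>lborel)" unfolding T by (rule nn_integral_density) auto
    also have "\<dots> = (\<integral>\<^sup>+x. (\<integral>\<^sup>+w. (if w < x then 1 else 0) * f x \<partial>\<alpha>) \<partial>lborel)"
      unfolding a_def by (intro nn_integral_cong) (simp add: nn_integral_multc)
    also have "\<dots> = (\<integral>\<^sup>+w. (\<integral>\<^sup>+x. (if w < x then 1 else 0) * f x \<partial>lborel) \<partial>\<alpha>)"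
      by (rule P.Fubini') measurable
    finally show ?thesis .
  qed
  show "diffuse_above_2 (tail_measure \<alpha>)"
    unfolding diffuse_above_2_def
  proof (intro conjI allI)
    show "sets (tail_measure \<alpha>) = sets borel" by (simp add: T)
    show "AE w in tail_measure \<alpha>. 2 < w" unfolding T
      by (subst AE_density) (use a_0 in \<open>auto intro!: AE_I2 simp: not_le[symmetric]\<close>)
    show "AE w in tail_measure \<alpha>. w \<noteq> l" for l
      unfolding T using AE_lborel_singleton[of l] by (subst AE_density) (auto elim!: eventually_mono)
    fix l :: real
    have "emeasure (tail_measure \<alpha>) {..l} = (\<integral>\<^sup>+x. a x * indicator {..l} x \<partial>lborel)"
      unfolding T by (simp add: emeasure_density)
    also have "\<dots> \<le> (\<integral>\<^sup>+x. emeasure \<alpha> {..l} * indicator {2..max 2 l} x \<partial>lborel)"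
      using a_0 a_le by (intro nn_integral_mono) (auto split: split_indicator simp: not_le)
    also have "\<dots> = emeasure \<alpha> {..l} * ennreal (max 2 l - 2)" by (subst nn_integral_cmult_indicator) auto
    also have "\<dots> < \<infinity>" using diffuse_above_2D(2)[OF \<alpha>] by (simp add: ennreal_mult_less_top)
    finally show "emeasure (tail_measure \<alpha>) {..l} < \<infinity>" .
  qed
qed

lemma monotone_order_deriv_antimono:
  assumes "monotone_order_deriv (Suc n) h"
  shows "antimono_on {2..} h" "2 \<le> w \<Longrightarrow> 0 \<le> h w"
proof -
  obtain D where D: "D 0 = h" "\<And>j w. j < n \<Longrightarrow> 2 \<le> w \<Longrightarrow> (D j has_real_derivative D (Suc j) w) (at w within {2..})"
    "\<And>j w. j < Suc n \<Longrightarrow> 2 \<le> w \<Longrightarrow> 0 \<le> (- 1) ^ j * D j w" "antimono_on {2..} (\<lambda>w. (- 1) ^ n * D n w)"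
    using assms unfolding monotone_order_deriv_def by auto
  show "2 \<le> w \<Longrightarrow> 0 \<le> h w" using D(3)[of 0] D(1) by simp
  show "antimono_on {2..} h"
  proof (cases n)
    case 0
    then show ?thesis using D(1,4) by simp
  next
    case (Suc m)
    have "h y \<le> h x" if "2 \<le> x" "x \<le> y" for x y
    proof (cases "x = y")
      case False
      then have "x < y" using that by simp
      have "\<exists>z\<in>{x<..<y}. h y - h x = (y - x) *\<^sub>R D 1 z"
      proof (rule mvt_simple[OF \<open>x < y\<close>, where f' = "\<lambda>z t. t *\<^sub>R D 1 z"])
        fix z assume z: "x \<le> z" "z \<le> y"
        have "(h has_real_derivative D 1 z) (at z within {x..y})"
          using D(2)[of 0 z] D(1) Suc z that by (auto intro: has_field_derivative_subset)
        moreover have "(\<lambda>t. t *\<^sub>R D 1 z) = (*) (D 1 z)" by (auto simp: fun_eq_iff)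
        ultimately show "(h has_derivative (\<lambda>t. t *\<^sub>R D 1 z)) (at z within {x..y})"
          by (simp only: has_field_derivative_def)
      qed
      then obtain z where "x < z" "h y - h x = (y - x) * D 1 z" by auto
      moreover have "D 1 z \<le> 0" using D(3)[of 1 z] Suc that \<open>x < z\<close> by simp
      ultimately show ?thesis using \<open>x < y\<close> mult_nonneg_nonpos[of "y - x" "D 1 z"] by simp
    qed simp
    then show ?thesis by (auto simp: monotone_on_def)
  qed
qed

text \<open>
Induction on \<open>n\<close>: \<open>h\<close> is its limit at infinity plus the integral of \<open>- h'\<close> over \<open>(w, \<infinity>)\<close>, the function
\<open>- h'\<close> is monotone of one order less, and the tail measures are comparable at one order less.
\<close>
lemma stop_loss_le_monotone_order_deriv:
  assumes "stop_loss_le n \<alpha> \<beta>" "monotone_order_deriv (Suc n) h"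
  shows "(\<integral>\<^sup>+w. ennreal (h w) \<partial>\<alpha>) \<le> (\<integral>\<^sup>+w. ennreal (h w) \<partial>\<beta>)"
  using assms
proof (induction n arbitrary: \<alpha> \<beta> h)
  case 0
  then show ?case using stop_loss_le_antimono monotone_order_deriv_antimono by blast
next
  case (Suc n)
  obtain D where D: "D 0 = h" "\<And>j w. j < Suc n \<Longrightarrow> 2 \<le> w \<Longrightarrow> (D j has_real_derivative D (Suc j) w) (at w within {2..})"
    "\<And>j w. j < Suc (Suc n) \<Longrightarrow> 2 \<le> w \<Longrightarrow> 0 \<le> (- 1) ^ j * D j w" "antimono_on {2..} (\<lambda>w. (- 1) ^ Suc n * D (Suc n) w)"
    using Suc.prems(2) unfolding monotone_order_deriv_def by auto
  define h1 where "h1 w = - D 1 w" for w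
  have sign: "(- 1) ^ j * D (Suc j) w \<le> 0" if "j < Suc n" "2 \<le> w" for j w
    using D(3)[of "Suc j" w] that by simp
  have h1: "monotone_order_deriv (Suc n) h1"
    unfolding monotone_order_deriv_def
    using D by (intro exI[of _ "\<lambda>j w. - D (Suc j) w"]) (auto simp: h1_def[abs_def] sign intro!: DERIV_minus)
  note h_anti = monotone_order_deriv_antimono[OF Suc.prems(2)]
  note h1_anti = monotone_order_deriv_antimono[OF h1]
  define g where "g w = h1 (max 2 w)" for w
  have [measurable]: "g \<in> borel_measurable borel"
  proof -
    have "(\<lambda>w. - g w) \<in> borel_measurable borel"
      using h1_anti by (intro borel_measurable_mono) (auto simp: g_def monotone_on_def)
    then show ?thesis by simp
  qed
  define c where "c = Inf (h ` {2..})"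
  have bdd: "bdd_below (h ` {2..})" using h_anti(2) by (intro bdd_belowI[of _ 0]) auto
  have c_le: "c \<le> h w" if "2 \<le> w" for w unfolding c_def using bdd that by (intro cInf_lower) auto
  have c0: "0 \<le> c" unfolding c_def using h_anti(2) by (intro cInf_greatest) auto
  have lim: "(h \<longlongrightarrow> c) at_top"
  proof (rule order_tendstoI)
    show "\<forall>\<^sub>F x in at_top. a < h x" if "a < c" for a
      using eventually_ge_at_top[of 2] by eventually_elim (use c_le that in \<open>auto intro: less_le_trans\<close>)
    fix a assume "c < a"
    then obtain x0 where x0: "2 \<le> x0" "h x0 < a" unfolding c_def by (auto dest: cInf_lessD[rotated])
    show "\<forall>\<^sub>F x in at_top. h x < a"
      using eventually_ge_at_top[of x0]
    proof eventually_elim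
      case (elim x)
      have "h x \<le> h x0" using monotone_onD[OF h_anti(1), of x0 x] elim x0 by simp
      then show ?case using x0(2) by simp
    qed
  qed
  have ftc: "ennreal (h w) = ennreal c + (\<integral>\<^sup>+x. (if w < x then 1 else 0) * ennreal (g x) \<partial>lborel)" if w: "2 < w" for w
  proof -
    have "(\<integral>\<^sup>+x. ennreal (g x) * indicator {w..} x \<partial>lborel) = ennreal (- c - (- h w))"
    proof (rule nn_integral_FTC_atLeast)
      fix x assume x: "w \<le> x"
      have "(h has_real_derivative D 1 x) (at x within {2..})" using D(2)[of 0 x] D(1) x w by simp
      then have "(h has_real_derivative D 1 x) (at x within {2<..})"
        by (rule has_field_derivative_subset) auto
      then have "(h has_real_derivative D 1 x) (at x)"
        using x w at_within_open[of x "{2<..}"] by simp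
      then show "((\<lambda>w. - h w) has_real_derivative g x) (at x)"
        using x w by (auto simp: g_def h1_def intro!: DERIV_minus)
      show "0 \<le> g x" using h1_anti(2)[of "max 2 x"] by (simp add: g_def)
    next
      show "((\<lambda>w. - h w) \<longlongrightarrow> - c) at_top" by (intro tendsto_minus lim)
    qed measurable
    also have "(\<integral>\<^sup>+x. ennreal (g x) * indicator {w..} x \<partial>lborel) = (\<integral>\<^sup>+x. (if w < x then 1 else 0) * ennreal (g x) \<partial>lborel)"
      using AE_lborel_singleton[of w] by (intro nn_integral_cong_AE) (auto elim!: eventually_mono split: split_indicator)
    finally have "(\<integral>\<^sup>+x. (if w < x then 1 else 0) * ennreal (g x) \<partial>lborel) = ennreal (h w - c)" by simp
    then show ?thesis using c_le[of w] c0 w by (simp add: ennreal_plus[symmetric] del: ennreal_plus)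
  qed
  have split: "(\<integral>\<^sup>+w. ennreal (h w) \<partial>\<gamma>) = (\<integral>\<^sup>+w. ennreal c \<partial>\<gamma>) + (\<integral>\<^sup>+x. ennreal (h1 x) \<partial>tail_measure \<gamma>)"
    if \<gamma>: "diffuse_above_2 \<gamma>" for \<gamma>
  proof -
    note [measurable_cong] = diffuse_above_2D(1)[OF \<gamma>]
    have "(\<integral>\<^sup>+w. ennreal (h w) \<partial>\<gamma>) = (\<integral>\<^sup>+w. ennreal c + (\<integral>\<^sup>+x. (if w < x then 1 else 0) * ennreal (g x) \<partial>lborel) \<partial>\<gamma>)"
      using diffuse_above_2D(3)[OF \<gamma>] by (intro nn_integral_cong_AE) (auto elim!: eventually_mono simp: ftc)
    also have "\<dots> = (\<integral>\<^sup>+w. ennreal c \<partial>\<gamma>) + (\<integral>\<^sup>+w. (\<integral>\<^sup>+x. (if w < x then 1 else 0) * ennreal (g x) \<partial>lborel) \<partial>\<gamma>)"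
      by (rule nn_integral_add) measurable
    also have "(\<integral>\<^sup>+w. (\<integral>\<^sup>+x. (if w < x then 1 else 0) * ennreal (g x) \<partial>lborel) \<partial>\<gamma>) = (\<integral>\<^sup>+x. ennreal (g x) \<partial>tail_measure \<gamma>)"
      by (rule tail_measure_integral[OF \<gamma>, symmetric]) measurable
    also have "\<dots> = (\<integral>\<^sup>+x. ennreal (h1 x) \<partial>tail_measure \<gamma>)"
      using diffuse_above_2D(3)[OF tail_measure_diffuse[OF \<gamma>]]
      by (intro nn_integral_cong_AE) (auto elim!: eventually_mono simp: g_def)
    finally show ?thesis .
  qed
  have \<alpha>: "diffuse_above_2 \<alpha>" and \<beta>: "diffuse_above_2 \<beta>"
    and base: "\<And>l. 2 < l \<Longrightarrow> (\<integral>\<^sup>+w. stop_loss (Suc n) l w \<partial>\<alpha>) \<le> (\<integral>\<^sup>+w. stop_loss (Suc n) l w \<partial>\<beta>)"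
    using Suc.prems(1) by (auto simp: stop_loss_le_def)
  have tail: "(\<integral>\<^sup>+w. stop_loss n l w \<partial>tail_measure \<gamma>) = ennreal (1 / real (Suc n)) * (\<integral>\<^sup>+w. stop_loss (Suc n) l w \<partial>\<gamma>)"
    if \<gamma>: "diffuse_above_2 \<gamma>" for \<gamma> l
  proof -
    note [measurable_cong] = diffuse_above_2D(1)[OF \<gamma>]
    show ?thesis by (simp add: tail_measure_integral[OF \<gamma>] nn_integral_stop_loss nn_integral_cmult del: of_nat_Suc)
  qed
  have "stop_loss_le n (tail_measure \<alpha>) (tail_measure \<beta>)"
    unfolding stop_loss_le_def using tail_measure_diffuse[OF \<alpha>] tail_measure_diffuse[OF \<beta>] base
    by (auto simp: tail[OF \<alpha>] tail[OF \<beta>] intro: mult_left_mono)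
  from Suc.IH[OF this h1] show ?case
    unfolding split[OF \<alpha>] split[OF \<beta>] by (intro add_mono stop_loss_le_total[OF Suc.prems(1)])
qed

text \<open>
The representing measure \<open>H\<close> may fail to be \<open>\<sigma>\<close>-finite below \<open>2\<close>.  Weighting it by \<open>(l - 2)\<^sup>n\<close> on
\<open>l > 2\<close> gives a finite measure, because the representation holds at \<open>w = 2\<close>, and turns the truncated
powers into the normalised ones \<open>((l - w) / (l - 2))\<^sup>n\<close>.
\<close>
lemma stop_loss_le_monotone_order_integral:
  assumes le: "stop_loss_le n \<alpha> \<beta>" and h: "monotone_order_integral (Suc n) h"
  shows "(\<integral>\<^sup>+w. ennreal (h w) \<partial>\<alpha>) \<le> (\<integral>\<^sup>+w. ennreal (h w) \<partial>\<beta>)"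
proof -
  have \<alpha>: "diffuse_above_2 \<alpha>" and \<beta>: "diffuse_above_2 \<beta>"
    and base: "\<And>l. 2 < l \<Longrightarrow> (\<integral>\<^sup>+w. stop_loss n l w \<partial>\<alpha>) \<le> (\<integral>\<^sup>+w. stop_loss n l w \<partial>\<beta>)"
    using le by (auto simp: stop_loss_le_def)
  \<comment> \<open>\<open>R w l\<close> is \<open>w < l\<close> or \<open>w \<le> l\<close>, according to the form of the representation.\<close>
  obtain c :: real and H :: "real measure" and R :: "real \<Rightarrow> real \<Rightarrow> bool" where c: "0 \<le> c" and H[measurable_cong]: "sets H = sets borel"
    and R: "R = (<) \<or> R = (\<le>)"
    and int: "\<And>w. 2 \<le> w \<Longrightarrow> set_integrable H {l. R w l} (\<lambda>l. (l - w) ^ n)"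
    and eq: "\<And>w. 2 \<le> w \<Longrightarrow> h w = c + (LINT l:{l. R w l}|H. (l - w) ^ n)"
    using h unfolding monotone_order_integral_def greaterThan_def atLeast_def
    by (elim exE conjE disjE) (metis diff_Suc_1)+
  have R_le: "w \<le> l" if "R w l" for w l using R that by auto
  have R_less: "R w l" if "w < l" for w l using R that by auto
  have [measurable]: "Measurable.pred (borel \<Otimes>\<^sub>M borel) (\<lambda>(l, w). R w l)" using R by auto
  have [measurable]: "{l. R w l} \<in> sets borel" for w using R by (auto simp: greaterThan_def[symmetric] atLeast_def[symmetric])
  have nn: "ennreal (h w) = ennreal c + (\<integral>\<^sup>+l. (if R w l then ennreal ((l - w) ^ n) else 0) \<partial>H)"
    and fin: "(\<integral>\<^sup>+l. (if R w l then ennreal ((l - w) ^ n) else 0) \<partial>H) < \<infinity>" if w: "2 \<le> w" for w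
  proof -
    have i: "integrable H (\<lambda>l. indicator {l. R w l} l * (l - w) ^ n)"
      using int[OF w] by (simp add: set_integrable_def)
    have nn: "0 \<le> indicator {l. R w l} l * (l - w) ^ n" for l
      using R_le[of w l] by (auto split: split_indicator)
    have "(\<integral>\<^sup>+l. (if R w l then ennreal ((l - w) ^ n) else 0) \<partial>H) = (\<integral>\<^sup>+l. ennreal (indicator {l. R w l} l * (l - w) ^ n) \<partial>H)"
      by (intro nn_integral_cong) auto
    also have "\<dots> = ennreal (LINT l:{l. R w l}|H. (l - w) ^ n)"
      using nn_integral_eq_integral[OF i] nn by (simp add: set_lebesgue_integral_def)
    finally have *: "(\<integral>\<^sup>+l. (if R w l then ennreal ((l - w) ^ n) else 0) \<partial>H) = ennreal (LINT l:{l. R w l}|H. (l - w) ^ n)" .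
    have "0 \<le> (LINT l:{l. R w l}|H. (l - w) ^ n)"
      unfolding set_lebesgue_integral_def using nn by (intro integral_nonneg_AE) auto
    then show "ennreal (h w) = ennreal c + (\<integral>\<^sup>+l. (if R w l then ennreal ((l - w) ^ n) else 0) \<partial>H)"
      unfolding * eq[OF w] using c by (simp add: ennreal_plus)
    show "(\<integral>\<^sup>+l. (if R w l then ennreal ((l - w) ^ n) else 0) \<partial>H) < \<infinity>" unfolding * by simp
  qed
  define k where "k l = (if 2 < l then ennreal ((l - 2) ^ n) else 0)" for l :: real
  have [measurable]: "k \<in> borel_measurable borel" unfolding k_def by measurable
  define \<nu> where "\<nu> = density H k"
  have \<nu>_sets[measurable_cong]: "sets \<nu> = sets borel" by (simp add: \<nu>_def H)
  have "finite_measure \<nu>"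
  proof (rule finite_measureI)
    have "emeasure \<nu> (space \<nu>) = (\<integral>\<^sup>+l. 1 \<partial>\<nu>)" by simp
    also have "\<dots> = (\<integral>\<^sup>+l. k l \<partial>H)" unfolding \<nu>_def by (subst nn_integral_density) simp_all
    also have "\<dots> \<le> (\<integral>\<^sup>+l. (if R 2 l then ennreal ((l - 2) ^ n) else 0) \<partial>H)"
      using R_less by (intro nn_integral_mono) (auto simp: k_def)
    finally show "emeasure \<nu> (space \<nu>) \<noteq> \<infinity>" using fin[of 2] by (auto simp: top_unique)
  qed
  then have sf: "sigma_finite_measure \<nu>" by (rule finite_measure.axioms)
  define q where "q l w = (if R w l then ennreal (((l - w) / (l - 2)) ^ n) else 0)" for l w :: real
  have [measurable]: "(\<lambda>(l, w). q l w) \<in> borel_measurable (borel \<Otimes>\<^sub>M borel)"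
    unfolding q_def using R by auto
  have [measurable]: "(\<lambda>l. q l w) \<in> borel_measurable borel" for w by measurable
  have mix: "ennreal (h w) = ennreal c + (\<integral>\<^sup>+l. q l w \<partial>\<nu>)" if w: "2 < w" for w
  proof -
    have "(\<integral>\<^sup>+l. q l w \<partial>\<nu>) = (\<integral>\<^sup>+l. k l * q l w \<partial>H)"
      unfolding \<nu>_def by (rule nn_integral_density) measurable
    also have "\<dots> = (\<integral>\<^sup>+l. (if R w l then ennreal ((l - w) ^ n) else 0) \<partial>H)"
    proof (intro nn_integral_cong)
      fix l
      show "k l * q l w = (if R w l then ennreal ((l - w) ^ n) else 0)"
      proof (cases "R w l")
        case True
        then have "2 < l" "w \<le> l" using R_le[of w l] w by auto
        then have "ennreal ((l - 2) ^ n) * ennreal (((l - w) / (l - 2)) ^ n) = ennreal ((l - 2) ^ n * ((l - w) / (l - 2)) ^ n)"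
          by (intro ennreal_mult'[symmetric]) simp
        also have "(l - 2) ^ n * ((l - w) / (l - 2)) ^ n = (l - w) ^ n"
          using \<open>2 < l\<close> by (simp add: power_divide)
        finally show ?thesis using True \<open>2 < l\<close> by (simp add: k_def q_def)
      qed (simp add: q_def)
    qed
    finally show ?thesis using nn[of w] w by simp
  qed
  have split: "(\<integral>\<^sup>+w. ennreal (h w) \<partial>\<gamma>) = (\<integral>\<^sup>+w. ennreal c \<partial>\<gamma>) + (\<integral>\<^sup>+w. (\<integral>\<^sup>+l. q l w \<partial>\<nu>) \<partial>\<gamma>)"
    if \<gamma>: "diffuse_above_2 \<gamma>" for \<gamma>
  proof -
    note [measurable_cong] = diffuse_above_2D(1)[OF \<gamma>]
    interpret sigma_finite_measure \<nu> by (rule sf)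
    have "(\<integral>\<^sup>+w. ennreal (h w) \<partial>\<gamma>) = (\<integral>\<^sup>+w. ennreal c + (\<integral>\<^sup>+l. q l w \<partial>\<nu>) \<partial>\<gamma>)"
      using diffuse_above_2D(3)[OF \<gamma>] by (intro nn_integral_cong_AE) (auto elim!: eventually_mono simp: mix)
    also have "\<dots> = (\<integral>\<^sup>+w. ennreal c \<partial>\<gamma>) + (\<integral>\<^sup>+w. (\<integral>\<^sup>+l. q l w \<partial>\<nu>) \<partial>\<gamma>)"
      by (rule nn_integral_add) measurable
    finally show ?thesis .
  qed
  have "(\<integral>\<^sup>+w. (\<integral>\<^sup>+l. q l w \<partial>\<nu>) \<partial>\<alpha>) \<le> (\<integral>\<^sup>+w. (\<integral>\<^sup>+l. q l w \<partial>\<nu>) \<partial>\<beta>)"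
  proof (rule stop_loss_le_mixture[OF le sf])
    show "(\<lambda>(l, w). q l w) \<in> borel_measurable (\<nu> \<Otimes>\<^sub>M borel)" by measurable
    fix l
    have q_int: "(\<integral>\<^sup>+w. q l w \<partial>\<gamma>) = (if 2 < l then ennreal ((1 / (l - 2)) ^ n) * (\<integral>\<^sup>+w. stop_loss n l w \<partial>\<gamma>) else 0)"
      if \<gamma>: "diffuse_above_2 \<gamma>" for \<gamma>
    proof -
      note [measurable_cong] = diffuse_above_2D(1)[OF \<gamma>]
      show ?thesis
      proof (cases "2 < l")
        case True
        have "(\<integral>\<^sup>+w. q l w \<partial>\<gamma>) = (\<integral>\<^sup>+w. ennreal ((1 / (l - 2)) ^ n) * stop_loss n l w \<partial>\<gamma>)"
        proof (intro nn_integral_cong_AE, use diffuse_above_2D(4)[OF \<gamma>, of l] in eventually_elim)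
          fix w assume "w \<noteq> l"
          then have "R w l \<longleftrightarrow> w < l" using R_le[of w l] R_less[of w l] by auto
          moreover have "((l - w) / (l - 2)) ^ n = (1 / (l - 2)) ^ n * (l - w) ^ n"
            by (simp add: power_divide)
          ultimately show "q l w = ennreal ((1 / (l - 2)) ^ n) * stop_loss n l w"
            using True by (simp add: q_def stop_loss_def ennreal_mult')
        qed
        then show ?thesis using True by (simp add: nn_integral_cmult)
      next
        case False
        have "(\<integral>\<^sup>+w. q l w \<partial>\<gamma>) = (\<integral>\<^sup>+w. 0 \<partial>\<gamma>)"
          using diffuse_above_2D(3)[OF \<gamma>]
        proof (intro nn_integral_cong_AE, elim eventually_mono)
          fix w :: real assume "2 < w"
          then have "\<not> R w l" using R_le[of w l] False by auto
          then show "q l w = 0" by (simp add: q_def)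
        qed
        then show ?thesis using False by simp
      qed
    qed
    show "(\<integral>\<^sup>+w. q l w \<partial>\<alpha>) \<le> (\<integral>\<^sup>+w. q l w \<partial>\<beta>)"
      unfolding q_int[OF \<alpha>] q_int[OF \<beta>] using base by (auto intro: mult_left_mono)
  qed
  then show ?thesis unfolding split[OF \<alpha>] split[OF \<beta>]
    by (intro add_mono stop_loss_le_total[OF le])
qed

section \<open>Stop-loss comparison in the hyperbolic variable\<close>

text \<open>
The image under \<open>v \<mapsto> v + 1 / v\<close> of the measure with density the positive part of \<open>v\<^sup>n e(v)\<close>: negative
values of \<open>e\<close> disappear in \<open>ennreal\<close>, so \<open>e\<close> and \<open>- e\<close> give the two halves of a signed measure.
The factor \<open>v\<^sup>n\<close> comes from \<open>l - (v + 1 / v) = (b - v) (v - 1 / b) / v\<close> for \<open>l = b + 1 / b\<close>.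
\<close>
definition hyperbolic_measure :: "nat \<Rightarrow> (real \<Rightarrow> real) \<Rightarrow> real measure" where
  "hyperbolic_measure n e = distr (density lborel (\<lambda>v. ennreal (v ^ n * e v) * indicator {0<..} v)) borel (\<lambda>v. v + 1 / v)"

lemma nn_integral_hyperbolic_measure:
  assumes [measurable]: "e \<in> borel_measurable borel" "q \<in> borel_measurable borel"
  shows "(\<integral>\<^sup>+w. q w \<partial>hyperbolic_measure n e) = (\<integral>\<^sup>+v. ennreal (v ^ n * e v) * indicator {0<..} v * q (v + 1 / v) \<partial>lborel)"
  unfolding hyperbolic_measure_def by (simp add: nn_integral_distr nn_integral_density)

lemma hyperbolic_sum_gt_2:
  fixes v :: real
  assumes "0 < v" "v \<noteq> 1"
  shows "2 < v + 1 / v"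
proof -
  have "0 < (v - 1)\<^sup>2 / v" using assms by simp
  also have "(v - 1)\<^sup>2 / v = v + 1/v - 2" using assms by (simp add: field_simps power2_eq_square)
  finally show ?thesis by simp
qed

lemma hyperbolic_sum_diff:
  fixes b v :: real
  assumes "0 < v" "0 < b"
  shows "b + 1 / b - (v + 1 / v) = (b - v) * (v - 1 / b) / v"
  using assms by (simp add: field_simps)

text \<open>
The inverse of \<open>v \<mapsto> v + 1 / v\<close> on \<open>[1, \<infinity>)\<close>.  It expresses \<open>h\<close> through \<open>f\<close>, so that \<open>h\<close> is
Borel measurable where it matters.
\<close>
definition hyperbolic_branch :: "real \<Rightarrow> real" where
  "hyperbolic_branch w = (w + sqrt (w\<^sup>2 - 4)) / 2"

lemma hyperbolic_branch_sum:
  fixes w :: real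
  assumes "2 \<le> w"
  shows "1 \<le> hyperbolic_branch w" "hyperbolic_branch w + 1 / hyperbolic_branch w = w"
proof -
  define b where "b = hyperbolic_branch w"
  note b_def' = b_def[unfolded hyperbolic_branch_def]
  have "2\<^sup>2 \<le> w\<^sup>2" using assms by (intro power_mono) auto
  then have s: "0 \<le> sqrt (w\<^sup>2 - 4)" "(sqrt (w\<^sup>2 - 4))\<^sup>2 = w\<^sup>2 - 4" by auto
  have "2 \<le> w + sqrt (w\<^sup>2 - 4)" using s(1) assms(1) by linarith
  then have b1: "1 \<le> b" by (simp add: b_def')
  then show "1 \<le> hyperbolic_branch w" by (simp only: b_def)
  have "b\<^sup>2 - w * b + 1 = 0" using s(2) by (simp add: b_def' power2_eq_square field_simps)
  then have "b * b + 1 = w * b" by (simp add: power2_eq_square)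
  then have "(b * b + 1) / b = w" using b1 by simp
  then have "b + 1 / b = w" using b1 by (simp add: add_divide_distrib)
  then show "hyperbolic_branch w + 1 / hyperbolic_branch w = w" by (simp only: b_def)
qed

lemma diffuse_hyperbolic_measure:
  assumes [measurable]: "e \<in> borel_measurable borel" and cont: "continuous_on {0<..} e"
  shows "diffuse_above_2 (hyperbolic_measure n e)"
  unfolding diffuse_above_2_def
proof (intro conjI allI)
  have AE: "(AE w in hyperbolic_measure n e. P w) \<longleftrightarrow> (AE v in lborel. ennreal (v ^ n * e v) * indicator {0<..} v \<noteq> 0 \<longrightarrow> P (v + 1 / v))"
    if "Measurable.pred borel P" for P
    unfolding hyperbolic_measure_def using that
    by (subst AE_distr_iff) (auto simp: AE_density zero_less_iff_neq_zero)
  show "sets (hyperbolic_measure n e) = sets borel" by (simp add: hyperbolic_measure_def)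
  show "AE w in hyperbolic_measure n e. 2 < w"
    by (subst AE, simp) (use AE_lborel_singleton[of 1] in \<open>auto elim!: eventually_mono simp: hyperbolic_sum_gt_2 split: split_indicator_asm\<close>)
  show "AE w in hyperbolic_measure n e. w \<noteq> l" for l
  proof (cases "\<exists>b>0. b + 1 / b = l")
    case True
    then obtain b where b: "b > 0" "b + 1 / b = l" by blast
    show ?thesis
    proof (subst AE, simp, use AE_lborel_singleton[of b] AE_lborel_singleton[of "1 / b"] in eventually_elim)
      fix v assume "v \<noteq> b" "v \<noteq> 1 / b"
      then show "ennreal (v ^ n * e v) * indicator {0<..} v \<noteq> 0 \<longrightarrow> v + 1 / v \<noteq> l"
        using hyperbolic_sum_diff[of v b] b by (auto split: split_indicator_asm)
    qed
  next
    case False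
    then show ?thesis by (subst AE) (auto intro!: AE_I2 split: split_indicator_asm)
  qed
  fix l :: real
  define B where "B = \<bar>l\<bar> + 1"
  have B: "B > 0" by (simp add: B_def)
  have "set_integrable lborel {1/B..B} (\<lambda>v. v ^ n * e v)"
  proof (rule borel_integrable_atLeastAtMost')
    have "{1/B..B} \<subseteq> {0<..}" using B by (auto intro: less_le_trans[of 0 "1/B"])
    then show "continuous_on {1/B..B} (\<lambda>v. v ^ n * e v)"
      by (intro continuous_intros continuous_on_subset[OF cont])
  qed
  then have "(\<integral>\<^sup>+v. ennreal (indicator {1/B..B} v * (v ^ n * e v)) \<partial>lborel) < \<infinity>"
    unfolding set_integrable_def by (auto dest!: integrableD(2) simp: less_top)
  moreover have "emeasure (hyperbolic_measure n e) {..l} = (\<integral>\<^sup>+v. ennreal (v ^ n * e v) * indicator {0<..} v * indicator {..l} (v + 1 / v) \<partial>lborel)"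
    by (subst nn_integral_hyperbolic_measure[symmetric]) (auto simp: hyperbolic_measure_def)
  moreover have "\<dots> \<le> (\<integral>\<^sup>+v. ennreal (indicator {1/B..B} v * (v ^ n * e v)) \<partial>lborel)"
  proof (intro nn_integral_mono)
    fix v :: real
    have "v \<in> {1/B..B}" if "0 < v" "v + 1 / v \<le> l"
    proof -
      have "1 / v > 0" using that by simp
      then have "v \<le> B" "1 / v \<le> B" using that unfolding B_def by linarith+
      then show ?thesis using that B by (simp add: field_simps)
    qed
    then show "ennreal (v ^ n * e v) * indicator {0<..} v * indicator {..l} (v + 1 / v) \<le> ennreal (indicator {1/B..B} v * (v ^ n * e v))"
      by (auto split: split_indicator)
  qed
  ultimately show "emeasure (hyperbolic_measure n e) {..l} < \<infinity>" by (auto intro: le_less_trans)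
qed

lemma nn_integral_negative_part_le:
  fixes \<psi> :: "'a \<Rightarrow> real"
  assumes "integrable M \<psi>" "0 \<le> (LINT x|M. \<psi> x)"
  shows "(\<integral>\<^sup>+x. ennreal (- \<psi> x) \<partial>M) \<le> (\<integral>\<^sup>+x. ennreal (\<psi> x) \<partial>M)"
proof -
  have "enn2real (\<integral>\<^sup>+x. ennreal (- \<psi> x) \<partial>M) \<le> enn2real (\<integral>\<^sup>+x. ennreal (\<psi> x) \<partial>M)"
    using assms(2) real_lebesgue_integral_def[OF assms(1)] by simp
  moreover have "(\<integral>\<^sup>+x. ennreal (\<psi> x) \<partial>M) < \<top>" "(\<integral>\<^sup>+x. ennreal (- \<psi> x) \<partial>M) < \<top>"
    using assms(1) by (auto simp: real_integrable_def less_top)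
  ultimately show ?thesis by (metis ennreal_enn2real ennreal_leI)
qed

text \<open>
Testing the negative and the positive part of the kernel increment against a truncated power is
exactly \<open>hyperbolic_kernel_integral_mono\<close>.
\<close>
lemma stop_loss_le_hyperbolic:
  assumes z: "0 < z" and \<theta>: "0 \<le> \<theta>" "\<theta> \<le> \<theta>'" "\<theta>' < pi"
  shows "stop_loss_le n (hyperbolic_measure n (\<lambda>v. - (hyperbolic_kernel n z \<theta>' v - hyperbolic_kernel n z \<theta> v)))
      (hyperbolic_measure n (\<lambda>v. hyperbolic_kernel n z \<theta>' v - hyperbolic_kernel n z \<theta> v))"
proof -
  define e where "e v = hyperbolic_kernel n z \<theta>' v - hyperbolic_kernel n z \<theta> v" for v
  have [measurable]: "e \<in> borel_measurable borel" unfolding e_def by measurable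
  have ck: "continuous_on {0<..} (hyperbolic_kernel n z \<theta>')" "continuous_on {0<..} (hyperbolic_kernel n z \<theta>)"
    using \<theta> by (auto intro!: hyperbolic_kernel_continuous z)
  have cont: "continuous_on {0<..} e" unfolding e_def by (intro continuous_intros ck)
  have "(\<integral>\<^sup>+w. stop_loss n l w \<partial>hyperbolic_measure n (\<lambda>v. - e v)) \<le> (\<integral>\<^sup>+w. stop_loss n l w \<partial>hyperbolic_measure n e)"
    if l: "2 < l" for l
  proof -
    obtain b where b: "1 \<le> b" "b + 1 / b = l" using hyperbolic_branch_sum[of l] l by (metis less_imp_le)
    have b1: "1 < b" using b l by (cases "b = 1") auto
    define \<psi> where "\<psi> v = indicator {1/b..b} v * (((b - v) * (v - 1/b)) ^ n * e v)" for v
    have sub: "{1/b..b} \<subseteq> {0<..}" using b1 by (auto intro: less_le_trans[of 0 "1/b"])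
    have ints: "set_integrable lborel {1/b..b} (\<lambda>v. ((b - v) * (v - 1/b)) ^ n * k v)" if "continuous_on {0<..} k" for k
      by (intro borel_integrable_atLeastAtMost' continuous_intros continuous_on_subset[OF that sub])
    have int: "integrable lborel \<psi>" using ints[OF cont] by (simp add: set_integrable_def \<psi>_def[abs_def])
    have "(LINT v|lborel. \<psi> v) = (LINT v:{1/b..b}|lborel. ((b - v) * (v - 1/b)) ^ n * hyperbolic_kernel n z \<theta>' v) -
        (LINT v:{1/b..b}|lborel. ((b - v) * (v - 1/b)) ^ n * hyperbolic_kernel n z \<theta> v)"
      unfolding set_integral_diff(2)[OF ints[OF ck(1)] ints[OF ck(2)], symmetric]
      by (simp add: set_lebesgue_integral_def \<psi>_def e_def right_diff_distrib)
    also have "\<dots> = integral {1/b..b} (\<lambda>v. ((b - v) * (v - 1/b)) ^ n * hyperbolic_kernel n z \<theta>' v) -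
        integral {1/b..b} (\<lambda>v. ((b - v) * (v - 1/b)) ^ n * hyperbolic_kernel n z \<theta> v)"
      using set_borel_integral_eq_integral(2)[OF ints[OF ck(1)]] set_borel_integral_eq_integral(2)[OF ints[OF ck(2)]] by simp
    also have "\<dots> \<ge> 0"
      using hyperbolic_kernel_integral_mono[OF b1 z \<theta>, of n] by simp
    finally have pos: "0 \<le> (LINT v|lborel. \<psi> v)" .
    have eq: "(\<integral>\<^sup>+w. stop_loss n l w \<partial>hyperbolic_measure n (\<lambda>v. \<sigma> * e v)) = (\<integral>\<^sup>+v. ennreal (\<sigma> * \<psi> v) \<partial>lborel)" for \<sigma>
    proof -
      have "(\<integral>\<^sup>+w. stop_loss n l w \<partial>hyperbolic_measure n (\<lambda>v. \<sigma> * e v)) =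
          (\<integral>\<^sup>+v. ennreal (v ^ n * (\<sigma> * e v)) * indicator {0<..} v * stop_loss n l (v + 1 / v) \<partial>lborel)"
        by (rule nn_integral_hyperbolic_measure) measurable
      also have "\<dots> = (\<integral>\<^sup>+v. ennreal (\<sigma> * \<psi> v) \<partial>lborel)"
      proof (intro nn_integral_cong_AE, use AE_lborel_singleton[of b] AE_lborel_singleton[of "1/b"] in eventually_elim)
        fix v assume ne: "v \<noteq> b" "v \<noteq> 1 / b"
        show "ennreal (v ^ n * (\<sigma> * e v)) * indicator {0<..} v * stop_loss n l (v + 1 / v) = ennreal (\<sigma> * \<psi> v)"
        proof (cases "0 < v")
          case v: True
          have d: "l - (v + 1 / v) = (b - v) * (v - 1 / b) / v"
            using hyperbolic_sum_diff[OF v, of b] b b1 by simp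
          have in_iff: "v + 1 / v < l \<longleftrightarrow> v \<in> {1/b..b}"
          proof -
            have "v + 1 / v < l \<longleftrightarrow> 0 < (b - v) * (v - 1 / b) / v" using d by linarith
            also have "\<dots> \<longleftrightarrow> 0 < (b - v) * (v - 1 / b)" using v by (simp add: zero_less_divide_iff)
            also have "\<dots> \<longleftrightarrow> v \<in> {1/b..b}"
            proof -
              have "1 / b < b" using b1 less_trans[of "1/b" 1 b] by simp
              then show ?thesis using ne by (auto simp: zero_less_mult_iff)
            qed
            finally show ?thesis .
          qed
          show ?thesis
          proof (cases "v \<in> {1/b..b}")
            case True
            have "0 \<le> l - (v + 1 / v)" using in_iff True by simp
            then have "ennreal (v ^ n * (\<sigma> * e v)) * ennreal ((l - (v + 1 / v)) ^ n) = ennreal (v ^ n * (\<sigma> * e v) * (l - (v + 1 / v)) ^ n)"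
              by (intro ennreal_mult''[symmetric]) simp
            also have "v ^ n * (\<sigma> * e v) * (l - (v + 1 / v)) ^ n = \<sigma> * \<psi> v"
              unfolding d using True v by (simp add: \<psi>_def power_divide)
            finally show ?thesis using True in_iff v by (simp add: stop_loss_def)
          next
            case False
            then have "\<not> v + 1 / v < l" using in_iff by blast
            moreover have "\<psi> v = 0" using False by (simp add: \<psi>_def)
            ultimately show ?thesis by (simp add: stop_loss_def)
          qed
        next
          case False
          then have "v \<notin> {1/b..b}" using sub by auto
          then show ?thesis using False by (simp add: \<psi>_def)
        qed
      qed
      finally show ?thesis .
    qed
    show ?thesis using nn_integral_negative_part_le[OF int pos] eq[of "-1"] eq[of 1] by simp
  qed
  then show ?thesis
    unfolding stop_loss_le_def e_def[symmetric]
    by (auto intro!: diffuse_hyperbolic_measure continuous_intros cont)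
qed

text \<open>
Hyperbolic monotonicity enters only here: \<open>v \<mapsto> f(u v) f(u / v)\<close> is \<open>h(v + 1 / v)\<close> for a function \<open>h\<close> to
which the stop-loss comparison applies.
\<close>
lemma HM_nn_integral_hyperbolic_le:
  fixes f :: "real \<Rightarrow> real"
  assumes f: "HM (Suc n) f" and [measurable]: "f \<in> borel_measurable borel" and u: "0 < u"
    and z: "0 < z" and \<theta>: "0 \<le> \<theta>" "\<theta> \<le> \<theta>'" "\<theta>' < pi"
  defines "e \<equiv> \<lambda>v. hyperbolic_kernel n z \<theta>' v - hyperbolic_kernel n z \<theta> v"
  shows "(\<integral>\<^sup>+v. ennreal (v ^ n * - e v * (f (u * v) * f (u / v))) * indicator {0<..} v \<partial>lborel) \<le>
      (\<integral>\<^sup>+v. ennreal (v ^ n * e v * (f (u * v) * f (u / v))) * indicator {0<..} v \<partial>lborel)"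
proof -
  obtain h where h: "\<And>v. 0 < v \<Longrightarrow> h (v + 1 / v) = f (u * v) * f (u / v)"
    and mono: "monotone_order_deriv (Suc n) h \<or> monotone_order_integral (Suc n) h"
    using f u unfolding HM_def by blast
  define H where "H w = f (u * hyperbolic_branch w) * f (u / hyperbolic_branch w)" for w
  have [measurable]: "H \<in> borel_measurable borel" unfolding H_def hyperbolic_branch_def by measurable
  have H: "H w = h w" if "2 \<le> w" for w
    using hyperbolic_branch_sum[OF that] h[of "hyperbolic_branch w"] by (simp add: H_def)
  have [measurable]: "e \<in> borel_measurable borel" unfolding e_def by measurable
  have le: "stop_loss_le n (hyperbolic_measure n (\<lambda>v. - e v)) (hyperbolic_measure n e)"
    unfolding e_def by (rule stop_loss_le_hyperbolic[OF z \<theta>])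
  have fnn: "0 \<le> f x" if "0 < x" for x using f that by (auto simp: HM_def)
  have eq: "(\<integral>\<^sup>+v. ennreal (v ^ n * k v * (f (u * v) * f (u / v))) * indicator {0<..} v \<partial>lborel) =
      (\<integral>\<^sup>+w. ennreal (h w) \<partial>hyperbolic_measure n k)"
    if [measurable]: "k \<in> borel_measurable borel" and diff: "diffuse_above_2 (hyperbolic_measure n k)" for k
  proof -
    have "(\<integral>\<^sup>+v. ennreal (v ^ n * k v * (f (u * v) * f (u / v))) * indicator {0<..} v \<partial>lborel) =
        (\<integral>\<^sup>+v. ennreal (v ^ n * k v) * indicator {0<..} v * ennreal (H (v + 1 / v)) \<partial>lborel)"
    proof (intro nn_integral_cong)
      fix v :: real
      show "ennreal (v ^ n * k v * (f (u * v) * f (u / v))) * indicator {0<..} v =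
          ennreal (v ^ n * k v) * indicator {0<..} v * ennreal (H (v + 1 / v))"
      proof (cases "0 < v")
        case v: True
        have "2 \<le> v + 1 / v" using hyperbolic_sum_gt_2[OF v] by (cases "v = 1") auto
        then have "H (v + 1 / v) = f (u * v) * f (u / v)" using H h[OF v] by simp
        moreover have "0 \<le> f (u * v) * f (u / v)" using fnn u v by simp
        ultimately show ?thesis using v by (simp add: ennreal_mult'')
      qed simp
    qed
    also have "\<dots> = (\<integral>\<^sup>+w. ennreal (H w) \<partial>hyperbolic_measure n k)"
      by (rule nn_integral_hyperbolic_measure[symmetric]) measurable
    also have "\<dots> = (\<integral>\<^sup>+w. ennreal (h w) \<partial>hyperbolic_measure n k)"
      using diffuse_above_2D(3)[OF diff] by (intro nn_integral_cong_AE) (auto elim!: eventually_mono simp: H)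
    finally show ?thesis .
  qed
  have "(\<integral>\<^sup>+w. ennreal (h w) \<partial>hyperbolic_measure n (\<lambda>v. - e v)) \<le> (\<integral>\<^sup>+w. ennreal (h w) \<partial>hyperbolic_measure n e)"
    using mono stop_loss_le_monotone_order_deriv[OF le] stop_loss_le_monotone_order_integral[OF le] by blast
  moreover have "diffuse_above_2 (hyperbolic_measure n (\<lambda>v. - e v))" "diffuse_above_2 (hyperbolic_measure n e)"
    using le by (auto simp: stop_loss_le_def)
  ultimately show ?thesis by (simp only: eq borel_measurable_uminus \<open>e \<in> borel_measurable borel\<close>)
qed

section \<open>Growth of the modulus along circular arcs\<close>

lemma nn_integral_square_substitution:
  fixes F :: "real \<Rightarrow> ennreal"
  assumes [measurable]: "F \<in> borel_measurable borel" and c: "0 < c"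
  shows "(\<integral>\<^sup>+y. F y * indicator {0<..} y \<partial>lborel) = (\<integral>\<^sup>+u. F (c * u\<^sup>2) * ennreal (2 * c * u) * indicator {0<..} u \<partial>lborel)"
proof -
  have drop0: "(\<integral>\<^sup>+y. F y * indicator {0<..} y \<partial>lborel) = emeasure (density lborel F) (\<Union>m::nat. {0..c * (real m + 1)\<^sup>2})"
    if "F \<in> borel_measurable borel" "0 < c" for F :: "real \<Rightarrow> ennreal" and c
  proof -
    have "(\<Union>m::nat. {0..c * (real m + 1)\<^sup>2}) = {0..}"
    proof (safe; simp)
      fix y :: real assume "0 \<le> y"
      obtain m :: nat where "y / c \<le> real m" using real_arch_simple by blast
      also have "real m \<le> (real m + 1)\<^sup>2" by (simp add: power2_eq_square algebra_simps)
      finally show "\<exists>m::nat. y \<le> c * (real m + 1)\<^sup>2" using that by (auto simp: field_simps)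
    qed
    then show ?thesis using that AE_lborel_singleton[of 0]
      by (auto simp: emeasure_density intro!: nn_integral_cong_AE elim!: eventually_mono split: split_indicator)
  qed
  have drop0': "(\<integral>\<^sup>+y. F y * indicator {0<..} y \<partial>lborel) = emeasure (density lborel F) (\<Union>m::nat. {0..real m + 1})"
    if "F \<in> borel_measurable borel" for F :: "real \<Rightarrow> ennreal"
  proof -
    have "(\<Union>m::nat. {0..real m + 1}) = {0..}"
    proof (safe; simp)
      fix y :: real assume "0 \<le> y"
      obtain m :: nat where "y \<le> real m" using real_arch_simple by blast
      then show "\<exists>m::nat. y \<le> real m + 1" by (intro exI[of _ m]) simp
    qed
    then show ?thesis using that AE_lborel_singleton[of 0]
      by (auto simp: emeasure_density intro!: nn_integral_cong_AE elim!: eventually_mono split: split_indicator)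
  qed
  have step: "emeasure (density lborel F) {0..c * (real m + 1)\<^sup>2} =
      emeasure (density lborel (\<lambda>u. F (c * u\<^sup>2) * ennreal (2 * c * u))) {0..real m + 1}" for m :: nat
  proof -
    have "(\<integral>\<^sup>+x. F x * indicator {c * 0\<^sup>2..c * (real m + 1)\<^sup>2} x \<partial>lborel) =
        (\<integral>\<^sup>+x. F (c * x\<^sup>2) * ennreal (2 * c * x) * indicator {0..real m + 1} x \<partial>lborel)"
      by (rule nn_integral_substitution_aux) (use c in \<open>auto intro!: derivative_eq_intros continuous_intros\<close>)
    then show ?thesis by (simp add: emeasure_density)
  qed
  have "(\<integral>\<^sup>+y. F y * indicator {0<..} y \<partial>lborel) = (SUP m. emeasure (density lborel F) {0..c * (real m + 1)\<^sup>2})"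
    using c by (subst drop0[OF assms]) (auto intro!: SUP_emeasure_incseq[symmetric] simp: incseq_def mult_left_mono)
  also have "\<dots> = (SUP m::nat. emeasure (density lborel (\<lambda>u. F (c * u\<^sup>2) * ennreal (2 * c * u))) {0..real m + 1})"
    unfolding step ..
  also have "\<dots> = (\<integral>\<^sup>+u. F (c * u\<^sup>2) * ennreal (2 * c * u) * indicator {0<..} u \<partial>lborel)"
    by (subst drop0') (auto intro!: SUP_emeasure_incseq simp: incseq_def)
  finally show ?thesis .
qed

text \<open>
Two one-dimensional substitutions: \<open>y = u\<^sup>2 / x\<close> for fixed \<open>x\<close>, then \<open>x = u v\<close> for fixed \<open>u\<close>.
\<close>
lemma nn_integral_hyperbolic_coordinates:
  fixes g :: "real \<Rightarrow> real \<Rightarrow> ennreal"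
  assumes [measurable]: "(\<lambda>(x, y). g x y) \<in> borel_measurable (borel \<Otimes>\<^sub>M borel)"
  shows "(\<integral>\<^sup>+x. (\<integral>\<^sup>+y. g x y * indicator {0<..} y \<partial>lborel) * indicator {0<..} x \<partial>lborel) =
    (\<integral>\<^sup>+u. (\<integral>\<^sup>+v. ennreal (2 * u / v) * g (u * v) (u / v) * indicator {0<..} v \<partial>lborel) * indicator {0<..} u \<partial>lborel)"
proof -
  have "(\<integral>\<^sup>+x. (\<integral>\<^sup>+y. g x y * indicator {0<..} y \<partial>lborel) * indicator {0<..} x \<partial>lborel) =
      (\<integral>\<^sup>+x. (\<integral>\<^sup>+u. g x (1 / x * u\<^sup>2) * ennreal (2 * (1 / x) * u) * indicator {0<..} u * indicator {0<..} x \<partial>lborel) \<partial>lborel)"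
  proof (intro nn_integral_cong)
    fix x :: real
    show "(\<integral>\<^sup>+y. g x y * indicator {0<..} y \<partial>lborel) * indicator {0<..} x =
      (\<integral>\<^sup>+u. g x (1 / x * u\<^sup>2) * ennreal (2 * (1 / x) * u) * indicator {0<..} u * indicator {0<..} x \<partial>lborel)"
    proof (cases "0 < x")
      case True
      then show ?thesis
        using nn_integral_square_substitution[of "g x" "1 / x"] by simp
    qed simp
  qed
  also have "\<dots> = (\<integral>\<^sup>+u. (\<integral>\<^sup>+x. g x (1 / x * u\<^sup>2) * ennreal (2 * (1 / x) * u) * indicator {0<..} u * indicator {0<..} x \<partial>lborel) \<partial>lborel)"
    by (rule lborel_pair.Fubini') measurable
  also have "\<dots> = (\<integral>\<^sup>+u. (\<integral>\<^sup>+v. ennreal (2 * u / v) * g (u * v) (u / v) * indicator {0<..} v \<partial>lborel) * indicator {0<..} u \<partial>lborel)"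
  proof (intro nn_integral_cong)
    fix u :: real
    show "(\<integral>\<^sup>+x. g x (1 / x * u\<^sup>2) * ennreal (2 * (1 / x) * u) * indicator {0<..} u * indicator {0<..} x \<partial>lborel) =
        (\<integral>\<^sup>+v. ennreal (2 * u / v) * g (u * v) (u / v) * indicator {0<..} v \<partial>lborel) * indicator {0<..} u"
    proof (cases "0 < u")
      case u: True
      have "(\<integral>\<^sup>+x. g x (1 / x * u\<^sup>2) * ennreal (2 * (1 / x) * u) * indicator {0<..} x \<partial>lborel) =
        ennreal \<bar>u\<bar> * (\<integral>\<^sup>+v. g (0 + u * v) (1 / (0 + u * v) * u\<^sup>2) * ennreal (2 * (1 / (0 + u * v)) * u) * indicator {0<..} (0 + u * v) \<partial>lborel)"
        by (rule nn_integral_real_affine) (use u in auto)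
      also have "\<dots> = (\<integral>\<^sup>+v. ennreal u * (g (0 + u * v) (1 / (0 + u * v) * u\<^sup>2) * ennreal (2 * (1 / (0 + u * v)) * u) * indicator {0<..} (0 + u * v)) \<partial>lborel)"
        using u by (subst nn_integral_cmult) auto
      also have "\<dots> = (\<integral>\<^sup>+v. ennreal (2 * u / v) * g (u * v) (u / v) * indicator {0<..} v \<partial>lborel)"
      proof (intro nn_integral_cong)
        fix v :: real
        show "ennreal u * (g (0 + u * v) (1 / (0 + u * v) * u\<^sup>2) * ennreal (2 * (1 / (0 + u * v)) * u) * indicator {0<..} (0 + u * v)) =
          ennreal (2 * u / v) * g (u * v) (u / v) * indicator {0<..} v"
        proof (cases "0 < v")
          case v: True
          have 1: "1 / (0 + u * v) * u\<^sup>2 = u / v" using u v by (simp add: power2_eq_square)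
          have "ennreal u * ennreal (2 * (1 / (0 + u * v)) * u) = ennreal (u * (2 * (1 / (0 + u * v)) * u))"
            using u by (intro ennreal_mult'[symmetric]) simp
          also have "u * (2 * (1 / (0 + u * v)) * u) = 2 * u / v" using u v by simp
          finally have 2: "ennreal u * ennreal (2 * (1 / (0 + u * v)) * u) = ennreal (2 * u / v)" .
          show ?thesis unfolding 1 2[symmetric] using u v by (simp add: mult_ac)
        next
          case False
          then show ?thesis using u by (simp add: zero_less_mult_iff)
        qed
      qed
      finally show ?thesis using u by simp
    qed simp
  qed
  finally show ?thesis .
qed

text \<open>
The product of the two factors is \<open>1 + z\<^sup>2 + z (v cis \<theta> + cis (- \<theta>) / v)\<close> with \<open>z = r u\<close>; this is
\<open>z / v\<close> times the denominator of the kernel.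
\<close>
lemma hyperbolic_kernel_factor:
  fixes r u v \<theta> :: real
  assumes r: "0 < r" and u: "0 < u" and v: "0 < v"
  shows "Re (1 / ((1 + of_real r * cis \<theta> * of_real (u * v)) * (1 + cnj (of_real r * cis \<theta>) * of_real (u / v))) ^ Suc n) =
    (v / (r * u)) ^ Suc n * hyperbolic_kernel n (r * u) \<theta> v"
proof -
  define z where "z = r * u"
  have z: "z > 0" using r u by (simp add: z_def)
  define D where "D = of_real ((z + 1/z) * v) + of_real (v\<^sup>2) * cis \<theta> + cis (- \<theta>)"
  have cc: "cis \<theta> * cis (- \<theta>) = 1" by (simp add: cis_mult)
  have "(1 + of_real r * cis \<theta> * of_real (u * v)) * (1 + cnj (of_real r * cis \<theta>) * of_real (u / v)) =
      (1 + of_real (z * v) * cis \<theta>) * (1 + of_real (z / v) * cis (- \<theta>))"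
    by (simp add: z_def cis_cnj mult_ac)
  also have "\<dots> = 1 + of_real (z * v) * cis \<theta> + of_real (z / v) * cis (- \<theta>) + of_real (z * v) * of_real (z / v) * (cis \<theta> * cis (- \<theta>))"
    by (simp add: algebra_simps)
  also have "\<dots> = of_real (z / v) * D"
    unfolding cc D_def using v z by (simp add: field_simps power2_eq_square)
  finally have "1 / ((1 + of_real r * cis \<theta> * of_real (u * v)) * (1 + cnj (of_real r * cis \<theta>) * of_real (u / v))) ^ Suc n =
      of_real ((v / z) ^ Suc n) * (1 / D ^ Suc n)"
    using v z by (simp add: power_mult_distrib power_divide del: power_Suc)
  then have "Re (1 / ((1 + of_real r * cis \<theta> * of_real (u * v)) * (1 + cnj (of_real r * cis \<theta>) * of_real (u / v))) ^ Suc n) =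
      (v / z) ^ Suc n * Re (1 / D ^ Suc n)"
    by (simp only: times_complex.sel Re_complex_of_real Im_complex_of_real mult_zero_left diff_0_right)
  then show ?thesis by (simp only: hyperbolic_kernel_def D_def z_def)
qed

text \<open>
The two sides are the integrals of the negative and of the positive part of the increment of
\<open>\<bar>\<Phi>(z)\<bar>\<^sup>2\<close> as \<open>\<theta>\<close> moves to \<open>\<theta>'\<close>.  Keeping them apart lets the inequality be proved separately for
each \<open>u\<close>, although the representation of \<open>h\<close> may depend on \<open>u\<close> in a non-measurable way.
\<close>
lemma HM_product_kernel_le:
  fixes f :: "real \<Rightarrow> real"
  assumes f: "HM (Suc n) f" and [measurable]: "f \<in> borel_measurable borel"
    and r: "0 < r" and \<theta>: "0 \<le> \<theta>" "\<theta> \<le> \<theta>'" "\<theta>' < pi"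
  defines "E \<equiv> \<lambda>\<theta> x y. Re (1 / ((1 + of_real r * cis \<theta> * of_real x) * (1 + cnj (of_real r * cis \<theta>) * of_real y)) ^ Suc n)"
  shows "(\<integral>\<^sup>+x. (\<integral>\<^sup>+y. ennreal (- (f x * f y * (E \<theta>' x y - E \<theta> x y))) * indicator {0<..} y \<partial>lborel) * indicator {0<..} x \<partial>lborel) \<le>
      (\<integral>\<^sup>+x. (\<integral>\<^sup>+y. ennreal (f x * f y * (E \<theta>' x y - E \<theta> x y)) * indicator {0<..} y \<partial>lborel) * indicator {0<..} x \<partial>lborel)"
proof -
  define e where "e u v = hyperbolic_kernel n (r * u) \<theta>' v - hyperbolic_kernel n (r * u) \<theta> v" for u v
  have [measurable]: "e u \<in> borel_measurable borel" for u unfolding e_def[abs_def] by measurable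
  have E_meas[measurable]: "(\<lambda>(x, y). E \<theta> x y) \<in> borel_measurable (borel \<Otimes>\<^sub>M borel)" for \<theta>
    unfolding E_def by measurable
  define d where "d x y = f x * f y * (E \<theta>' x y - E \<theta> x y)" for x y
  have [measurable]: "(\<lambda>(x, y). d x y) \<in> borel_measurable (borel \<Otimes>\<^sub>M borel)" unfolding d_def by measurable
  define C where "C u = 2 * u / (r * u) ^ Suc n" for u
  define J where "J \<sigma> u = (\<integral>\<^sup>+v. ennreal (v ^ n * (\<sigma> * e u v) * (f (u * v) * f (u / v))) * indicator {0<..} v \<partial>lborel)" for \<sigma> u
  have eq: "(\<integral>\<^sup>+x. (\<integral>\<^sup>+y. ennreal (\<sigma> * d x y) * indicator {0<..} y \<partial>lborel) * indicator {0<..} x \<partial>lborel) =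
      (\<integral>\<^sup>+u. ennreal (C u) * J \<sigma> u * indicator {0<..} u \<partial>lborel)" for \<sigma>
  proof -
    have "(\<integral>\<^sup>+x. (\<integral>\<^sup>+y. ennreal (\<sigma> * d x y) * indicator {0<..} y \<partial>lborel) * indicator {0<..} x \<partial>lborel) =
        (\<integral>\<^sup>+u. (\<integral>\<^sup>+v. ennreal (2 * u / v) * ennreal (\<sigma> * d (u * v) (u / v)) * indicator {0<..} v \<partial>lborel) * indicator {0<..} u \<partial>lborel)"
      by (rule nn_integral_hyperbolic_coordinates) measurable
    also have "\<dots> = (\<integral>\<^sup>+u. ennreal (C u) * J \<sigma> u * indicator {0<..} u \<partial>lborel)"
    proof (intro nn_integral_cong)
      fix u :: real
      show "(\<integral>\<^sup>+v. ennreal (2 * u / v) * ennreal (\<sigma> * d (u * v) (u / v)) * indicator {0<..} v \<partial>lborel) * indicator {0<..} u =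
          ennreal (C u) * J \<sigma> u * indicator {0<..} u"
      proof (cases "0 < u")
        case u: True
        have "(\<integral>\<^sup>+v. ennreal (2 * u / v) * ennreal (\<sigma> * d (u * v) (u / v)) * indicator {0<..} v \<partial>lborel) =
          (\<integral>\<^sup>+v. ennreal (C u) * (ennreal (v ^ n * (\<sigma> * e u v) * (f (u * v) * f (u / v))) * indicator {0<..} v) \<partial>lborel)"
        proof (intro nn_integral_cong)
          fix v :: real
          show "ennreal (2 * u / v) * ennreal (\<sigma> * d (u * v) (u / v)) * indicator {0<..} v =
            ennreal (C u) * (ennreal (v ^ n * (\<sigma> * e u v) * (f (u * v) * f (u / v))) * indicator {0<..} v)"
          proof (cases "0 < v")
            case v: True
            have "E \<theta>' (u * v) (u / v) - E \<theta> (u * v) (u / v) = (v / (r * u)) ^ Suc n * e u v"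
              unfolding E_def hyperbolic_kernel_factor[OF r u v] e_def by (simp only: right_diff_distrib)
            then have "2 * u / v * (\<sigma> * d (u * v) (u / v)) = C u * (v ^ n * (\<sigma> * e u v) * (f (u * v) * f (u / v)))"
              using v by (simp add: d_def C_def power_divide)
            moreover have "0 \<le> 2 * u / v" "0 \<le> C u" using u v r by (auto simp: C_def)
            ultimately show ?thesis using v
              by (simp add: ennreal_mult'[symmetric] del: power_Suc)
          qed simp
        qed
        also have "\<dots> = ennreal (C u) * J \<sigma> u" unfolding J_def by (rule nn_integral_cmult) measurable
        finally show ?thesis by simp
      qed simp
    qed
    finally show ?thesis .
  qed
  have "J (- 1) u \<le> J 1 u" if u: "0 < u" for u
    using HM_nn_integral_hyperbolic_le[OF f \<open>f \<in> borel_measurable borel\<close> u mult_pos_pos[OF r u] \<theta>] by (simp add: J_def e_def)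
  then have "(\<integral>\<^sup>+u. ennreal (C u) * J (- 1) u * indicator {0<..} u \<partial>lborel) \<le> (\<integral>\<^sup>+u. ennreal (C u) * J 1 u * indicator {0<..} u \<partial>lborel)"
    by (intro nn_integral_mono) (auto split: split_indicator intro!: mult_left_mono)
  then show ?thesis using eq[of "- 1"] eq[of 1] by (simp add: d_def)
qed

text \<open>
\<open>\<Phi>\<close> is considered for a weight \<open>f\<close> that is merely integrable against \<open>1 / (1 + x)\<close> to the power \<open>n + 1\<close>, because
quotients lead to the weight \<open>x\<^sup>n\<^sup>+\<^sup>1 f(x)\<close>.
\<close>
theorem HM_modulus_mono:
  fixes f :: "real \<Rightarrow> real"
  assumes f: "HM (Suc n) f" and fm[measurable]: "f \<in> borel_measurable borel" and f0: "\<And>x. x \<le> 0 \<Longrightarrow> f x = 0"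
    and int: "integrable lborel (\<lambda>x. f x / (1 + \<bar>x\<bar>) ^ Suc n)"
    and r: "0 < r" and \<theta>: "0 \<le> \<theta>" "\<theta> \<le> \<theta>'" "\<theta>' < pi"
  defines "\<Phi> \<equiv> \<lambda>z. LINT x|lborel. of_real (f x) / (1 + z * of_real x) ^ Suc n"
  shows "norm (\<Phi> (of_real r * cis \<theta>)) \<le> norm (\<Phi> (of_real r * cis \<theta>'))"
proof -
  define G where "G z x = of_real (f x) / (1 + z * of_real x) ^ Suc n" for z :: complex and x :: real
  have [measurable]: "G z \<in> borel_measurable borel" for z unfolding G_def[abs_def] by measurable
  have \<Phi>_G: "\<Phi> z = (LINT x|lborel. G z x)" for z by (simp only: \<Phi>_def G_def)
  have fnn: "0 \<le> f x" for x using f f0[of x] by (cases "0 < x") (auto simp: HM_def)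
  have G_int: "integrable lborel (G z)" if z: "z \<in> - \<real>\<^sub>\<le>\<^sub>0" for z
  proof -
    obtain \<delta> where \<delta>: "0 < \<delta>" "\<And>y v. y \<in> ball z \<delta> \<Longrightarrow> 0 \<le> v \<Longrightarrow> \<delta> * (1 + v) \<le> norm (1 + y * of_real v)"
      using slit_plane_linear_lower_bound[OF z] by metis
    show ?thesis
    proof (rule Bochner_Integration.integrable_bound)
      show "integrable lborel (\<lambda>x. 1 / \<delta> ^ Suc n * (f x / (1 + \<bar>x\<bar>) ^ Suc n))" using int by (rule integrable_mult_right)
      show "AE x in lborel. norm (G z x) \<le> norm (1 / \<delta> ^ Suc n * (f x / (1 + \<bar>x\<bar>) ^ Suc n))"
      proof (rule AE_I2)
        fix x :: real
        show "norm (G z x) \<le> norm (1 / \<delta> ^ Suc n * (f x / (1 + \<bar>x\<bar>) ^ Suc n))"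
        proof (cases "0 < x")
          case True
          have "(\<delta> * (1 + x)) ^ Suc n \<le> norm (1 + z * of_real x) ^ Suc n"
            using \<delta> True by (intro power_mono) auto
          moreover have "0 < (\<delta> * (1 + x)) ^ Suc n" using \<delta> True by simp
          ultimately have "f x / norm (1 + z * of_real x) ^ Suc n \<le> f x / (\<delta> * (1 + x)) ^ Suc n"
            using fnn by (intro divide_left_mono mult_pos_pos) auto
          also have "\<dots> = norm (1 / \<delta> ^ Suc n * (f x / (1 + \<bar>x\<bar>) ^ Suc n))"
            using \<delta> True fnn[of x] by (simp add: power_mult_distrib abs_mult del: power_Suc)
          finally show ?thesis using fnn[of x] by (simp add: G_def norm_divide norm_power del: power_Suc)
        next
          case False
          then show ?thesis using f0[of x] by (simp add: G_def)
        qed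
      qed
    qed measurable
  qed
  have [measurable]: "cnj \<in> borel_measurable borel"
    by (intro borel_measurable_continuous_onI continuous_intros)
  define K where "K z p = Re (G z (fst p) * cnj (G z (snd p)))" for z p
  have [measurable]: "K z \<in> borel_measurable (lborel \<Otimes>\<^sub>M lborel)" for z unfolding K_def[abs_def] by measurable
  have prod: "integrable (lborel \<Otimes>\<^sub>M lborel) (\<lambda>p. G z (fst p) * cnj (G z (snd p)))"
    and prod_eq: "(\<integral>p. G z (fst p) * cnj (G z (snd p)) \<partial>(lborel \<Otimes>\<^sub>M lborel)) = \<Phi> z * cnj (\<Phi> z)" if z: "z \<in> - \<real>\<^sub>\<le>\<^sub>0" for z
  proof -
    show i: "integrable (lborel \<Otimes>\<^sub>M lborel) (\<lambda>p. G z (fst p) * cnj (G z (snd p)))"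
      by (rule lborel_pair.Fubini_integrable)
         (use G_int[OF z] in \<open>auto simp: norm_mult intro!: integrable_mult_left integrable_norm\<close>)
    have "(\<integral>p. G z (fst p) * cnj (G z (snd p)) \<partial>(lborel \<Otimes>\<^sub>M lborel)) = (LINT x|lborel. LINT y|lborel. G z x * cnj (G z y))"
      using lborel_pair.integral_fst'[OF i] by simp
    then show "(\<integral>p. G z (fst p) * cnj (G z (snd p)) \<partial>(lborel \<Otimes>\<^sub>M lborel)) = \<Phi> z * cnj (\<Phi> z)"
      unfolding \<Phi>_G by simp
  qed
  have K_int: "integrable (lborel \<Otimes>\<^sub>M lborel) (K z)" if "z \<in> - \<real>\<^sub>\<le>\<^sub>0" for z
    unfolding K_def[abs_def] by (rule integrable_Re[OF prod[OF that]])
  have K_eq: "(\<integral>p. K z p \<partial>(lborel \<Otimes>\<^sub>M lborel)) = (norm (\<Phi> z))\<^sup>2" if "z \<in> - \<real>\<^sub>\<le>\<^sub>0" for z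
    unfolding K_def integral_Re[OF prod[OF that]] prod_eq[OF that]
    by (simp add: complex_norm_square[symmetric] flip: of_real_power)
  define z where "z \<theta> = of_real r * cis \<theta>" for \<theta>
  have zS: "z \<theta> \<in> - \<real>\<^sub>\<le>\<^sub>0" "z \<theta>' \<in> - \<real>\<^sub>\<le>\<^sub>0"
    using cis_in_slit_plane[of \<theta>] cis_in_slit_plane[of \<theta>'] \<theta> r
    by (auto simp: z_def complex_nonpos_Reals_iff zero_le_mult_iff mult_le_0_iff)
  define E where "E \<theta> x y = Re (1 / ((1 + z \<theta> * of_real x) * (1 + cnj (z \<theta>) * of_real y)) ^ Suc n)" for \<theta> x y
  have KE: "K (z \<theta>) (x, y) = f x * f y * E \<theta> x y" for \<theta> x y
  proof -
    have "G (z \<theta>) x * cnj (G (z \<theta>) y) = of_real (f x * f y) * (1 / ((1 + z \<theta> * of_real x) * (1 + cnj (z \<theta>) * of_real y)) ^ Suc n)"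
      by (simp add: G_def power_mult_distrib del: power_Suc)
    then show ?thesis
      unfolding K_def E_def by (simp only: fst_conv snd_conv times_complex.sel Re_complex_of_real Im_complex_of_real mult_zero_left diff_0_right)
  qed
  define d where "d p = K (z \<theta>') p - K (z \<theta>) p" for p
  have [measurable]: "d \<in> borel_measurable (lborel \<Otimes>\<^sub>M lborel)" unfolding d_def by measurable
  have d_int: "integrable (lborel \<Otimes>\<^sub>M lborel) d" unfolding d_def by (intro Bochner_Integration.integrable_diff K_int zS)
  have nn: "(\<integral>\<^sup>+p. ennreal (\<sigma> * d p) \<partial>(lborel \<Otimes>\<^sub>M lborel)) =
      (\<integral>\<^sup>+x. (\<integral>\<^sup>+y. ennreal (\<sigma> * (f x * f y * (E \<theta>' x y - E \<theta> x y))) * indicator {0<..} y \<partial>lborel) * indicator {0<..} x \<partial>lborel)" for \<sigma>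
  proof -
    have "(\<integral>\<^sup>+p. ennreal (\<sigma> * d p) \<partial>(lborel \<Otimes>\<^sub>M lborel)) = (\<integral>\<^sup>+x. (\<integral>\<^sup>+y. ennreal (\<sigma> * d (x, y)) \<partial>lborel) \<partial>lborel)"
      by (rule lborel.nn_integral_fst[symmetric]) measurable
    also have "\<dots> = (\<integral>\<^sup>+x. (\<integral>\<^sup>+y. ennreal (\<sigma> * (f x * f y * (E \<theta>' x y - E \<theta> x y))) * indicator {0<..} y \<partial>lborel) * indicator {0<..} x \<partial>lborel)"
    proof (intro nn_integral_cong)
      fix x :: real
      have "(\<integral>\<^sup>+y. ennreal (\<sigma> * d (x, y)) \<partial>lborel) = (\<integral>\<^sup>+y. ennreal (\<sigma> * (f x * f y * (E \<theta>' x y - E \<theta> x y))) * indicator {0<..} y \<partial>lborel)"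
        by (intro nn_integral_cong) (auto simp: d_def KE right_diff_distrib f0 split: split_indicator)
      then show "(\<integral>\<^sup>+y. ennreal (\<sigma> * d (x, y)) \<partial>lborel) =
          (\<integral>\<^sup>+y. ennreal (\<sigma> * (f x * f y * (E \<theta>' x y - E \<theta> x y))) * indicator {0<..} y \<partial>lborel) * indicator {0<..} x"
        using f0[of x] by (cases "0 < x") auto
    qed
    finally show ?thesis .
  qed
  have "(\<integral>\<^sup>+p. ennreal (- 1 * d p) \<partial>(lborel \<Otimes>\<^sub>M lborel)) \<le> (\<integral>\<^sup>+p. ennreal (1 * d p) \<partial>(lborel \<Otimes>\<^sub>M lborel))"
    unfolding nn using HM_product_kernel_le[OF f fm r \<theta>] by (simp add: E_def z_def)
  then have le: "(\<integral>\<^sup>+p. ennreal (- d p) \<partial>(lborel \<Otimes>\<^sub>M lborel)) \<le> (\<integral>\<^sup>+p. ennreal (d p) \<partial>(lborel \<Otimes>\<^sub>M lborel))" by simp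
  have "(\<integral>\<^sup>+p. ennreal (d p) \<partial>(lborel \<Otimes>\<^sub>M lborel)) < \<top>" using d_int by (auto simp: real_integrable_def less_top)
  with le have "0 \<le> (\<integral>p. d p \<partial>(lborel \<Otimes>\<^sub>M lborel))"
    unfolding real_lebesgue_integral_def[OF d_int] by (simp add: enn2real_mono)
  also have "(\<integral>p. d p \<partial>(lborel \<Otimes>\<^sub>M lborel)) = (norm (\<Phi> (z \<theta>')))\<^sup>2 - (norm (\<Phi> (z \<theta>)))\<^sup>2"
    unfolding d_def Bochner_Integration.integral_diff[OF K_int[OF zS(2)] K_int[OF zS(1)]] K_eq[OF zS(1)] K_eq[OF zS(2)] ..
  finally have "(norm (\<Phi> (z \<theta>)))\<^sup>2 \<le> (norm (\<Phi> (z \<theta>')))\<^sup>2" by simp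
  then have "norm (\<Phi> (z \<theta>)) \<le> norm (\<Phi> (z \<theta>'))" by (rule power2_le_imp_le) simp
  then show ?thesis by (simp add: z_def)
qed

section \<open>Self-maps of the right half-plane\<close>

text \<open>
The Cayley map carries the unit disc to the right half-plane, where \<open>Re\<close> can be read off from \<open>1 - \<bar>\<zeta>\<bar>\<^sup>2\<close>.
\<close>
lemma Re_cayley_pos:
  fixes \<zeta> :: complex
  assumes "norm \<zeta> < 1"
  shows "0 < Re ((1 + \<zeta>) / (1 - \<zeta>))"
proof -
  have "\<zeta> \<noteq> 1" using assms by auto
  have "Re ((1 + \<zeta>) / (1 - \<zeta>)) = (1 - (norm \<zeta>)\<^sup>2) / (norm (1 - \<zeta>))\<^sup>2"
    unfolding cmod_power2 by (simp add: Re_divide power2_eq_square algebra_simps)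
  moreover have "(norm \<zeta>)\<^sup>2 < 1" using assms by (simp add: power_less_one_iff abs_square_less_1)
  ultimately show ?thesis using \<open>\<zeta> \<noteq> 1\<close> by simp
qed

text \<open>
The inequality says \<open>\<bar>arg P(q)\<bar> \<le> \<bar>arg q\<bar>\<close>.  In the hyperbolic metric of the half-plane \<open>arg q\<close> measures the distance from
\<open>q\<close> to the positive axis, which is attained at \<open>\<bar>q\<bar>\<close>; a holomorphic self-map does not increase distances and \<open>P\<close>
maps the axis into itself.  Concretely this is the Schwarz lemma with \<open>r = \<bar>q\<bar>\<close> and \<open>\<rho> = P(r)\<close> moved to the origin.
\<close>
lemma schwarz_pick_sector:
  fixes P :: "complex \<Rightarrow> complex"
  assumes hol: "P holomorphic_on {q. 0 < Re q}"
    and right: "\<And>q. 0 < Re q \<Longrightarrow> 0 < Re (P q)"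
    and real: "\<And>r. 0 < r \<Longrightarrow> Im (P (of_real r)) = 0"
    and q: "0 < Re q"
  shows "norm (P q) * Re q \<le> norm q * Re (P q)"
proof -
  define r where "r = norm q"
  have r: "r > 0" using q by (auto simp: r_def)
  define \<rho> where "\<rho> = Re (P (of_real r))"
  have \<rho>: "\<rho> > 0" "P (of_real r) = of_real \<rho>"
    using right[of "of_real r"] real[OF r] r by (auto simp: \<rho>_def complex_eq_iff)
  \<comment> \<open>\<open>m\<close> carries the disc to the half-plane and \<open>0\<close> to \<open>r\<close>; \<open>B\<close> is \<open>P\<close> read in the discs centred at \<open>r\<close> and \<open>\<rho>\<close>.\<close>
  define m where "m \<zeta> = of_real r * ((1 + \<zeta>) / (1 - \<zeta>))" for \<zeta> :: complex
  define B where "B \<zeta> = (P (m \<zeta>) - of_real \<rho>) / (P (m \<zeta>) + of_real \<rho>)" for \<zeta>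
  have Re_pos: "0 < Re (m \<zeta>)" if "norm \<zeta> < 1" for \<zeta>
  proof -
    have "0 < Re ((1 + \<zeta>) / (1 - \<zeta>))" using that by (rule Re_cayley_pos)
    moreover have "Re (m \<zeta>) = r * Re ((1 + \<zeta>) / (1 - \<zeta>))"
      unfolding m_def by (simp only: times_complex.sel Re_complex_of_real Im_complex_of_real mult_zero_left diff_0_right)
    ultimately show ?thesis using r by simp
  qed
  have nz: "P w + of_real \<rho> \<noteq> 0" if "0 < Re w" for w
    using right[OF that] \<rho>(1) by (auto simp: complex_eq_iff)
  have norm_lt: "norm (p - of_real \<rho>) < norm (p + of_real \<rho>)" if "0 < Re p" for p
  proof -
    have "(norm (p - of_real \<rho>))\<^sup>2 < (norm (p + of_real \<rho>))\<^sup>2"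
      using that \<rho>(1) unfolding cmod_power2 by (simp add: power2_eq_square algebra_simps)
    then show ?thesis by (rule power2_less_imp_less) simp
  qed
  have "norm (B \<zeta>) \<le> norm \<zeta>" if \<zeta>: "norm \<zeta> < 1" for \<zeta>
  proof (rule Schwarz_Lemma(1)[OF _ _ _ \<zeta>])
    have "m holomorphic_on ball 0 1"
      unfolding m_def by (intro holomorphic_intros) auto
    then have "(P \<circ> m) holomorphic_on ball 0 1"
      by (rule holomorphic_on_compose_gen[OF _ hol]) (use Re_pos in auto)
    then show "B holomorphic_on ball 0 1"
      unfolding B_def o_def by (intro holomorphic_intros) (use nz Re_pos in auto)
    show "B 0 = 0" by (simp add: B_def m_def \<rho>)
    show "norm (B \<zeta>) < 1" if "norm \<zeta> < 1" for \<zeta>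
      using norm_lt[OF right[OF Re_pos[OF that]]] nz[OF Re_pos[OF that]]
      by (simp add: B_def norm_divide divide_less_eq)
  qed
  moreover define \<zeta> where "\<zeta> = (q - of_real r) / (q + of_real r)"
  have qr: "q + of_real r \<noteq> 0" using q r by (auto simp: complex_eq_iff)
  have "norm (q - of_real r) < norm (q + of_real r)"
  proof -
    have "(norm (q - of_real r))\<^sup>2 < (norm (q + of_real r))\<^sup>2"
      using q r unfolding cmod_power2 by (simp add: power2_eq_square algebra_simps)
    then show ?thesis by (rule power2_less_imp_less) simp
  qed
  then have "norm \<zeta> < 1" using qr by (simp add: \<zeta>_def norm_divide divide_less_eq)
  moreover have "m \<zeta> = q"
  proof -
    have "1 + \<zeta> = 2 * q / (q + of_real r)" "1 - \<zeta> = 2 * of_real r / (q + of_real r)"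
      using qr by (simp_all add: \<zeta>_def field_simps)
    then show ?thesis using qr r by (simp add: m_def)
  qed
  ultimately have "norm (P q - of_real \<rho>) / norm (P q + of_real \<rho>) \<le> norm (q - of_real r) / norm (q + of_real r)"
    by (metis B_def \<zeta>_def norm_divide)
  then have "norm (P q - of_real \<rho>) * norm (q + of_real r) \<le> norm (q - of_real r) * norm (P q + of_real \<rho>)"
    using nz[OF q] qr by (simp add: divide_simps)
  then have "(norm (P q - of_real \<rho>) * norm (q + of_real r))\<^sup>2 \<le> (norm (q - of_real r) * norm (P q + of_real \<rho>))\<^sup>2"
    by (intro power_mono) auto
  moreover define p1 p2 where "p1 = Re (P q)" and "p2 = Im (P q)"
  have "(norm (P q - of_real \<rho>))\<^sup>2 = (norm (P q))\<^sup>2 + \<rho>\<^sup>2 - 2 * \<rho> * Re (P q)"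
    "(norm (P q + of_real \<rho>))\<^sup>2 = (norm (P q))\<^sup>2 + \<rho>\<^sup>2 + 2 * \<rho> * Re (P q)"
    "(norm (q - of_real r))\<^sup>2 = 2 * r\<^sup>2 - 2 * r * Re q"
    "(norm (q + of_real r))\<^sup>2 = 2 * r\<^sup>2 + 2 * r * Re q"
    unfolding r_def by (simp_all only: cmod_power2) (simp_all add: cmod_power2 algebra_simps power2_diff power2_sum)
  ultimately have "((norm (P q))\<^sup>2 + \<rho>\<^sup>2 - 2 * \<rho> * Re (P q)) * (2 * r\<^sup>2 + 2 * r * Re q) \<le>
      (2 * r\<^sup>2 - 2 * r * Re q) * ((norm (P q))\<^sup>2 + \<rho>\<^sup>2 + 2 * \<rho> * Re (P q))"
    by (simp add: power_mult_distrib)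
  then have "(4 * r) * (((norm (P q))\<^sup>2 + \<rho>\<^sup>2) * Re q) \<le> (4 * r) * (2 * r * \<rho> * Re (P q))"
    by (simp add: power2_eq_square algebra_simps)
  then have 1: "((norm (P q))\<^sup>2 + \<rho>\<^sup>2) * Re q \<le> 2 * r * \<rho> * Re (P q)"
    by (rule mult_left_le_imp_le) (use r in simp)
  have "0 \<le> (norm (P q) - \<rho>)\<^sup>2" by simp
  then have "2 * norm (P q) * \<rho> \<le> (norm (P q))\<^sup>2 + \<rho>\<^sup>2" by (simp add: power2_eq_square algebra_simps)
  then have "2 * norm (P q) * \<rho> * Re q \<le> ((norm (P q))\<^sup>2 + \<rho>\<^sup>2) * Re q" using q by (intro mult_right_mono) auto
  with 1 have "(2 * \<rho>) * (norm (P q) * Re q) \<le> (2 * \<rho>) * (r * Re (P q))" by (simp add: algebra_simps)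
  then show ?thesis using \<rho>(1) by (simp add: r_def)
qed

text \<open>
With \<open>P(q)\<^sup>2 = F(q\<^sup>2)\<close> the previous lemma gives \<open>0 \<le> arg F(q\<^sup>2) \<le> 2 arg q\<close> in the first quadrant, so that
\<open>F(q\<^sup>2) / q\<close> has argument between \<open>- arg q\<close> and \<open>arg q\<close>.  The square root needs \<open>F\<close> to stay
off the slit, which is arranged by adding \<open>e z\<close> and letting \<open>e\<close> tend to \<open>0\<close>.
\<close>
lemma Re_div_sqrt_nonneg:
  fixes F :: "complex \<Rightarrow> complex"
  assumes hol: "F holomorphic_on (- \<real>\<^sub>\<le>\<^sub>0)"
    and cnj: "\<And>z. z \<in> - \<real>\<^sub>\<le>\<^sub>0 \<Longrightarrow> F (cnj z) = cnj (F z)"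
    and upper: "\<And>z. 0 < Im z \<Longrightarrow> 0 \<le> Im (F z)"
    and pos: "\<And>s. 0 < s \<Longrightarrow> 0 \<le> Re (F (of_real s))"
    and q: "0 < Re q"
  shows "0 \<le> Re (F (q\<^sup>2) / q)"
proof -
  note sq = square_in_slit_plane
  have real: "Im (F (of_real s)) = 0" if "0 < s" for s
    using cnj[of "of_real s"] that by (auto simp: complex_nonpos_Reals_iff complex_eq_iff)
  have upper_q: "0 \<le> Re (F (q\<^sup>2) / q)" if q: "0 < Re q" "0 < Im q" for q
  proof -
    have eps: "0 \<le> Re ((F (q\<^sup>2) + of_real e * q\<^sup>2) / q)" if e: "e > 0" for e
    proof -
      define G where "G z = F z + of_real e * z" for z
      have Gup: "0 < Im (G z)" if "0 < Im z" for z
        using upper[OF that] that e by (simp add: G_def add_nonneg_pos)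
      have Gpos: "0 < Re (G (of_real s))" "Im (G (of_real s)) = 0" if "0 < s" for s
        using pos[OF that] real[OF that] that e by (simp_all add: G_def add_nonneg_pos)
      have Gcnj: "G (cnj z) = cnj (G z)" if "z \<in> - \<real>\<^sub>\<le>\<^sub>0" for z
        using cnj[OF that] by (simp add: G_def)
      have Gslit: "G z \<in> - \<real>\<^sub>\<le>\<^sub>0" if z: "z \<in> - \<real>\<^sub>\<le>\<^sub>0" for z
      proof (cases "Im z = 0")
        case True
        then have "z = of_real (Re z)" "0 < Re z" using z by (auto simp: complex_eq_iff complex_nonpos_Reals_iff)
        then show ?thesis using Gpos[of "Re z"] by (auto simp: complex_nonpos_Reals_iff)
      next
        case False
        then consider "0 < Im z" | "0 < Im (cnj z)" by fastforce
        then show ?thesis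
        proof cases
          case 1 then show ?thesis using Gup[of z] by (auto simp: complex_nonpos_Reals_iff)
        next
          case 2 then show ?thesis using Gup[of "cnj z"] Gcnj[OF z] by (auto simp: complex_nonpos_Reals_iff)
        qed
      qed
      define P where "P w = csqrt (G (w\<^sup>2))" for w
      have holG: "G holomorphic_on - \<real>\<^sub>\<le>\<^sub>0" unfolding G_def by (intro holomorphic_intros hol)
      have "(G \<circ> (\<lambda>w. w\<^sup>2)) holomorphic_on {w. 0 < Re w}"
        by (rule holomorphic_on_compose_gen[OF _ holG]) (auto intro!: holomorphic_intros dest: sq)
      then have "P holomorphic_on {w. 0 < Re w}"
        unfolding P_def o_def by (intro holomorphic_on_csqrt') (use Gslit sq in auto)
      moreover have Ppos: "0 < Re (P w)" if "0 < Re w" for w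
      proof (rule ccontr)
        assume "\<not> 0 < Re (P w)"
        then have "Re (P w) = 0" using csqrt_principal[of "G (w\<^sup>2)"] by (auto simp: P_def)
        moreover have "(P w)\<^sup>2 = G (w\<^sup>2)" by (simp add: P_def)
        ultimately have "Re (G (w\<^sup>2)) = - (Im (P w))\<^sup>2" "Im (G (w\<^sup>2)) = 0"
          by (metis add.left_neutral diff_0 mult_zero_left power2_eq_square times_complex.sel(1))
             (metis \<open>(P w)\<^sup>2 = G (w\<^sup>2)\<close> \<open>Re (P w) = 0\<close> add.right_neutral mult_zero_left mult_zero_right power2_eq_square times_complex.sel(2))
        then show False using Gslit[OF sq[OF that]] by (auto simp: complex_nonpos_Reals_iff)
      qed
      moreover have "Im (P (of_real r)) = 0" if "0 < r" for r
        unfolding P_def using Gpos[of "r\<^sup>2"] that by (auto simp: csqrt_of_real_nonneg complex_eq_iff simp flip: of_real_power)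
      ultimately have sp: "norm (P q) * Re q \<le> norm q * Re (P q)"
        using schwarz_pick_sector q by blast
      define p1 p2 q1 q2 where "p1 = Re (P q)" "p2 = Im (P q)" "q1 = Re q" "q2 = Im q"
      note defs = this
      have p1: "p1 > 0" using Ppos[OF q(1)] by (simp add: defs)
      have qq: "q1 > 0" "q2 > 0" using q by (auto simp: defs)
      have P2: "(P q)\<^sup>2 = G (q\<^sup>2)" by (simp add: P_def)
      have "0 < Im (q\<^sup>2)" using q by (simp add: power2_eq_square)
      then have "0 < Im ((P q)\<^sup>2)" using Gup P2 by simp
      then have "0 < p1 * p2" by (simp add: defs power2_eq_square mult.commute)
      then have p2: "p2 > 0" using p1 by (simp add: zero_less_mult_iff)
      have "(norm (P q) * Re q)\<^sup>2 \<le> (norm q * Re (P q))\<^sup>2" using sp q by (intro power_mono) auto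
      then have "(p1\<^sup>2 + p2\<^sup>2) * q1\<^sup>2 \<le> (q1\<^sup>2 + q2\<^sup>2) * p1\<^sup>2" by (simp add: power_mult_distrib cmod_power2 defs)
      then have "(p2 * q1)\<^sup>2 \<le> (p1 * q2)\<^sup>2" by (simp add: algebra_simps power_mult_distrib)
      then have le: "p2 * q1 \<le> p1 * q2" using p1 qq by (intro power2_le_imp_le[of "p2 * q1"]) auto
      have "p2 * q1 \<le> 2 * p1 * q2" using le mult_pos_pos[OF p1 qq(2)] by linarith
      then have "0 \<le> p1\<^sup>2 * q1 + p2 * (2 * p1 * q2 - p2 * q1)"
        using p1 p2 qq by (intro add_nonneg_nonneg mult_nonneg_nonneg) auto
      also have "\<dots> = Re ((P q)\<^sup>2) * q1 + Im ((P q)\<^sup>2) * q2"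
        by (simp add: defs power2_eq_square algebra_simps)
      finally have "0 \<le> Re ((P q)\<^sup>2 / q)" by (simp add: Re_divide defs)
      then show ?thesis by (simp add: P2 G_def)
    qed
    have "((\<lambda>e. Re ((F (q\<^sup>2) + of_real e * q\<^sup>2) / q)) \<longlongrightarrow> Re ((F (q\<^sup>2) + of_real 0 * q\<^sup>2) / q)) (at_right 0)"
      using q by (intro tendsto_intros) auto
    then have "0 \<le> Re ((F (q\<^sup>2) + of_real 0 * q\<^sup>2) / q)"
      by (rule tendsto_lowerbound) (auto simp: eventually_at_filter intro!: always_eventually eps)
    then show ?thesis by simp
  qed
  consider "0 < Im q" | "Im q < 0" | "Im q = 0" by linarith
  then show ?thesis
  proof cases
    case 1 then show ?thesis using upper_q q by simp
  next
    case 2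
    have "0 \<le> Re (F ((cnj q)\<^sup>2) / cnj q)" using upper_q[of "cnj q"] q 2 by simp
    also have "F ((cnj q)\<^sup>2) / cnj q = cnj (F (q\<^sup>2) / q)" using cnj[OF sq[OF q]] by simp
    finally show ?thesis by (simp only: cnj.sel)
  next
    case 3
    then have "q = of_real (Re q)" by (simp add: complex_eq_iff)
    then obtain r where r: "q = of_real r" "r > 0" using q by metis
    have "F (q\<^sup>2) = of_real (Re (F (of_real (r\<^sup>2))))"
      unfolding r(1) using real[of "r\<^sup>2"] r(2) by (intro complex_eqI) simp_all
    then have "F (q\<^sup>2) / q = of_real (Re (F (of_real (r\<^sup>2))) / r)" using r by simp
    then show ?thesis using pos[of "r\<^sup>2"] r by simp
  qed
qed

section \<open>Herglotz representation\<close>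

lemma poisson_denominator_pos:
  fixes x c :: real
  assumes "\<bar>x\<bar> < 1" "\<bar>c\<bar> \<le> 1"
  shows "0 < 1 - 2 * x * c + x\<^sup>2"
proof -
  have "\<bar>x * c\<bar> \<le> \<bar>x\<bar> * 1" unfolding abs_mult using assms by (intro mult_left_mono) auto
  then have "x * c \<le> \<bar>x\<bar>" by simp
  moreover have "0 < (1 - \<bar>x\<bar>)\<^sup>2" using assms by simp
  ultimately show ?thesis by (simp add: power2_eq_square algebra_simps)
qed

text \<open>
Cauchy's formula at \<open>x\<close>, plus Cauchy's formula for the value \<open>0\<close> at the origin of
\<open>w G(w) x / (1 - x w)\<close>.  On the unit circle the two kernels add up to the Poisson kernel, which is
real and depends on the angle only through its cosine.
\<close>
lemma poisson_integral_real_point: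
  fixes G :: "complex \<Rightarrow> complex" and x :: real
  assumes hol: "G holomorphic_on cball 0 1" and x: "\<bar>x\<bar> < 1"
  defines "e \<equiv> \<lambda>t::real. cis (2 * pi * t)"
  shows "(\<lambda>t. Re (G (e t)) * ((1 - x\<^sup>2) / (1 - 2 * x * cos (2 * pi * t) + x\<^sup>2))) integrable_on {0..1}" (is ?i)
    and "integral {0..1} (\<lambda>t. Re (G (e t)) * ((1 - x\<^sup>2) / (1 - 2 * x * cos (2 * pi * t) + x\<^sup>2))) = Re (G (of_real x))" (is ?e)
proof -
  have ee: "exp (2 * of_real pi * \<i> * of_real t) = e t" for t
    by (simp add: e_def cis_conv_exp mult_ac)
  have nx: "1 - of_real x * u \<noteq> 0" if "norm u \<le> 1" for u :: complex
  proof
    assume "1 - of_real x * u = 0"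
    then have "norm (of_real x * u) = 1" by (metis eq_iff_diff_eq_0 norm_one)
    moreover have "norm (of_real x * u) \<le> \<bar>x\<bar> * 1" unfolding norm_mult using that by (intro mult_mono) auto
    ultimately show False using x by simp
  qed
  have param: "((\<lambda>t. f (e t) * e t) has_integral I) {0..1}"
    if "(f has_contour_integral (2 * of_real pi * \<i> * I)) (circlepath 0 1)" for f I
  proof -
    have "((\<lambda>t. f (e t) * (2 * pi * \<i> * e t)) has_integral (2 * of_real pi * \<i> * I)) {0..1}"
    proof (rule has_integral_eq[rotated])
      show "((\<lambda>x. f (circlepath 0 1 x) * vector_derivative (circlepath 0 1) (at x within {0..1}))
          has_integral 2 * of_real pi * \<i> * I) {0..1}"
        using that unfolding has_contour_integral_def .
      fix t :: real assume t: "t \<in> {0..1}"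
      have "vector_derivative (circlepath 0 1) (at t within {0..1}) = 2 * pi * \<i> * e t"
        using t by (simp add: vector_derivative_circlepath01 ee)
      moreover have "circlepath 0 1 t = e t" by (simp add: circlepath ee)
      ultimately show "f (circlepath 0 1 t) * vector_derivative (circlepath 0 1) (at t within {0..1}) = f (e t) * (2 * pi * \<i> * e t)"
        by simp
    qed
    then have "((\<lambda>t. (1 / (2 * of_real pi * \<i>)) * (f (e t) * (2 * pi * \<i> * e t))) has_integral
        ((1 / (2 * of_real pi * \<i>)) * (2 * of_real pi * \<i> * I))) {0..1}"
      by (rule has_integral_mult_right)
    moreover have "(1 / (2 * of_real pi * \<i>)) * (w * (2 * pi * \<i> * w')) = w * w'" for w w' :: complex
      by (simp add: field_simps)
    moreover have "(1 / (2 * of_real pi * \<i>)) * (2 * of_real pi * \<i> * I) = I" by (simp add: field_simps)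
    ultimately show ?thesis by (simp only:)
  qed
  have 1: "((\<lambda>t. G (e t) / (e t - of_real x) * e t) has_integral G (of_real x)) {0..1}"
    by (rule param, rule Cauchy_integral_circlepath_simple[OF hol]) (use x in auto)
  have "((\<lambda>u. (G u * (of_real x * u / (1 - of_real x * u))) / (u - 0)) has_contour_integral
       (2 * of_real pi * \<i> * (G 0 * (of_real x * 0 / (1 - of_real x * 0))))) (circlepath 0 1)"
    by (rule Cauchy_integral_circlepath_simple, intro holomorphic_intros hol) (use nx in auto)
  then have 2: "((\<lambda>t. (G (e t) * (of_real x * e t / (1 - of_real x * e t))) / (e t - 0) * e t) has_integral 0) {0..1}"
    by (intro param) simp
  have kern: "G (e t) / (e t - of_real x) * e t + (G (e t) * (of_real x * e t / (1 - of_real x * e t))) / (e t - 0) * e t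
     = G (e t) * of_real ((1 - x\<^sup>2) / (1 - 2 * x * cos (2 * pi * t) + x\<^sup>2))" for t
  proof -
    have n1: "norm (e t) = 1" by (simp add: e_def)
    have et: "e t \<noteq> 0" using n1 by auto
    have inv: "e t * cnj (e t) = 1" by (simp add: complex_norm_square[symmetric] n1)
    have c0: "1 - of_real x * cnj (e t) \<noteq> 0" using nx[of "cnj (e t)"] n1 by simp
    have a0: "1 - of_real x * e t \<noteq> 0" using nx[of "e t"] n1 by simp
    have "e t - of_real x = e t * (1 - of_real x * cnj (e t))" using inv by (simp add: algebra_simps)
    then have cauchy: "e t / (e t - of_real x) = 1 / (1 - of_real x * cnj (e t))" using et by simp
    have "e t / (e t - of_real x) + of_real x * e t / (1 - of_real x * e t) =
        ((1 - of_real x * e t) + of_real x * e t * (1 - of_real x * cnj (e t))) / ((1 - of_real x * cnj (e t)) * (1 - of_real x * e t))"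
      unfolding cauchy using a0 c0 by (subst add_frac_eq) simp_all
    also have "(1 - of_real x * e t) + of_real x * e t * (1 - of_real x * cnj (e t)) = of_real (1 - x\<^sup>2)"
      using inv by (simp add: algebra_simps power2_eq_square)
    also have "(1 - of_real x * cnj (e t)) * (1 - of_real x * e t) = of_real (1 - 2 * x * cos (2 * pi * t) + x\<^sup>2)"
    proof -
      have "(1 - of_real x * cnj (e t)) * (1 - of_real x * e t) = 1 - of_real x * (e t + cnj (e t)) + of_real (x\<^sup>2) * (e t * cnj (e t))"
        by (simp add: algebra_simps power2_eq_square)
      also have "e t + cnj (e t) = of_real (2 * cos (2 * pi * t))" by (simp add: e_def complex_eq_iff)
      finally show ?thesis using inv by simp
    qed
    finally have "e t / (e t - of_real x) + of_real x * e t / (1 - of_real x * e t) =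
        of_real ((1 - x\<^sup>2) / (1 - 2 * x * cos (2 * pi * t) + x\<^sup>2))" by simp
    then have "G (e t) * (e t / (e t - of_real x) + of_real x * e t / (1 - of_real x * e t)) =
        G (e t) * of_real ((1 - x\<^sup>2) / (1 - 2 * x * cos (2 * pi * t) + x\<^sup>2))" by simp
    moreover have "g / A * u + (g * N) / (u - 0) * u = g * (u / A + N)" if "u \<noteq> 0" for g A u N :: complex
      using that by (simp add: algebra_simps)
    ultimately show ?thesis using et by metis
  qed
  have "((\<lambda>t. G (e t) * of_real ((1 - x\<^sup>2) / (1 - 2 * x * cos (2 * pi * t) + x\<^sup>2))) has_integral G (of_real x)) {0..1}"
    using has_integral_add[OF 1 2] unfolding kern by simp
  from has_integral_linear[OF this bounded_linear_Re]
  have "((\<lambda>t. Re (G (e t)) * ((1 - x\<^sup>2) / (1 - 2 * x * cos (2 * pi * t) + x\<^sup>2))) has_integral Re (G (of_real x))) {0..1}"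
    unfolding o_def times_complex.sel Re_complex_of_real Im_complex_of_real by simp
  then show ?i ?e by (auto simp: has_integral_iff)
qed

text \<open>
On a circle of radius \<open>\<rho> < 1\<close> the values of \<open>Re g\<close>, divided by \<open>Re (g 0)\<close>, are a probability density for the angle.
Since only real points are represented, it suffices to keep the law of the cosine of the angle, a probability measure on
\<open>[- 1, 1]\<close>.  Helly selection provides a limit as \<open>\<rho>\<close> tends to \<open>1\<close>.
\<close>
theorem herglotz_real_point:
  fixes g :: "complex \<Rightarrow> complex"
  assumes hol: "g holomorphic_on ball 0 1"
    and nonneg: "\<And>\<zeta>. norm \<zeta> < 1 \<Longrightarrow> 0 \<le> Re (g \<zeta>)" and pos: "0 < Re (g 0)"
  obtains M :: "real measure" where "prob_space M" "sets M = sets borel" "AE c in M. \<bar>c\<bar> \<le> 1"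
    "\<And>x. \<bar>x\<bar> < 1 \<Longrightarrow> Re (g (of_real x)) = Re (g 0) * (LINT c|M. (1 - x\<^sup>2) / (1 - 2 * x * c + x\<^sup>2))"
proof -
  \<comment> \<open>Weak convergence is tested with functions on the whole line, so the kernel is continued constantly outside \<open>[- 1, 1]\<close>.\<close>
  define clamp :: "real \<Rightarrow> real" where "clamp c = max (- 1) (min 1 c)" for c
  have clamp: "\<bar>clamp c\<bar> \<le> 1" "\<bar>c\<bar> \<le> 1 \<Longrightarrow> clamp c = c" for c by (auto simp: clamp_def)
  have cont_clamp: "continuous_on UNIV clamp" unfolding clamp_def by (intro continuous_intros)
  have [measurable]: "clamp \<in> borel_measurable borel" using cont_clamp by (rule borel_measurable_continuous_onI)
  define K where "K x c = (1 - x\<^sup>2) / (1 - 2 * x * clamp c + x\<^sup>2)" for x c :: real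
  have cont_K: "continuous_on UNIV (K x)" if "\<bar>x\<bar> < 1" for x
    unfolding K_def using poisson_denominator_pos[OF that clamp(1)] cont_clamp
    by (intro continuous_intros) (auto simp: less_imp_neq[symmetric])
  have Kc: "K x (cos t) = (1 - x\<^sup>2) / (1 - 2 * x * cos t + x\<^sup>2)" for x t :: real by (simp add: K_def clamp)
  define \<rho> where "\<rho> n = 1 - 1 / (real n + 2)" for n
  have \<rho>: "0 < \<rho> n" "\<rho> n < 1" for n by (auto simp: \<rho>_def)
  have \<rho>lim: "\<rho> \<longlonglongrightarrow> 1" unfolding \<rho>_def by real_asymp
  define G where "G n \<zeta> = g (of_real (\<rho> n) * \<zeta>)" for n \<zeta>
  have in_ball: "norm (of_real (\<rho> n) * \<zeta>) < 1" if "norm \<zeta> \<le> 1" for n and \<zeta> :: complex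
  proof -
    have "\<rho> n * norm \<zeta> \<le> \<rho> n" using that \<rho>[of n] by (intro mult_left_le) auto
    from le_less_trans[OF this \<rho>(2)] show ?thesis using \<rho>(1)[of n] by (simp add: norm_mult)
  qed
  have holG: "G n holomorphic_on cball 0 1" for n
  proof -
    have "(g \<circ> (\<lambda>\<zeta>. of_real (\<rho> n) * \<zeta>)) holomorphic_on cball 0 1"
      by (rule holomorphic_on_compose_gen[OF _ hol]) (use in_ball in \<open>auto intro!: holomorphic_intros\<close>)
    then show ?thesis by (simp add: G_def[abs_def] o_def)
  qed
  define d where "d n t = indicator {0..1} t * Re (G n (cis (2 * pi * t))) / Re (g 0)" for n and t :: real
  have d_nonneg: "0 \<le> d n t" for n t
    unfolding d_def G_def using nonneg[OF in_ball] pos by (auto intro!: divide_nonneg_pos mult_nonneg_nonneg)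
  have contG: "continuous_on {0..1} (\<lambda>t. Re (G n (cis (2 * pi * t))))" for n
    by (intro continuous_on_Re continuous_on_compose2[OF holomorphic_on_imp_continuous_on[OF holG[of n]]])
       (auto intro!: continuous_intros)
  have [measurable]: "d n \<in> borel_measurable borel" for n
  proof -
    have "(\<lambda>t. indicator {0..1} t *\<^sub>R Re (G n (cis (2 * pi * t)))) \<in> borel_measurable borel"
      by (intro borel_measurable_continuous_on_indicator contG) auto
    then show ?thesis unfolding d_def by simp
  qed
  have int_d: "has_bochner_integral lborel (\<lambda>t. d n t * K x (cos (2 * pi * t))) (Re (G n (of_real x)) / Re (g 0))"
    if x: "\<bar>x\<bar> < 1" for n x
  proof -
    let ?h = "\<lambda>t. Re (G n (cis (2 * pi * t))) * ((1 - x\<^sup>2) / (1 - 2 * x * cos (2 * pi * t) + x\<^sup>2))"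
    have "continuous_on {0..1} ?h"
      using poisson_denominator_pos[OF x abs_cos_le_one]
      by (intro continuous_on_mult[OF contG] continuous_intros) (auto simp: less_imp_neq[symmetric])
    then have si: "set_integrable lborel {0..1} ?h" by (rule borel_integrable_atLeastAtMost')
    have "(LINT t:{0..1}|lborel. ?h t) = Re (G n (of_real x))"
      using set_borel_integral_eq_integral(2)[OF si] poisson_integral_real_point(2)[OF holG x] by simp
    then have "has_bochner_integral lborel (\<lambda>t. indicator {0..1} t *\<^sub>R ?h t) (Re (G n (of_real x)))"
      using si unfolding set_integrable_def set_lebesgue_integral_def by (simp add: has_bochner_integral_iff)
    then have "has_bochner_integral lborel (\<lambda>t. indicator {0..1} t *\<^sub>R ?h t / Re (g 0)) (Re (G n (of_real x)) / Re (g 0))"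
      by (rule has_bochner_integral_divide_zero)
    then show ?thesis unfolding d_def Kc by (simp add: mult_ac)
  qed
  define \<mu> where "\<mu> n = distr (density lborel (\<lambda>t. ennreal (d n t))) borel (\<lambda>t. cos (2 * pi * t))" for n
  have \<mu>_sets[measurable_cong, simp]: "sets (\<mu> n) = sets borel" "space (\<mu> n) = UNIV" for n by (auto simp: \<mu>_def)
  have int_\<mu>: "(LINT c|\<mu> n. K x c) = Re (G n (of_real x)) / Re (g 0)" if x: "\<bar>x\<bar> < 1" for n x
  proof -
    have [measurable]: "K x \<in> borel_measurable borel" using cont_K[OF x] by (rule borel_measurable_continuous_onI)
    have "(LINT c|\<mu> n. K x c) = (LINT t|lborel. d n t *\<^sub>R K x (cos (2 * pi * t)))"
      unfolding \<mu>_def by (subst integral_distr, simp, simp, subst integral_density) (auto simp: d_nonneg)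
    then show ?thesis using has_bochner_integral_integral_eq[OF int_d[OF x]] by simp
  qed
  have prob_\<mu>: "prob_space (\<mu> n)" for n
  proof
    have 1: "has_bochner_integral lborel (d n) 1"
      using int_d[of 0 n] pos by (simp add: K_def G_def)
    have "emeasure (\<mu> n) (space (\<mu> n)) = (\<integral>\<^sup>+t. ennreal (d n t) \<partial>lborel)"
      unfolding \<mu>_def by (simp add: emeasure_distr emeasure_density)
    also have "\<dots> = ennreal 1"
      using 1 d_nonneg by (subst nn_integral_eq_integral) (auto simp: has_bochner_integral_iff)
    finally show "emeasure (\<mu> n) (space (\<mu> n)) = 1" by simp
  qed
  have rd: "real_distribution (\<mu> n)" for n
    using prob_\<mu>[of n] by (simp add: real_distribution_def real_distribution_axioms_def)
  have "measure (\<mu> n) {-2<..1} = 1" for n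
  proof -
    interpret prob_space "\<mu> n" by (rule prob_\<mu>)
    have "AE c in \<mu> n. c \<in> {-2<..1}"
      unfolding \<mu>_def by (subst AE_distr_iff) (auto intro!: AE_I2 intro: less_le_trans[OF _ cos_ge_minus_one])
    then show ?thesis by (subst prob_eq_1) auto
  qed
  then have "tight \<mu>"
    unfolding tight_def using rd by (intro conjI allI impI exI[of _ "-2"] exI[of _ "1::real"]) simp_all
  from tight_imp_convergent_subsubsequence[OF this strict_mono_id]
  obtain r M where r: "strict_mono r" and M: "real_distribution M" "weak_conv_m (\<mu> \<circ> r) M"
    by (auto simp: o_def id_def)
  interpret M: real_distribution M by (rule M(1))
  have main: "Re (g (of_real x)) / Re (g 0) = (LINT c|M. K x c)" if x: "\<bar>x\<bar> < 1" for x
  proof -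
    have "\<bar>K x c\<bar> \<le> (1 - x\<^sup>2) / (1 - \<bar>x\<bar>)\<^sup>2" for c
    proof -
      have "(1 - \<bar>x\<bar>)\<^sup>2 \<le> 1 - 2 * x * clamp c + x\<^sup>2"
      proof -
        have "\<bar>x * clamp c\<bar> \<le> \<bar>x\<bar> * 1" unfolding abs_mult using clamp by (intro mult_left_mono) auto
        then have "x * clamp c \<le> \<bar>x\<bar>" by simp
        then show ?thesis by (simp add: power2_eq_square algebra_simps)
      qed
      moreover have "0 < (1 - \<bar>x\<bar>)\<^sup>2" "0 \<le> 1 - x\<^sup>2" using x by (auto simp: abs_square_le_1)
      moreover have "0 \<le> K x c"
        using poisson_denominator_pos[OF x clamp(1), of c] \<open>0 \<le> 1 - x\<^sup>2\<close> by (simp add: K_def)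
      ultimately show ?thesis
        using poisson_denominator_pos[OF x clamp(1), of c]
        by (simp add: K_def divide_left_mono)
    qed
    then have "(\<lambda>n. LINT c|(\<mu> \<circ> r) n. K x c) \<longlonglongrightarrow> (LINT c|M. K x c)"
      using M cont_K[OF x] rd
      by (intro weak_conv_imp_integral_bdd_continuous_conv[where B = "(1 - x\<^sup>2) / (1 - \<bar>x\<bar>)\<^sup>2"])
         (auto simp: continuous_on_eq_continuous_at o_def)
    moreover have "(\<lambda>n. LINT c|(\<mu> \<circ> r) n. K x c) = (\<lambda>n. Re (G (r n) (of_real x)) / Re (g 0))"
      by (simp add: int_\<mu>[OF x])
    moreover have "(\<lambda>n. Re (G (r n) (of_real x)) / Re (g 0)) \<longlonglongrightarrow> Re (g (of_real x)) / Re (g 0)"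
    proof -
      have "isCont g (of_real x)"
        using holomorphic_on_imp_continuous_on[OF hol] x by (simp add: continuous_on_eq_continuous_at)
      moreover have "(\<lambda>n. of_real (\<rho> (r n)) * of_real x) \<longlonglongrightarrow> (of_real 1 * of_real x :: complex)"
        using LIMSEQ_subseq_LIMSEQ[OF \<rho>lim r] by (intro tendsto_intros) (simp add: o_def)
      ultimately have "(\<lambda>n. G (r n) (of_real x)) \<longlonglongrightarrow> g (of_real x)"
        unfolding G_def by (intro isCont_tendsto_compose[of "of_real x" g]) auto
      then show ?thesis using pos by (intro tendsto_intros) auto
    qed
    ultimately show ?thesis using LIMSEQ_unique by metis
  qed
  show ?thesis
  proof
    show "prob_space (distr M borel clamp)" by (rule M.prob_space_distr) simp
    show "AE c in distr M borel clamp. \<bar>c\<bar> \<le> 1" by (subst AE_distr_iff) (auto simp: clamp)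
    fix x :: real assume x: "\<bar>x\<bar> < 1"
    have "(LINT c|distr M borel clamp. (1 - x\<^sup>2) / (1 - 2 * x * c + x\<^sup>2)) = (LINT c|M. K x c)"
      unfolding K_def by (subst integral_distr) simp_all
    then show "Re (g (of_real x)) = Re (g 0) * (LINT c|distr M borel clamp. (1 - x\<^sup>2) / (1 - 2 * x * c + x\<^sup>2))"
      using main[OF x] pos by (simp add: field_simps)
  qed simp
qed

text \<open>
The Herglotz representation of \<open>F(q\<^sup>2) / q\<close> in the disc coordinate \<open>x = (q - 1) / (q + 1)\<close>.  The point \<open>c = 1\<close>
gives the linear term of \<open>F\<close>, the point \<open>c = - 1\<close> the constant term, and the other points give multiples of
\<open>s / (s + t)\<close> with \<open>t = (1 + c) / (1 - c)\<close>.
\<close>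
theorem complete_bernstein_representation:
  fixes F :: "complex \<Rightarrow> complex"
  assumes hol: "F holomorphic_on (- \<real>\<^sub>\<le>\<^sub>0)"
    and cnj: "\<And>z. z \<in> - \<real>\<^sub>\<le>\<^sub>0 \<Longrightarrow> F (cnj z) = cnj (F z)"
    and upper: "\<And>z. 0 < Im z \<Longrightarrow> 0 \<le> Im (F z)"
    and nonneg: "\<And>s. 0 < s \<Longrightarrow> 0 \<le> Re (F (of_real s))"
    and pos: "0 < Re (F 1)"
  obtains \<nu> :: "real measure" where "finite_measure \<nu>" "sets \<nu> = sets borel" "AE c in \<nu>. \<bar>c\<bar> \<le> 1"
    "\<And>s. 0 < s \<Longrightarrow> ennreal (Re (F (of_real s)) / s) = (\<integral>\<^sup>+c. ennreal (2 / ((1 - c) * s + (1 + c))) \<partial>\<nu>)"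
proof -
  define m where "m \<zeta> = (1 + \<zeta>) / (1 - \<zeta>)" for \<zeta> :: complex
  define g where "g \<zeta> = F ((m \<zeta>)\<^sup>2) / m \<zeta>" for \<zeta>
  have Re_pos: "0 < Re (m \<zeta>)" if "norm \<zeta> < 1" for \<zeta>
    unfolding m_def by (rule Re_cayley_pos[OF that])
  have "(F \<circ> (\<lambda>\<zeta>. (m \<zeta>)\<^sup>2)) holomorphic_on ball 0 1"
  proof (rule holomorphic_on_compose_gen[OF _ hol])
    show "(\<lambda>\<zeta>. (m \<zeta>)\<^sup>2) holomorphic_on ball 0 1" unfolding m_def by (intro holomorphic_intros) auto
  qed (use square_in_slit_plane Re_pos in auto)
  moreover have "m holomorphic_on ball 0 1" unfolding m_def by (intro holomorphic_intros) auto
  moreover have "m \<zeta> \<noteq> 0" if "norm \<zeta> < 1" for \<zeta> using Re_pos[OF that] by auto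
  ultimately have holg: "g holomorphic_on ball 0 1"
    unfolding g_def o_def by (intro holomorphic_intros) auto
  have g_nonneg: "0 \<le> Re (g \<zeta>)" if "norm \<zeta> < 1" for \<zeta>
    unfolding g_def using Re_div_sqrt_nonneg[OF hol cnj upper nonneg Re_pos[OF that]] .
  have g0: "g 0 = F 1" by (simp add: g_def m_def)
  obtain M :: "real measure" where M: "prob_space M" "sets M = sets borel" "AE c in M. \<bar>c\<bar> \<le> 1"
    and rep: "\<And>x. \<bar>x\<bar> < 1 \<Longrightarrow> Re (g (of_real x)) = Re (g 0) * (LINT c|M. (1 - x\<^sup>2) / (1 - 2 * x * c + x\<^sup>2))"
    using herglotz_real_point[OF holg g_nonneg] pos g0 by metis
  interpret M: prob_space M by (rule M(1))
  note [measurable_cong] = M(2)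
  define \<nu> where "\<nu> = density M (\<lambda>_. ennreal (Re (F 1)))"
  have "emeasure \<nu> (space \<nu>) < \<infinity>" unfolding \<nu>_def by (simp add: emeasure_density M.emeasure_space_1)
  then have fin: "finite_measure \<nu>" by (intro finite_measureI) auto
  show ?thesis
  proof (rule that[OF fin])
    show "sets \<nu> = sets borel" by (simp add: \<nu>_def M)
    show "AE c in \<nu>. \<bar>c\<bar> \<le> 1" unfolding \<nu>_def using M(3) by (subst AE_density) auto
    fix s :: real assume s: "0 < s"
    define q where "q = sqrt s"
    have q: "q > 0" "q\<^sup>2 = s" using s by (auto simp: q_def)
    define x where "x = (q - 1) / (q + 1)"
    have x: "\<bar>x\<bar> < 1" using q by (auto simp: x_def field_simps abs_less_iff)
    have mx: "m (of_real x) = of_real q"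
    proof -
      have "1 + x = 2 * q / (q + 1)" "1 - x = 2 / (q + 1)" using q by (auto simp: x_def field_simps)
      then have "(1 + x) / (1 - x) = q" using q by simp
      then show ?thesis unfolding m_def by (metis of_real_1 of_real_add of_real_diff of_real_divide)
    qed
    have kern: "(1 - x\<^sup>2) / (1 - 2 * x * c + x\<^sup>2) = q * (2 / ((1 - c) * s + (1 + c)))" for c
    proof -
      have xq: "x * (q + 1) = q - 1" using q(1) by (simp add: x_def)
      have "(1 - x\<^sup>2) * (q + 1)\<^sup>2 = (q + 1)\<^sup>2 - (x * (q + 1))\<^sup>2"
        by (simp add: power2_eq_square algebra_simps)
      also have "\<dots> = 4 * q" unfolding xq by (simp add: power2_eq_square algebra_simps)
      finally have "(1 - x\<^sup>2) * (q + 1)\<^sup>2 = 4 * q" .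
      moreover have "(1 - 2 * x * c + x\<^sup>2) * (q + 1)\<^sup>2 = 2 * ((1 - c) * s + (1 + c))"
      proof -
        have "(1 - 2 * x * c + x\<^sup>2) * (q + 1)\<^sup>2 = (q + 1)\<^sup>2 - 2 * c * (x * (q + 1)) * (q + 1) + (x * (q + 1))\<^sup>2"
          by (simp add: power2_eq_square algebra_simps)
        then show ?thesis unfolding xq q(2)[symmetric] by (simp add: power2_eq_square algebra_simps)
      qed
      ultimately have "(1 - x\<^sup>2) / (1 - 2 * x * c + x\<^sup>2) = 4 * q / (2 * ((1 - c) * s + (1 + c)))"
        using q(1) by (metis mult_divide_mult_cancel_right power_not_zero add_pos_pos less_irrefl zero_less_one)
      moreover have "4 * q / (2 * y) = q * (2 / y)" for y by simp
      ultimately show ?thesis by (simp only:)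
    qed
    have kpos: "0 < (1 - c) * s + (1 + c)" if "\<bar>c\<bar> \<le> 1" for c
    proof (cases "c = 1")
      case False
      then have "0 < (1 - c) * s" using that s by simp
      then show ?thesis using that by linarith
    qed simp
    have "Re (F (of_real s)) / q = Re (g (of_real x))"
      unfolding g_def mx using q by (simp flip: of_real_power)
    also have "\<dots> = Re (F 1) * (LINT c|M. q * (2 / ((1 - c) * s + (1 + c))))"
      unfolding rep[OF x] kern g0 ..
    finally have "Re (F (of_real s)) / q = Re (F 1) * (q * (LINT c|M. 2 / ((1 - c) * s + (1 + c))))"
      by (simp del: times_divide_eq_right)
    moreover have "R / q\<^sup>2 = Q * E" if "R / q = Q * (q * E)" for R Q E
      using that q(1) by (simp add: field_simps power2_eq_square)
    ultimately have eq: "Re (F (of_real s)) / s = Re (F 1) * (LINT c|M. 2 / ((1 - c) * s + (1 + c)))"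
      unfolding q(2) by metis
    have bound: "2 / ((1 - c) * s + (1 + c)) \<le> 2 / min (2 * s) 2" if "\<bar>c\<bar> \<le> 1" for c
    proof -
      have "(1 - c) * min s 1 \<le> (1 - c) * s" "(1 + c) * min s 1 \<le> (1 + c) * 1"
        using that by (intro mult_left_mono; auto)+
      then have "min (2 * s) 2 \<le> (1 - c) * s + (1 + c)" by (simp add: algebra_simps min_def split: if_splits)
      then show ?thesis using s by (intro divide_left_mono) (auto simp: kpos[OF that] intro!: mult_pos_pos)
    qed
    have int: "integrable M (\<lambda>c. 2 / ((1 - c) * s + (1 + c)))"
    proof (rule M.integrable_const_bound[where B = "2 / min (2 * s) 2"])
      show "AE c in M. norm (2 / ((1 - c) * s + (1 + c))) \<le> 2 / min (2 * s) 2"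
        using M(3) by eventually_elim (use bound kpos in \<open>force simp: less_imp_le\<close>)
    qed measurable
    have "(\<integral>\<^sup>+c. ennreal (2 / ((1 - c) * s + (1 + c))) \<partial>M) = ennreal (LINT c|M. 2 / ((1 - c) * s + (1 + c)))"
      by (rule nn_integral_eq_integral[OF int]) (use M(3) in eventually_elim, use kpos in \<open>force simp: less_imp_le\<close>)
    then have "(\<integral>\<^sup>+c. ennreal (2 / ((1 - c) * s + (1 + c))) \<partial>\<nu>) = ennreal (Re (F 1)) * ennreal (LINT c|M. 2 / ((1 - c) * s + (1 + c)))"
      unfolding \<nu>_def by (subst nn_integral_density) (auto simp: nn_integral_cmult)
    also have "\<dots> = ennreal (Re (F (of_real s)) / s)"
      unfolding eq using pos by (simp add: ennreal_mult')
    finally show "ennreal (Re (F (of_real s)) / s) = (\<integral>\<^sup>+c. ennreal (2 / ((1 - c) * s + (1 + c))) \<partial>\<nu>)" ..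
  qed
qed

section \<open>Thorin measures\<close>

text \<open>
The conditions on drift and Thorin measure in the definition of a generalized gamma convolution.
\<close>
definition thorin_pair :: "real \<Rightarrow> real measure \<Rightarrow> bool" where
  "thorin_pair a U \<longleftrightarrow>
    0 \<le> a \<and> sets U = sets borel \<and> emeasure U {..0} = 0 \<and>
    (\<forall>K. compact K \<and> K \<subseteq> {0<..} \<longrightarrow> emeasure U K < \<infinity>) \<and>
    (\<integral>\<^sup>+ t\<in>{0<..<1}. ennreal \<bar>ln t\<bar> \<partial>U) < \<infinity> \<and>
    (\<integral>\<^sup>+ t\<in>{1<..}. ennreal (1 / t) \<partial>U) < \<infinity>"

lemma nn_integral_FTC_Ioo:
  fixes f F :: "real \<Rightarrow> real"
  assumes s: "0 < s"
    and F: "\<And>x. 0 < x \<Longrightarrow> (F has_real_derivative f x) (at x)"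
    and f: "\<And>x. 0 < x \<Longrightarrow> isCont f x" and nonneg: "\<And>x. 0 < x \<Longrightarrow> 0 \<le> f x"
    and lim: "(F \<longlongrightarrow> A) (at_right 0)"
  shows "(\<integral>\<^sup>+x\<in>{0<..<s}. ennreal (f x) \<partial>lborel) = ennreal (F s - A)"
proof -
  have Fs: "(F \<longlongrightarrow> F s) (at_left s)"
    using DERIV_isCont[OF F[OF s]] by (simp add: isCont_def filterlim_at_split)
  have *: "set_integrable lborel (einterval (ereal 0) (ereal s)) f"
    "(LBINT x=ereal 0..ereal s. f x) = F s - A"
    by (rule interval_integral_FTC_nonneg[where F = F];
        use s F f nonneg lim Fs in \<open>auto simp: ereal_tendsto_simps\<close>)+
  have "einterval (ereal 0) (ereal s) = {0<..<s}" by (auto simp: einterval_def)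
  with * s have **: "integrable lborel (\<lambda>x. indicator {0<..<s} x * f x)" "(LINT x|lborel. indicator {0<..<s} x * f x) = F s - A"
    by (simp_all add: set_integrable_def interval_lebesgue_integral_def set_lebesgue_integral_def zero_ereal_def)
  have "(\<integral>\<^sup>+x\<in>{0<..<s}. ennreal (f x) \<partial>lborel) = (\<integral>\<^sup>+x. ennreal (indicator {0<..<s} x * f x) \<partial>lborel)"
    by (intro nn_integral_cong) (auto split: split_indicator)
  also have "\<dots> = ennreal (F s - A)"
    using ** nonneg by (subst nn_integral_eq_integral) (auto split: split_indicator)
  finally show ?thesis .
qed

lemma nn_integral_inverse_near_0:
  fixes s :: real
  assumes "0 < s"
  shows "(\<integral>\<^sup>+x\<in>{0<..<s}. ennreal (1 / x) \<partial>lborel) = \<infinity>"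
proof (rule ccontr)
  assume "\<not> ?thesis"
  then obtain n :: nat where n: "(\<integral>\<^sup>+x\<in>{0<..<s}. ennreal (1 / x) \<partial>lborel) < of_nat n"
    using ennreal_Ex_less_of_nat by (auto simp: less_top)
  \<comment> \<open>The integral of \<open>1 / x\<close> over \<open>[\<delta>, s]\<close> is exactly \<open>n\<close>.\<close>
  define \<delta> where "\<delta> = s * exp (- real n)"
  have \<delta>: "0 < \<delta>" "\<delta> \<le> s" using assms by (auto simp: \<delta>_def)
  have "of_nat n = ennreal (ln s - ln \<delta>)"
    using assms by (simp add: \<delta>_def ln_mult ennreal_of_nat_eq_real_of_nat)
  also have "\<dots> = (\<integral>\<^sup>+x. ennreal (1 / x) * indicator {\<delta>..s} x \<partial>lborel)"
    using \<delta> by (intro nn_integral_FTC_Icc[symmetric]) (auto intro!: derivative_eq_intros)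
  also have "\<dots> \<le> (\<integral>\<^sup>+x\<in>{0<..<s}. ennreal (1 / x) \<partial>lborel)"
    using AE_lborel_singleton[of s]
    by (intro nn_integral_mono_AE, eventually_elim) (use \<delta> in \<open>auto split: split_indicator\<close>)
  finally show False using n by (simp add: not_less)
qed

lemma nn_integral_thorin_kernel:
  fixes c s :: real
  assumes s: "0 < s" and c: "- 1 < c" "c < 1"
  shows "(\<integral>\<^sup>+x\<in>{0<..<s}. ennreal (2 / ((1 - c) * x + (1 + c))) \<partial>lborel) =
    ennreal (2 / (1 - c)) * ennreal (ln (((1 + c) / (1 - c) + s) / ((1 + c) / (1 - c))))"
proof -
  define F where "F x = 2 / (1 - c) * ln ((1 - c) * x + (1 + c))" for x
  have pos: "0 < (1 - c) * x + (1 + c)" if "0 \<le> x" for x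
    using c that by (simp add: add_nonneg_pos)
  have "(\<integral>\<^sup>+x\<in>{0<..<s}. ennreal (2 / ((1 - c) * x + (1 + c))) \<partial>lborel) = ennreal (F s - F 0)"
  proof (rule nn_integral_FTC_Ioo[OF s])
    fix x :: real assume x: "0 < x"
    show "(F has_real_derivative 2 / ((1 - c) * x + (1 + c))) (at x)"
    proof -
      have "((\<lambda>x. ln ((1 - c) * x + (1 + c))) has_real_derivative (1 - c) / ((1 - c) * x + (1 + c))) (at x)"
        using pos[of x] x by (auto intro!: derivative_eq_intros)
      moreover have "2 / k * (k / y) = 2 / y" if "k \<noteq> 0" for k y :: real using that by simp
      moreover have "1 - c \<noteq> 0" using c by simp
      ultimately show ?thesis unfolding F_def using DERIV_cmult[of _ _ x UNIV "2 / (1 - c)"] by metis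
    qed
    show "isCont (\<lambda>x. 2 / ((1 - c) * x + (1 + c))) x" using pos[of x] x by (intro continuous_intros) auto
    show "0 \<le> 2 / ((1 - c) * x + (1 + c))" using pos[of x] x by simp
  next
    have "isCont F 0" unfolding F_def using pos[of 0] c by (intro continuous_intros) auto
    then show "(F \<longlongrightarrow> F 0) (at_right 0)" by (simp add: isCont_def filterlim_at_split)
  qed
  also have "F s - F 0 = 2 / (1 - c) * ln (((1 - c) * s + (1 + c)) / (1 + c))"
    unfolding F_def using pos[of s] s c by (simp add: ln_div right_diff_distrib)
  also have "((1 - c) * s + (1 + c)) / (1 + c) = ((1 + c) / (1 - c) + s) / ((1 + c) / (1 - c))"
  proof -
    have "(k * s + m) / m = (m / k + s) / (m / k)" if "k \<noteq> 0" "m \<noteq> 0" for k m :: real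
      using that by (simp add: field_simps)
    then show ?thesis using c by simp
  qed
  finally show ?thesis using c by (subst ennreal_mult'[symmetric]) auto
qed

text \<open>
Integrate the representation of \<open>l = L'\<close> over \<open>(0, s)\<close>, where \<open>L(s) = - ln \<phi>(s)\<close>, and exchange the integrals.  Since \<open>L\<close> is
finite, \<open>\<nu>\<close> cannot charge \<open>c = - 1\<close>, where the inner integral is that of \<open>1 / x\<close>.  Transporting
\<open>2 / (1 - c) \<nu>(dc)\<close> by \<open>t = (1 + c) / (1 - c)\<close> gives \<open>U\<close>.  All the integrability conditions follow from the
single one that \<open>ln ((t + 1) / t)\<close> is integrable, by comparison.
\<close>
lemma thorin_measure_of_log_derivative:
  fixes L l :: "real \<Rightarrow> real" and \<nu> :: "real measure"
  assumes fin: "finite_measure \<nu>" and \<nu>[measurable_cong]: "sets \<nu> = sets borel" and supp: "AE c in \<nu>. \<bar>c\<bar> \<le> 1"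
    and deriv: "\<And>s. 0 < s \<Longrightarrow> (L has_real_derivative l s) (at s)"
    and cont: "\<And>s. 0 < s \<Longrightarrow> isCont l s" and nonneg: "\<And>s. 0 < s \<Longrightarrow> 0 \<le> l s"
    and lim: "(L \<longlongrightarrow> 0) (at_right 0)"
    and rep: "\<And>s. 0 < s \<Longrightarrow> ennreal (l s) = (\<integral>\<^sup>+c. ennreal (2 / ((1 - c) * s + (1 + c))) \<partial>\<nu>)"
  obtains a :: real and U :: "real measure" where "thorin_pair a U"
    "\<And>s. 0 < s \<Longrightarrow> - L s = - a * s + (LINT t:{0<..}|U. ln (t / (t + s)))"
proof -
  interpret finite_measure \<nu> by (rule fin)
  define I where "I s c = (\<integral>\<^sup>+x\<in>{0<..<s}. ennreal (2 / ((1 - c) * x + (1 + c))) \<partial>lborel)" for s c :: real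
  define T where "T c = (1 + c) / (1 - c)" for c :: real
  have [measurable]: "T \<in> borel_measurable borel" unfolding T_def by measurable
  have LI: "ennreal (L s) = (\<integral>\<^sup>+c. I s c \<partial>\<nu>)" if s: "0 < s" for s
  proof -
    have "ennreal (L s) = (\<integral>\<^sup>+x\<in>{0<..<s}. ennreal (l x) \<partial>lborel)"
      using nn_integral_FTC_Ioo[OF s deriv cont nonneg lim] by simp
    also have "\<dots> = (\<integral>\<^sup>+x. (\<integral>\<^sup>+c. ennreal (2 / ((1 - c) * x + (1 + c))) * indicator {0<..<s} x \<partial>\<nu>) \<partial>lborel)"
      using rep by (intro nn_integral_cong) (auto simp: nn_integral_multc split: split_indicator)
    also have "\<dots> = (\<integral>\<^sup>+c. I s c \<partial>\<nu>)"
      unfolding I_def by (rule pair_sigma_finite.Fubini') (auto simp: pair_sigma_finite_def sigma_finite_measure_axioms lborel.sigma_finite_measure_axioms)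
    finally show ?thesis .
  qed
  have I_meas[measurable]: "I s \<in> borel_measurable borel" for s unfolding I_def by measurable
  have Ifin: "AE c in \<nu>. I 1 c \<noteq> \<infinity>"
    using LI[of 1] by (intro nn_integral_PInf_AE) (simp, metis ennreal_neq_top infinity_ennreal_def zero_less_one)
  have Im1: "I 1 (-1) = \<infinity>" using nn_integral_inverse_near_0[of 1] by (simp add: I_def)
  have supp': "AE c in \<nu>. c = 1 \<or> (- 1 < c \<and> c < 1)"
    using Ifin supp
  proof eventually_elim
    case (elim c)
    then have "c \<noteq> - 1" using Im1 by auto
    then show ?case using elim(2) by (auto simp: abs_le_iff)
  qed
  \<comment> \<open>The cut-off at \<open>\<plusminus> 1\<close> keeps the drift \<open>c = 1\<close> out of \<open>U\<close>; there \<open>T\<close> would have the default value \<open>0\<close>.\<close>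
  define d where "d c = (if - 1 < c \<and> c < 1 then 2 / (1 - c) else 0)" for c :: real
  have d0: "0 \<le> d c" for c by (simp add: d_def)
  have [measurable]: "d \<in> borel_measurable borel" unfolding d_def by measurable
  define U where "U = distr (density \<nu> (\<lambda>c. ennreal (d c))) borel T"
  have U_sets[measurable_cong]: "sets U = sets borel" by (simp add: U_def)
  have U_int: "(\<integral>\<^sup>+t. f t \<partial>U) = (\<integral>\<^sup>+c. ennreal (d c) * f (T c) \<partial>\<nu>)" if "f \<in> borel_measurable borel" for f
    unfolding U_def using that by (subst nn_integral_distr) (auto simp: nn_integral_density)
  define a where "a = measure \<nu> {1}"
  define J where "J s = (\<integral>\<^sup>+t\<in>{0<..}. ennreal (ln ((t + s) / t)) \<partial>U)" for s
  have T_pos: "0 < T c" if "-1 < c" "c < 1" for c using that by (simp add: T_def)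
  have LJ: "ennreal (L s) = ennreal (a * s) + J s" if s: "0 < s" for s
  proof -
    have J_eq: "J s = (\<integral>\<^sup>+c. ennreal (d c) * (ennreal (ln ((T c + s) / T c)) * indicator {0<..} (T c)) \<partial>\<nu>)"
      unfolding J_def by (rule U_int) simp
    have a_eq: "ennreal (a * s) = (\<integral>\<^sup>+c. ennreal s * indicator {1} c \<partial>\<nu>)"
      using s by (subst nn_integral_cmult_indicator) (auto simp: a_def emeasure_eq_measure ennreal_mult' mult.commute)
    have "ennreal (a * s) + J s = (\<integral>\<^sup>+c. ennreal s * indicator {1} c +
        ennreal (d c) * (ennreal (ln ((T c + s) / T c)) * indicator {0<..} (T c)) \<partial>\<nu>)"
      unfolding J_eq a_eq by (subst nn_integral_add) auto
    also have "\<dots> = (\<integral>\<^sup>+c. I s c \<partial>\<nu>)"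
    proof (intro nn_integral_cong_AE, use supp' in eventually_elim)
      fix c :: real assume "c = 1 \<or> - 1 < c \<and> c < 1"
      then show "ennreal s * indicator {1} c + ennreal (d c) * (ennreal (ln ((T c + s) / T c)) * indicator {0<..} (T c)) = I s c"
      proof
        assume "c = 1"
        then show ?thesis using s by (simp add: I_def d_def nn_integral_cmult_indicator)
      next
        assume c: "- 1 < c \<and> c < 1"
        then show ?thesis using T_pos[of c] nn_integral_thorin_kernel[OF s, of c] by (simp add: I_def d_def T_def)
      qed
    qed
    finally show ?thesis using LI[OF s] by simp
  qed
  have a0: "0 \<le> a" by (simp add: a_def)
  have L0: "0 \<le> L s" if s: "0 < s" for s
  proof -
    have "L x \<le> L y" if "0 < x" "x \<le> y" for x y
      using that deriv nonneg by (intro DERIV_nonneg_imp_nondecreasing[of x y L]) (meson less_le_trans)+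
    then have "eventually (\<lambda>x. L x \<le> L s) (at_right 0)"
      using eventually_at_right_less[of 0] eventually_at_right[OF s, of "\<lambda>x. x < s"] s
      by (auto simp: eventually_at_right_field intro!: exI[of _ s])
    then show ?thesis by (intro tendsto_upperbound[OF lim]) auto
  qed
  have Jfin: "J s < \<infinity>" if s: "0 < s" for s
  proof -
    have "J s \<le> ennreal (L s)" by (simp add: LJ[OF s])
    also have "\<dots> < \<infinity>" by simp
    finally show ?thesis .
  qed
  show ?thesis
  proof (rule that)
    show "thorin_pair a U"
      unfolding thorin_pair_def
    proof (intro conjI allI impI a0 U_sets)
      have "emeasure U {..0} = (\<integral>\<^sup>+t. indicator {..0} t \<partial>U)" by (simp add: U_sets)
      also have "\<dots> = (\<integral>\<^sup>+c. ennreal (d c) * indicator {..0} (T c) \<partial>\<nu>)" by (rule U_int) simp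
      also have "\<dots> = (\<integral>\<^sup>+c. 0 \<partial>\<nu>)"
        using T_pos by (intro nn_integral_cong) (force simp: d_def split: split_indicator)
      finally show "emeasure U {..0} = 0" by simp
    next
      fix K :: "real set" assume "compact K \<and> K \<subseteq> {0<..}"
      then have K: "compact K" "K \<subseteq> {0<..}" by auto
      obtain m where m: "m > 0" "\<And>x. x \<in> K \<Longrightarrow> x \<le> m"
        using compact_imp_bounded[OF K(1)] by (metis abs_le_D1 bounded_pos real_norm_def)
      define \<epsilon> where "\<epsilon> = ln ((m + 1) / m)"
      have \<epsilon>: "\<epsilon> > 0" using m by (simp add: \<epsilon>_def)
      have "ennreal \<epsilon> * emeasure U K = (\<integral>\<^sup>+t. ennreal \<epsilon> * indicator K t \<partial>U)"
        using K by (subst nn_integral_cmult_indicator) (auto simp: U_sets borel_compact)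
      also have "\<dots> \<le> J 1"
        unfolding J_def
      proof (intro nn_integral_mono)
        fix t
        have "\<epsilon> \<le> ln ((t + 1) / t)" if "t \<in> K"
          using m(2)[OF that] m(1) K(2) that unfolding \<epsilon>_def by (intro ln_mono) (auto simp: field_simps)
        then show "ennreal \<epsilon> * indicator K t \<le> ennreal (ln ((t + 1) / t)) * indicator {0<..} t"
          using K(2) by (auto split: split_indicator intro: ennreal_leI)
      qed
      finally have "ennreal \<epsilon> * emeasure U K < \<infinity>" using Jfin[of 1] by (auto intro: le_less_trans)
      then show "emeasure U K < \<infinity>" using \<epsilon> by (auto simp: ennreal_mult_less_top)
    next
      have "(\<integral>\<^sup>+ t\<in>{0<..<1}. ennreal \<bar>ln t\<bar> \<partial>U) \<le> J 1"
        unfolding J_def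
      proof (intro nn_integral_mono)
        fix t :: real
        have "\<bar>ln t\<bar> \<le> ln ((t + 1) / t)" if "0 < t" "t < 1"
          using that by (simp add: ln_div)
        then show "ennreal \<bar>ln t\<bar> * indicator {0<..<1} t \<le> ennreal (ln ((t + 1) / t)) * indicator {0<..} t"
          by (auto split: split_indicator intro: ennreal_leI)
      qed
      then show "(\<integral>\<^sup>+ t\<in>{0<..<1}. ennreal \<bar>ln t\<bar> \<partial>U) < \<infinity>" using Jfin[of 1] by (auto intro: le_less_trans)
    next
      have "(\<integral>\<^sup>+ t\<in>{1<..}. ennreal (1 / t) \<partial>U) \<le> (\<integral>\<^sup>+t. 2 * (ennreal (ln ((t + 1) / t)) * indicator {0<..} t) \<partial>U)"
      proof (intro nn_integral_mono)
        fix t :: real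
        have "1 / t \<le> 2 * ln ((t + 1) / t)" if "1 < t"
        proof -
          have "1 - t / (t + 1) \<le> - ln (t / (t + 1))"
            using ln_le_minus_one[of "t / (t + 1)"] that by simp
          also have "- ln (t / (t + 1)) = ln ((t + 1) / t)" using that by (simp add: ln_div)
          finally have "1 / (t + 1) \<le> ln ((t + 1) / t)" using that by (simp add: field_simps)
          moreover have "1 / t \<le> 2 * (1 / (t + 1))" using that by (simp add: field_simps)
          ultimately show ?thesis by linarith
        qed
        then have "ennreal (1 / t) \<le> 2 * ennreal (ln ((t + 1) / t))" if "1 < t"
          using that by (metis ennreal_leI ennreal_mult' ennreal_numeral zero_le_numeral)
        then show "ennreal (1 / t) * indicator {1<..} t \<le> 2 * (ennreal (ln ((t + 1) / t)) * indicator {0<..} t)"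
          by (auto split: split_indicator)
      qed
      also have "\<dots> = 2 * J 1" unfolding J_def by (subst nn_integral_cmult) auto
      also have "\<dots> < \<infinity>" using Jfin[of 1] by (simp add: ennreal_mult_less_top)
      finally show "(\<integral>\<^sup>+ t\<in>{1<..}. ennreal (1 / t) \<partial>U) < \<infinity>" .
    qed
  next
    fix s :: real assume s: "0 < s"
    have "(LINT t:{0<..}|U. ln (t / (t + s))) = - (LINT t|U. indicator {0<..} t * ln ((t + s) / t))"
      unfolding set_lebesgue_integral_def integral_minus[symmetric]
      using s by (intro Bochner_Integration.integral_cong refl) (auto simp: ln_div split: split_indicator)
    also have "(LINT t|U. indicator {0<..} t * ln ((t + s) / t)) = enn2real (\<integral>\<^sup>+t. ennreal (indicator {0<..} t * ln ((t + s) / t)) \<partial>U)"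
      using s by (intro integral_eq_nn_integral) (auto split: split_indicator)
    also have "(\<integral>\<^sup>+t. ennreal (indicator {0<..} t * ln ((t + s) / t)) \<partial>U) = J s"
      unfolding J_def by (intro nn_integral_cong) (auto split: split_indicator)
    finally have 1: "(LINT t:{0<..}|U. ln (t / (t + s))) = - enn2real (J s)" .
    have "ennreal (L s) = ennreal (a * s + enn2real (J s))"
      unfolding LJ[OF s] using Jfin[OF s] a0 s by (subst ennreal_plus) (auto simp: ennreal_enn2real_if)
    then have "L s = a * s + enn2real (J s)"
      using L0[OF s] a0 s by (subst (asm) ennreal_inj) auto
    then show "- L s = - a * s + (LINT t:{0<..}|U. ln (t / (t + s)))" using 1 by simp
  qed
qed

lemma polar_upper:
  assumes "z \<in> - \<real>\<^sub>\<le>\<^sub>0" "0 \<le> Im z"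
  obtains r \<theta> where "0 < r" "0 \<le> \<theta>" "\<theta> < pi" "z = of_real r * cis \<theta>"
proof (rule that)
  have z: "z \<noteq> 0" using assms by auto
  show "0 < norm z" using z by simp
  show "0 \<le> Arg z" using assms z by (simp add: Arg_less_0[symmetric] not_less)
  show "Arg z < pi"
    using Arg_le_pi[of z] Arg_eq_pi[of z] assms by (auto simp: complex_nonpos_Reals_iff less_le)
  show "z = of_real (norm z) * cis (Arg z)" using rcis_cmod_Arg[of z] by (simp add: rcis_def)
qed

text \<open>
The derivative of \<open>\<theta> \<mapsto> \<bar>\<phi>(r cis \<theta>)\<bar>\<^sup>2\<close> is \<open>2 \<bar>\<phi>\<bar>\<^sup>2\<close> times this imaginary part.
\<close>
lemma Im_log_derivative_nonneg:
  fixes \<phi> :: "complex \<Rightarrow> complex"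
  assumes deriv: "(\<phi> has_field_derivative D) (at z)" and z: "z = of_real r * cis \<theta>" and r: "0 < r" and \<theta>: "0 \<le> \<theta>" "\<theta> < pi"
    and mono: "\<And>\<theta> \<theta>'. 0 \<le> \<theta> \<Longrightarrow> \<theta> \<le> \<theta>' \<Longrightarrow> \<theta>' < pi \<Longrightarrow>
        norm (\<phi> (of_real r * cis \<theta>)) \<le> norm (\<phi> (of_real r * cis \<theta>'))"
    and nz: "\<phi> z \<noteq> 0"
  shows "0 \<le> Im (- z * D / \<phi> z)"
proof -
  define w where "w t = of_real r * cis t" for t
  have "(w has_vector_derivative (\<i> * z)) (at \<theta>)"
  proof -
    have "((\<lambda>t. of_real r * exp (\<i> * t)) has_field_derivative (of_real r * (\<i> * exp (\<i> * of_real \<theta>)))) (at (of_real \<theta>))"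
      by (auto intro!: derivative_eq_intros)
    from has_vector_derivative_real_field[OF this] show ?thesis
      by (simp add: w_def[abs_def] z cis_conv_exp mult_ac)
  qed
  moreover have "(\<phi> has_field_derivative D) (at (w \<theta>))" using deriv z by (simp add: w_def)
  ultimately have vd: "((\<phi> \<circ> w) has_vector_derivative (\<i> * z * D)) (at \<theta>)"
    by (rule field_vector_diff_chain_at)
  have re: "((\<lambda>t. Re (\<phi> (w t))) has_real_derivative Re (\<i> * z * D)) (at \<theta>)"
    and im: "((\<lambda>t. Im (\<phi> (w t))) has_real_derivative Im (\<i> * z * D)) (at \<theta>)"
    using bounded_linear.has_vector_derivative[OF bounded_linear_Re vd]
      bounded_linear.has_vector_derivative[OF bounded_linear_Im vd]
    by (simp_all add: has_real_derivative_iff_has_vector_derivative o_def)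
  define g where "g t = (norm (\<phi> (w t)))\<^sup>2" for t
  define g' where "g' = 2 * (Re (\<phi> z) * Re (\<i> * z * D) + Im (\<phi> z) * Im (\<i> * z * D))"
  have gd: "(g has_real_derivative g') (at \<theta>)"
    unfolding g_def cmod_power2
    by (rule DERIV_cong[OF DERIV_add[OF DERIV_power[OF re, of 2] DERIV_power[OF im, of 2]]])
       (simp add: g'_def w_def z)
  have "0 \<le> g'"
  proof (rule ccontr)
    assume "\<not> 0 \<le> g'"
    then obtain d where d: "d > 0" "\<And>h. h > 0 \<Longrightarrow> h < d \<Longrightarrow> g \<theta> > g (\<theta> + h)"
      using DERIV_neg_dec_right[OF gd] by auto
    \<comment> \<open>Small enough to stay below \<open>\<pi>\<close>, where the modulus is known to be monotone.\<close>
    define h where "h = min (d/2) ((pi - \<theta>)/2)"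
    have h: "0 < h" "h < d" "\<theta> + h < pi" using d \<theta> by (auto simp: h_def min_def field_simps)
    have "g \<theta> \<le> g (\<theta> + h)" unfolding g_def w_def using \<theta> h by (intro power_mono mono) auto
    with d(2)[OF h(1,2)] show False by simp
  qed
  also have "g' = 2 * (norm (\<phi> z))\<^sup>2 * Im (- z * D / \<phi> z)"
  proof -
    have "(norm v)\<^sup>2 * Im (u / v) = Im u * Re v - Re u * Im v" if "v \<noteq> 0" for u v :: complex
    proof -
      have "Im (u / v) = (Im u * Re v - Re u * Im v) / (norm v)\<^sup>2"
        unfolding cmod_power2 by (simp add: Im_divide)
      then show ?thesis using that by simp
    qed
    from this[OF nz, of "- z * D"]
    have "(norm (\<phi> z))\<^sup>2 * Im (- z * D / \<phi> z) = Im (- z * D) * Re (\<phi> z) - Re (- z * D) * Im (\<phi> z)" .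
    then show ?thesis unfolding g'_def by (simp add: algebra_simps)
  qed
  finally have "0 \<le> 2 * (norm (\<phi> z))\<^sup>2 * Im (- z * D / \<phi> z)" .
  moreover have "0 < 2 * (norm (\<phi> z))\<^sup>2" using nz by simp
  ultimately show ?thesis by (metis linorder_not_less mult_pos_neg)
qed

text \<open>
Growth along arcs also keeps \<open>\<phi>\<close> away from \<open>0\<close>, since \<open>\<phi>\<close> is positive where each arc starts; so
\<open>F(z) = - z \<phi>'(z) / \<phi>(z)\<close> is holomorphic on the whole slit plane.
\<close>
theorem thorin_of_monotone_modulus:
  fixes \<phi> :: "complex \<Rightarrow> complex"
  assumes hol: "\<phi> holomorphic_on (- \<real>\<^sub>\<le>\<^sub>0)"
    and cnj: "\<And>z. z \<in> - \<real>\<^sub>\<le>\<^sub>0 \<Longrightarrow> \<phi> (cnj z) = cnj (\<phi> z)"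
    and pos: "\<And>s. 0 < s \<Longrightarrow> 0 < Re (\<phi> (of_real s))"
    and dec: "\<And>s. 0 < s \<Longrightarrow> Re (deriv \<phi> (of_real s)) < 0"
    and lim: "((\<lambda>s. Re (\<phi> (of_real s))) \<longlongrightarrow> 1) (at_right 0)"
    and mono: "\<And>r \<theta> \<theta>'. 0 < r \<Longrightarrow> 0 \<le> \<theta> \<Longrightarrow> \<theta> \<le> \<theta>' \<Longrightarrow> \<theta>' < pi \<Longrightarrow>
        norm (\<phi> (of_real r * cis \<theta>)) \<le> norm (\<phi> (of_real r * cis \<theta>'))"
  obtains a :: real and U :: "real measure" where "thorin_pair a U"
    "\<And>s. 0 < s \<Longrightarrow> Re (\<phi> (of_real s)) = exp (- a * s + (LINT t:{0<..}|U. ln (t / (t + s))))"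
proof -
  let ?S = "- \<real>\<^sub>\<le>\<^sub>0 :: complex set"
  have of_real_S: "of_real s \<in> ?S" if "0 < s" for s using that by (simp add: complex_nonpos_Reals_iff)
  have cnj_S: "cnj z \<in> ?S" if "z \<in> ?S" for z using that by (simp add: complex_nonpos_Reals_iff)
  have nz_upper: "\<phi> z \<noteq> 0" if z: "z \<in> ?S" "0 \<le> Im z" for z
  proof -
    obtain r \<theta> where r: "0 < r" "0 \<le> \<theta>" "\<theta> < pi" "z = of_real r * cis \<theta>" using polar_upper[OF z] .
    have "0 < norm (\<phi> (of_real r))" using pos[OF r(1)] by auto
    also have "\<dots> \<le> norm (\<phi> z)" using mono[OF r(1), of 0 \<theta>] r by simp
    finally show ?thesis by auto
  qed
  have nz: "\<phi> z \<noteq> 0" if "z \<in> ?S" for z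
    using nz_upper[OF that] nz_upper[OF cnj_S[OF that]] cnj[OF that] by (cases "0 \<le> Im z") auto
  have D: "(\<phi> has_field_derivative deriv \<phi> z) (at z)" if "z \<in> ?S" for z
    using holomorphic_derivI[OF hol open_slit_plane that] .
  have D_cnj: "deriv \<phi> (cnj z) = cnj (deriv \<phi> z)" if z: "z \<in> ?S" for z
  proof -
    have "((cnj \<circ> \<phi> \<circ> cnj) has_field_derivative cnj (deriv \<phi> z)) (at (cnj z))"
      using D[OF z] by (intro has_field_derivative_cnj_cnj) simp
    moreover have "eventually (\<lambda>y. (cnj \<circ> \<phi> \<circ> cnj) y = \<phi> y) (nhds (cnj z))"
      using eventually_nhds_in_open[OF open_slit_plane cnj_S[OF z]] by eventually_elim (simp add: cnj)
    ultimately have "(\<phi> has_field_derivative cnj (deriv \<phi> z)) (at (cnj z))"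
      using DERIV_cong_ev[OF refl _ refl] by blast
    then show ?thesis by (rule DERIV_imp_deriv)
  qed
  have real: "\<phi> (of_real s) = of_real (Re (\<phi> (of_real s)))" if "0 < s" for s
    using cnj[OF of_real_S[OF that]] by (simp add: complex_eq_iff)
  define F where "F z = - z * deriv \<phi> z / \<phi> z" for z
  have holF: "F holomorphic_on ?S"
    unfolding F_def using nz by (intro holomorphic_intros holomorphic_deriv hol open_slit_plane) auto
  have F_cnj: "F (cnj z) = cnj (F z)" if "z \<in> ?S" for z
    unfolding F_def using D_cnj[OF that] cnj[OF that] by simp
  have F_upper: "0 \<le> Im (F z)" if pz: "0 < Im z" for z
  proof -
    have zS: "z \<in> ?S" using pz by (auto simp: complex_nonpos_Reals_iff)
    obtain r \<theta> where r: "0 < r" "0 \<le> \<theta>" "\<theta> < pi" "z = of_real r * cis \<theta>" using polar_upper[OF zS less_imp_le[OF pz]] .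
    show ?thesis unfolding F_def
      by (rule Im_log_derivative_nonneg[OF D[OF zS] r(4) r(1) r(2) r(3) mono[OF r(1)] nz[OF zS]])
  qed
  define l where "l s = - Re (deriv \<phi> (of_real s)) / Re (\<phi> (of_real s))" for s
  have F_real: "Re (F (of_real s)) / s = l s" if s: "0 < s" for s
  proof -
    have "F (of_real s) = of_real (- s / Re (\<phi> (of_real s))) * deriv \<phi> (of_real s)"
      unfolding F_def by (subst real[OF s]) simp
    then have "Re (F (of_real s)) = (- s / Re (\<phi> (of_real s))) * Re (deriv \<phi> (of_real s))"
      by (simp only: times_complex.sel Re_complex_of_real Im_complex_of_real mult_zero_left diff_0_right)
    then show ?thesis using s by (simp add: l_def)
  qed
  have l_pos: "0 < l s" if "0 < s" for s
    unfolding l_def using pos[OF that] dec[OF that] by (simp add: divide_neg_pos)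
  have F_nonneg: "0 < Re (F (of_real s))" if "0 < s" for s
    using F_real[OF that] l_pos[OF that] that by (metis zero_less_divide_iff order_less_asym)
  obtain \<nu> :: "real measure" where \<nu>: "finite_measure \<nu>" "sets \<nu> = sets borel" "AE c in \<nu>. \<bar>c\<bar> \<le> 1"
    "\<And>s. 0 < s \<Longrightarrow> ennreal (Re (F (of_real s)) / s) = (\<integral>\<^sup>+c. ennreal (2 / ((1 - c) * s + (1 + c))) \<partial>\<nu>)"
    using complete_bernstein_representation[OF holF F_cnj F_upper less_imp_le[OF F_nonneg]] F_nonneg[of 1] by auto
  define L where "L s = - ln (Re (\<phi> (of_real s)))" for s
  have L: "(L has_real_derivative l s) (at s)" if s: "0 < s" for s
  proof -
    have "((\<lambda>x. \<phi> (of_real x)) has_vector_derivative deriv \<phi> (of_real s)) (at s)"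
      by (rule has_vector_derivative_real_field[OF D[OF of_real_S[OF s]]])
    then have "((\<lambda>x. Re (\<phi> (of_real x))) has_real_derivative Re (deriv \<phi> (of_real s))) (at s)"
      using bounded_linear.has_vector_derivative[OF bounded_linear_Re]
      by (simp add: has_real_derivative_iff_has_vector_derivative)
    from DERIV_minus[OF DERIV_chain2[OF DERIV_ln_divide[OF pos[OF s]] this]] show ?thesis
      unfolding L_def[abs_def] l_def by simp
  qed
  have l_cont: "isCont l s" if s: "0 < s" for s
  proof -
    have c: "isCont (\<lambda>x. Re (f (of_real x))) s" if "f holomorphic_on ?S" for f
    proof -
      have "isCont f (of_real s)"
        using holomorphic_on_imp_continuous_on[OF that] of_real_S[OF s] open_slit_plane
        by (simp add: continuous_on_eq_continuous_at)
      then show ?thesis by (intro continuous_Re isCont_o2[of s of_real f]) auto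
    qed
    show ?thesis unfolding l_def
      using c[OF hol] c[OF holomorphic_deriv[OF hol open_slit_plane]] pos[OF s]
      by (intro continuous_intros) auto
  qed
  have L_lim: "(L \<longlongrightarrow> 0) (at_right 0)"
  proof -
    have "(L \<longlongrightarrow> - ln 1) (at_right 0)" unfolding L_def by (intro tendsto_intros lim) auto
    then show ?thesis by simp
  qed
  have rep: "ennreal (l s) = (\<integral>\<^sup>+c. ennreal (2 / ((1 - c) * s + (1 + c))) \<partial>\<nu>)" if "0 < s" for s
    using \<nu>(4)[OF that] F_real[OF that] by simp
  show ?thesis
  proof (rule thorin_measure_of_log_derivative[OF \<nu>(1-3) L l_cont less_imp_le[OF l_pos] L_lim rep])
    fix a U assume *: "thorin_pair a U"
      "\<And>s. 0 < s \<Longrightarrow> - L s = - a * s + (LINT t:{0<..}|U. ln (t / (t + s)))"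
    show ?thesis
    proof (rule that[OF *(1)])
      fix s :: real assume s: "0 < s"
      have "Re (\<phi> (of_real s)) = exp (- L s)" using pos[OF s] by (simp add: L_def)
      then show "Re (\<phi> (of_real s)) = exp (- a * s + (LINT t:{0<..}|U. ln (t / (t + s))))"
        using *(2)[OF s] by simp
    qed
  qed
qed

section \<open>Scale mixtures of gamma distributions\<close>

text \<open>
For a gamma variable \<open>Y\<close> of shape \<open>k\<close> independent of \<open>V\<close> this extends the Laplace transform of \<open>Y V\<close> from
\<open>(0, \<infinity>)\<close> to the slit plane.
\<close>
definition gamma_mixture_laplace :: "'a measure \<Rightarrow> ('a \<Rightarrow> real) \<Rightarrow> nat \<Rightarrow> complex \<Rightarrow> complex" where
  "gamma_mixture_laplace M V k z = (LINT \<omega>|M. 1 / (1 + z * of_real (V \<omega>)) ^ k)"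

lemma (in prob_space) expectation_pos:
  fixes f :: "'a \<Rightarrow> real"
  assumes "integrable M f" "AE \<omega> in M. 0 < f \<omega>"
  shows "0 < (LINT \<omega>|M. f \<omega>)"
proof -
  have nn: "AE \<omega> in M. 0 \<le> f \<omega>" using assms(2) by eventually_elim simp
  have "(LINT \<omega>|M. f \<omega>) \<noteq> 0"
  proof
    assume "(LINT \<omega>|M. f \<omega>) = 0"
    then have "AE \<omega> in M. f \<omega> = 0" using integral_nonneg_eq_0_iff_AE[OF assms(1) nn] by simp
    with assms(2) have "AE \<omega> in M. False" by eventually_elim simp
    then show False by simp
  qed
  moreover have "0 \<le> (LINT \<omega>|M. f \<omega>)" using nn by (rule integral_nonneg_AE)
  ultimately show ?thesis by simp
qed

context
  fixes M :: "'a measure" and V :: "'a \<Rightarrow> real" and n :: nat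
  assumes prob: "prob_space M" and V[measurable]: "V \<in> borel_measurable M" and Vpos: "AE \<omega> in M. 0 < V \<omega>"
begin

interpretation prob_space M by (rule prob)

text \<open>
Differentiation under the integral sign.  The derivative of the integrand is bounded near \<open>z\<close> uniformly in \<open>V\<close>, hence so are
its difference quotients.
\<close>
lemma gamma_mixture_laplace_deriv:
  assumes z: "z \<in> - \<real>\<^sub>\<le>\<^sub>0"
  shows "integrable M (\<lambda>\<omega>. 1 / (1 + z * of_real (V \<omega>)) ^ Suc n)"
    and "integrable M (\<lambda>\<omega>. - of_nat (Suc n) * of_real (V \<omega>) / (1 + z * of_real (V \<omega>)) ^ (n + 2))"
    and "(gamma_mixture_laplace M V (Suc n) has_field_derivative
       (LINT \<omega>|M. - of_nat (Suc n) * of_real (V \<omega>) / (1 + z * of_real (V \<omega>)) ^ (n + 2))) (at z)"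
proof -
  obtain \<delta> where \<delta>: "0 < \<delta>" "ball z \<delta> \<subseteq> - \<real>\<^sub>\<le>\<^sub>0"
    "\<And>y v. y \<in> ball z \<delta> \<Longrightarrow> 0 \<le> v \<Longrightarrow> \<delta> * (1 + v) \<le> norm (1 + y * of_real v)"
    using slit_plane_linear_lower_bound[OF z] by blast
  define g where "g v y = 1 / (1 + y * of_real v) ^ Suc n" for v :: real and y :: complex
  define g' where "g' v y = - of_nat (Suc n) * of_real v / (1 + y * of_real v) ^ (n + 2)" for v :: real and y :: complex
  have nz: "1 + y * of_real v \<noteq> 0" if "y \<in> ball z \<delta>" "0 < v" for y v
  proof -
    have "0 < \<delta> * (1 + v)" using \<delta>(1) that by simp
    then show ?thesis using \<delta>(3)[of y v] that by auto
  qed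
  have gd: "(g v has_field_derivative g' v y) (at y within A)" if "y \<in> ball z \<delta>" "0 < v" for y v A
  proof -
    have "((\<lambda>y. 1 + y * of_real v) has_field_derivative of_real v) (at y within A)"
      by (auto intro!: derivative_eq_intros)
    from has_field_derivative_divide_power[OF this nz[OF that], of 1 n] show ?thesis
      by (simp add: g_def[abs_def] g'_def)
  qed
  define B where "B = real (Suc n) / \<delta> ^ (n + 2)"
  have low: "\<delta> ^ m * (1 + v) ^ m \<le> norm (1 + y * of_real v) ^ m" if "y \<in> ball z \<delta>" "0 < v" for y v m
    using \<delta>(3)[OF that(1), of v] that(2) \<delta>(1)
    by (subst power_mult_distrib[symmetric], intro power_mono) auto
  have g_bound: "norm (g v y) \<le> 1 / \<delta> ^ Suc n" if "y \<in> ball z \<delta>" "0 < v" for y v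
  proof -
    have "\<delta> ^ Suc n * 1 \<le> \<delta> ^ Suc n * (1 + v) ^ Suc n" using that \<delta>(1) by (intro mult_left_mono one_le_power) auto
    also note low[OF that, of "Suc n"]
    finally show ?thesis unfolding g_def norm_divide norm_power using \<delta>(1) nz[OF that]
      by (intro frac_le) (auto simp: zero_less_power)
  qed
  have g'_bound: "norm (g' v y) \<le> B" if "y \<in> ball z \<delta>" "0 < v" for y v
  proof -
    have "\<delta> ^ (n + 2) * v \<le> \<delta> ^ (n + 2) * (1 + v) ^ (n + 2)"
    proof (intro mult_left_mono)
      have "v \<le> (1 + v) ^ 1" by simp
      also have "\<dots> \<le> (1 + v) ^ (n + 2)" using that by (intro power_increasing) auto
      finally show "v \<le> (1 + v) ^ (n + 2)" .
    qed (use \<delta>(1) in simp)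
    also note low[OF that, of "n + 2"]
    finally have *: "\<delta> ^ (n + 2) * v \<le> norm (1 + y * of_real v) ^ (n + 2)" .
    have "norm (g' v y) = real (Suc n) * v / norm (1 + y * of_real v) ^ (n + 2)"
      unfolding g'_def norm_divide norm_power norm_mult norm_minus_cancel using that
      by (simp del: of_nat_Suc power_Suc)
    also have "\<dots> \<le> B"
    proof -
      have "real (Suc n) * (\<delta> ^ (n + 2) * v) \<le> real (Suc n) * norm (1 + y * of_real v) ^ (n + 2)"
        using * by (intro mult_left_mono) auto
      moreover have "0 < norm (1 + y * of_real v) ^ (n + 2)" using nz[OF that] by simp
      moreover have "0 < \<delta> ^ (n + 2)" using \<delta>(1) by simp
      moreover have "k * v / a \<le> k / b" if "k * (b * v) \<le> k * a" "0 < a" "0 < b" for k v a b :: real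
        using that by (simp add: field_simps)
      ultimately show ?thesis unfolding B_def by blast
    qed
    finally show ?thesis .
  qed
  have z_in: "z \<in> ball z \<delta>" using \<delta>(1) by simp
  have [measurable]: "(\<lambda>\<omega>. g (V \<omega>) y) \<in> borel_measurable M" "(\<lambda>\<omega>. g' (V \<omega>) y) \<in> borel_measurable M" for y
    unfolding g_def g'_def by measurable
  have int_g: "integrable M (\<lambda>\<omega>. g (V \<omega>) y)" if "y \<in> ball z \<delta>" for y
    by (rule integrable_const_bound[where B = "1 / \<delta> ^ Suc n"])
       (use Vpos in eventually_elim, use g_bound[OF that] in auto)
  then show "integrable M (\<lambda>\<omega>. 1 / (1 + z * of_real (V \<omega>)) ^ Suc n)" using z_in by (simp add: g_def)
  have int_g': "integrable M (\<lambda>\<omega>. g' (V \<omega>) z)"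
    by (rule integrable_const_bound[where B = B])
       (use Vpos in eventually_elim, use g'_bound[OF z_in] in auto)
  then show "integrable M (\<lambda>\<omega>. - of_nat (Suc n) * of_real (V \<omega>) / (1 + z * of_real (V \<omega>)) ^ (n + 2))"
    by (simp only: g'_def)
  have "((\<lambda>y. LINT \<omega>|M. g (V \<omega>) y) has_field_derivative (LINT \<omega>|M. g' (V \<omega>) z)) (at z)"
    unfolding has_field_derivative_iff
  proof (subst tendsto_cong)
    show "\<forall>\<^sub>F y in at z. ((LINT \<omega>|M. g (V \<omega>) y) - (LINT \<omega>|M. g (V \<omega>) z)) / (y - z) =
        (LINT \<omega>|M. (g (V \<omega>) y - g (V \<omega>) z) / (y - z))"
      using eventually_at_in_open'[OF open_ball z_in]
      by eventually_elim (simp add: Bochner_Integration.integral_diff[OF int_g int_g[OF z_in]])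
    show "((\<lambda>y. LINT \<omega>|M. (g (V \<omega>) y - g (V \<omega>) z) / (y - z)) \<longlongrightarrow> (LINT \<omega>|M. g' (V \<omega>) z)) (at z)"
      unfolding tendsto_at_iff_sequentially comp_def
    proof (intro allI impI)
      fix X assume X: "\<forall>i. X i \<in> UNIV - {z}" "X \<longlonglongrightarrow> z"
      obtain N where N: "\<And>i. i \<ge> N \<Longrightarrow> X i \<in> ball z \<delta>"
        using topological_tendstoD[OF X(2) open_ball z_in] by (auto simp: eventually_sequentially)
      show "(\<lambda>i. LINT \<omega>|M. (g (V \<omega>) (X i) - g (V \<omega>) z) / (X i - z)) \<longlonglongrightarrow> (LINT \<omega>|M. g' (V \<omega>) z)"
      proof (rule LIMSEQ_offset[of _ N], rule integral_dominated_convergence[where w = "\<lambda>_. B"])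
        show "AE \<omega> in M. (\<lambda>i. (g (V \<omega>) (X (i + N)) - g (V \<omega>) z) / (X (i + N) - z)) \<longlonglongrightarrow> g' (V \<omega>) z"
          using Vpos
        proof eventually_elim
          case (elim \<omega>)
          have "((\<lambda>y. (g (V \<omega>) y - g (V \<omega>) z) / (y - z)) \<longlongrightarrow> g' (V \<omega>) z) (at z)"
            using gd[OF z_in elim, of UNIV] unfolding has_field_derivative_iff .
          then have "(\<lambda>i. (g (V \<omega>) (X i) - g (V \<omega>) z) / (X i - z)) \<longlonglongrightarrow> g' (V \<omega>) z"
            using X unfolding tendsto_at_iff_sequentially comp_def by blast
          then show ?case by (rule LIMSEQ_ignore_initial_segment)
        qed
        show "AE \<omega> in M. norm ((g (V \<omega>) (X (i + N)) - g (V \<omega>) z) / (X (i + N) - z)) \<le> B" for i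
          using Vpos
        proof eventually_elim
          case (elim \<omega>)
          have "norm (g (V \<omega>) (X (i + N)) - g (V \<omega>) z) \<le> B * norm (X (i + N) - z)"
            by (rule field_differentiable_bound[OF convex_ball[of z \<delta>], where f' = "g' (V \<omega>)"])
               (use gd g'_bound elim N z_in in auto)
          then show ?case using X(1) by (simp add: norm_divide divide_le_eq)
        qed
      qed auto
    qed
  qed
  then show "(gamma_mixture_laplace M V (Suc n) has_field_derivative
       (LINT \<omega>|M. - of_nat (Suc n) * of_real (V \<omega>) / (1 + z * of_real (V \<omega>)) ^ (n + 2))) (at z)"
    by (simp only: gamma_mixture_laplace_def[abs_def] g_def g'_def)
qed

lemma gamma_mixture_laplace_holomorphic:
  "gamma_mixture_laplace M V (Suc n) holomorphic_on - \<real>\<^sub>\<le>\<^sub>0"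
  using gamma_mixture_laplace_deriv(3) open_slit_plane by (auto simp: holomorphic_on_open)

lemma gamma_mixture_laplace_cnj:
  "gamma_mixture_laplace M V (Suc n) (cnj z) = cnj (gamma_mixture_laplace M V (Suc n) z)"
proof -
  have "1 / (1 + cnj z * of_real (V \<omega>)) ^ Suc n = cnj (1 / (1 + z * of_real (V \<omega>)) ^ Suc n)" for \<omega> by simp
  then show ?thesis unfolding gamma_mixture_laplace_def by (simp only: Bochner_Integration.integral_cnj)
qed

lemma gamma_mixture_laplace_real:
  "gamma_mixture_laplace M V (Suc n) (of_real s) = of_real (LINT \<omega>|M. 1 / (1 + s * V \<omega>) ^ Suc n)"
proof -
  have "gamma_mixture_laplace M V (Suc n) (of_real s) = (LINT \<omega>|M. complex_of_real (1 / (1 + s * V \<omega>) ^ Suc n))"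
    unfolding gamma_mixture_laplace_def by (intro Bochner_Integration.integral_cong refl) simp
  then show ?thesis by (simp only: integral_complex_of_real)
qed

lemma gamma_mixture_laplace_pos:
  assumes s: "0 < s"
  shows "0 < Re (gamma_mixture_laplace M V (Suc n) (of_real s))"
  unfolding gamma_mixture_laplace_real Re_complex_of_real
proof (rule expectation_pos)
  show "integrable M (\<lambda>\<omega>. 1 / (1 + s * V \<omega>) ^ Suc n)"
    by (rule integrable_const_bound[where B = 1])
       (use Vpos in eventually_elim, use s one_le_power[of "1 + s * _" "Suc n"] in \<open>auto simp: divide_le_eq\<close>)
  show "AE \<omega> in M. 0 < 1 / (1 + s * V \<omega>) ^ Suc n"
    using Vpos by eventually_elim (use s in \<open>auto simp: add_pos_pos\<close>)
qed

lemma gamma_mixture_laplace_deriv_neg: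
  assumes s: "0 < s"
  shows "Re (deriv (gamma_mixture_laplace M V (Suc n)) (of_real s)) < 0"
proof -
  have sS: "of_real s \<in> - (\<real>\<^sub>\<le>\<^sub>0 :: complex set)" using s by (simp add: complex_nonpos_Reals_iff)
  define h where "h \<omega> = real (Suc n) * V \<omega> / (1 + s * V \<omega>) ^ (n + 2)" for \<omega>
  have eq: "- of_nat (Suc n) * of_real (V \<omega>) / (1 + of_real s * of_real (V \<omega>)) ^ (n + 2) = complex_of_real (- h \<omega>)" for \<omega>
    by (simp add: h_def del: of_nat_Suc power_Suc)
  have "deriv (gamma_mixture_laplace M V (Suc n)) (of_real s) = (LINT \<omega>|M. complex_of_real (- h \<omega>))"
    using DERIV_imp_deriv[OF gamma_mixture_laplace_deriv(3)[OF sS]] unfolding eq .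
  then have "Re (deriv (gamma_mixture_laplace M V (Suc n)) (of_real s)) = - (LINT \<omega>|M. h \<omega>)"
    by (simp only: integral_complex_of_real Re_complex_of_real integral_minus)
  moreover have "integrable M (\<lambda>\<omega>. Re (complex_of_real (- h \<omega>)))"
    using gamma_mixture_laplace_deriv(2)[OF sS] unfolding eq by (rule integrable_Re)
  then have "integrable M h" by simp
  then have "0 < (LINT \<omega>|M. h \<omega>)"
    by (rule expectation_pos) (use Vpos in eventually_elim, use s in \<open>auto simp: h_def add_pos_pos\<close>)
  ultimately show ?thesis by simp
qed

lemma gamma_mixture_laplace_at_0:
  "((\<lambda>s. Re (gamma_mixture_laplace M V (Suc n) (of_real s))) \<longlongrightarrow> 1) (at_right 0)"
  unfolding gamma_mixture_laplace_real Re_complex_of_real tendsto_at_iff_sequentially comp_def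
proof (intro allI impI)
  fix X :: "nat \<Rightarrow> real" assume X: "\<forall>i. X i \<in> {0<..} - {0}" "X \<longlonglongrightarrow> 0"
  have "(\<lambda>i. LINT \<omega>|M. 1 / (1 + X i * V \<omega>) ^ Suc n) \<longlonglongrightarrow> (LINT \<omega>|M. 1)"
  proof (rule integral_dominated_convergence[where w = "\<lambda>_. 1"])
    show "AE \<omega> in M. (\<lambda>i. 1 / (1 + X i * V \<omega>) ^ Suc n) \<longlonglongrightarrow> 1"
    proof (rule AE_I2)
      fix \<omega>
      have "(\<lambda>i. 1 / (1 + X i * V \<omega>) ^ Suc n) \<longlonglongrightarrow> 1 / (1 + 0 * V \<omega>) ^ Suc n"
        by (intro tendsto_intros X(2)) simp
      then show "(\<lambda>i. 1 / (1 + X i * V \<omega>) ^ Suc n) \<longlonglongrightarrow> 1" by simp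
    qed
    show "AE \<omega> in M. norm (1 / (1 + X i * V \<omega>) ^ Suc n) \<le> 1" for i
      using Vpos
    proof eventually_elim
      case (elim \<omega>)
      have "0 \<le> X i * V \<omega>" using X(1)[rule_format, of i] elim by simp
      then show ?case using one_le_power[of "1 + X i * V \<omega>" "Suc n"] by (simp add: divide_le_eq)
    qed
  qed auto
  then show "(\<lambda>i. LINT \<omega>|M. 1 / (1 + X i * V \<omega>) ^ Suc n) \<longlonglongrightarrow> 1" by (simp add: prob_space)
qed

end

lemma nn_integral_gamma_density_exp:
  fixes c :: real
  assumes c: "0 \<le> c"
  shows "(\<integral>\<^sup>+y. ennreal (gamma_density (real (Suc n)) 1 y) * ennreal (exp (- c * y)) \<partial>lborel) = ennreal (1 / (1 + c) ^ Suc n)"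
proof -
  have "gamma_density (real (Suc n)) 1 y * exp (- c * y) = 1 / (1 + c) ^ Suc n * erlang_density n (1 + c) y"
    if "y \<noteq> 0" for y :: real
  proof -
    have "Gamma (real (Suc n)) = fact n" using Gamma_fact[of n, where 'a = real] by (simp add: add.commute)
    moreover have "exp (- y * 1) * exp (- c * y) = exp (- (1 + c) * y)"
      by (simp add: exp_add[symmetric] algebra_simps)
    moreover have "y powr (real (Suc n) - 1) = y ^ n" if "0 < y" using that by (simp add: powr_realpow)
    ultimately show ?thesis using that c
      unfolding gamma_density_def erlang_density_def
      by (simp add: divide_inverse mult_ac del: power_Suc of_nat_Suc)
  qed
  note density_eq = this
  have "(\<integral>\<^sup>+y. ennreal (gamma_density (real (Suc n)) 1 y) * ennreal (exp (- c * y)) \<partial>lborel) =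
      (\<integral>\<^sup>+y. ennreal (1 / (1 + c) ^ Suc n) * ennreal (erlang_density n (1 + c) y * y ^ 0) \<partial>lborel)"
  proof (intro nn_integral_cong_AE, use AE_lborel_singleton[of 0] in eventually_elim)
    fix y :: real assume y: "y \<noteq> 0"
    have "ennreal (gamma_density (real (Suc n)) 1 y) * ennreal (exp (- c * y)) =
        ennreal (gamma_density (real (Suc n)) 1 y * exp (- c * y))" by (rule ennreal_mult''[symmetric]) simp
    also have "\<dots> = ennreal (1 / (1 + c) ^ Suc n) * ennreal (erlang_density n (1 + c) y * y ^ 0)"
      unfolding density_eq[OF y] using c by (subst ennreal_mult') auto
    finally show "ennreal (gamma_density (real (Suc n)) 1 y) * ennreal (exp (- c * y)) =
        ennreal (1 / (1 + c) ^ Suc n) * ennreal (erlang_density n (1 + c) y * y ^ 0)" .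
  qed
  also have "\<dots> = ennreal (1 / (1 + c) ^ Suc n) * ennreal (fact (n + 0) / (fact n * (1 + c) ^ 0))"
    using c by (subst nn_integral_cmult, simp, subst nn_integral_erlang_ith_moment) simp_all
  finally show ?thesis by simp
qed

text \<open>
Given \<open>V\<close>, the variable \<open>Y V\<close> has Laplace transform \<open>1 / (1 + s V)\<close> to the power \<open>n + 1\<close>; so its transform is the function to
which \<open>thorin_of_monotone_modulus\<close> applies.
\<close>
theorem gamma_mixture_GGC:
  fixes M :: "'a measure" and Y V :: "'a \<Rightarrow> real"
  assumes prob: "prob_space M" and indep: "prob_space.indep_var M borel Y borel V"
    and Y: "distributed M lborel Y (\<lambda>x. ennreal (gamma_density (real (Suc n)) 1 x))"
    and Vpos: "AE \<omega> in M. 0 < V \<omega>"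
    and mono: "\<And>r \<theta> \<theta>'. 0 < r \<Longrightarrow> 0 \<le> \<theta> \<Longrightarrow> \<theta> \<le> \<theta>' \<Longrightarrow> \<theta>' < pi \<Longrightarrow>
        norm (gamma_mixture_laplace M V (Suc n) (of_real r * cis \<theta>)) \<le>
        norm (gamma_mixture_laplace M V (Suc n) (of_real r * cis \<theta>'))"
  shows "GGC (distr M borel (\<lambda>\<omega>. Y \<omega> * V \<omega>))"
proof -
  interpret prob_space M by (rule prob)
  have meas[measurable]: "Y \<in> borel_measurable M" "V \<in> borel_measurable M"
    and joint: "distr M borel Y \<Otimes>\<^sub>M distr M borel V = distr M (borel \<Otimes>\<^sub>M borel) (\<lambda>\<omega>. (Y \<omega>, V \<omega>))"
    using indep unfolding indep_var_distribution_eq by auto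
  have distY: "distr M borel Y = density lborel (\<lambda>x. ennreal (gamma_density (real (Suc n)) 1 x))"
    using distributed_distr_eq_density[OF Y] by (metis distr_cong sets_lborel)
  have [measurable]: "gamma_density (real (Suc n)) 1 \<in> borel_measurable borel"
    unfolding gamma_density_def by measurable
  interpret PY: prob_space "distr M borel Y" by (rule prob_space_distr) simp
  interpret PV: prob_space "distr M borel V" by (rule prob_space_distr) simp
  interpret P: pair_sigma_finite "distr M borel Y" "distr M borel V" ..
  have Ypos: "AE \<omega> in M. 0 < Y \<omega>"
  proof -
    have "AE y in distr M borel Y. 0 < y"
      unfolding distY by (subst AE_density) (auto simp: gamma_density_def)
    then show ?thesis by (subst (asm) AE_distr_iff) auto
  qed
  have laplace_nn: "(\<integral>\<^sup>+\<omega>. ennreal (exp (- s * (Y \<omega> * V \<omega>))) \<partial>M) = (\<integral>\<^sup>+\<omega>. ennreal (1 / (1 + s * V \<omega>) ^ Suc n) \<partial>M)"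
    if s: "0 \<le> s" for s
  proof -
    have "(\<integral>\<^sup>+\<omega>. ennreal (exp (- s * (Y \<omega> * V \<omega>))) \<partial>M) =
        (\<integral>\<^sup>+p. ennreal (exp (- s * (fst p * snd p))) \<partial>distr M (borel \<Otimes>\<^sub>M borel) (\<lambda>\<omega>. (Y \<omega>, V \<omega>)))"
      by (subst nn_integral_distr) auto
    also have "\<dots> = (\<integral>\<^sup>+v. (\<integral>\<^sup>+y. ennreal (exp (- s * (y * v))) \<partial>distr M borel Y) \<partial>distr M borel V)"
      unfolding joint[symmetric] by (subst P.nn_integral_snd[symmetric]) auto
    also have "\<dots> = (\<integral>\<^sup>+\<omega>. (\<integral>\<^sup>+y. ennreal (exp (- s * (y * V \<omega>))) \<partial>distr M borel Y) \<partial>M)"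
      by (subst nn_integral_distr) auto
    also have "\<dots> = (\<integral>\<^sup>+\<omega>. ennreal (1 / (1 + s * V \<omega>) ^ Suc n) \<partial>M)"
    proof (intro nn_integral_cong_AE, use Vpos in eventually_elim)
      fix \<omega> assume v: "0 < V \<omega>"
      have "(\<integral>\<^sup>+y. ennreal (exp (- s * (y * V \<omega>))) \<partial>distr M borel Y) =
         (\<integral>\<^sup>+y. ennreal (gamma_density (real (Suc n)) 1 y) * ennreal (exp (- (s * V \<omega>) * y)) \<partial>lborel)"
        unfolding distY by (subst nn_integral_density) (auto simp: mult_ac simp del: of_nat_Suc)
      also have "\<dots> = ennreal (1 / (1 + s * V \<omega>) ^ Suc n)"
        using s v by (intro nn_integral_gamma_density_exp) simp
      finally show "(\<integral>\<^sup>+y. ennreal (exp (- s * (y * V \<omega>))) \<partial>distr M borel Y) = ennreal (1 / (1 + s * V \<omega>) ^ Suc n)" .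
    qed
    finally show ?thesis .
  qed
  have laplace: "(LINT x|distr M borel (\<lambda>\<omega>. Y \<omega> * V \<omega>). exp (- s * x)) = Re (gamma_mixture_laplace M V (Suc n) (of_real s))"
    if s: "0 \<le> s" for s
  proof -
    have "(LINT x|distr M borel (\<lambda>\<omega>. Y \<omega> * V \<omega>). exp (- s * x)) = (LINT \<omega>|M. exp (- s * (Y \<omega> * V \<omega>)))"
      by (subst integral_distr) auto
    also have "\<dots> = enn2real (\<integral>\<^sup>+\<omega>. ennreal (exp (- s * (Y \<omega> * V \<omega>))) \<partial>M)"
      by (intro integral_eq_nn_integral) auto
    also have "\<dots> = (LINT \<omega>|M. 1 / (1 + s * V \<omega>) ^ Suc n)"
      unfolding laplace_nn[OF s]
      by (intro integral_eq_nn_integral[symmetric]) (use Vpos s in \<open>auto elim!: eventually_mono\<close>)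
    finally show ?thesis unfolding gamma_mixture_laplace_real[OF prob meas(2) Vpos] by simp
  qed
  show ?thesis
  proof (rule thorin_of_monotone_modulus[OF gamma_mixture_laplace_holomorphic[OF prob meas(2) Vpos]
      gamma_mixture_laplace_cnj[OF prob meas(2) Vpos] gamma_mixture_laplace_pos[OF prob meas(2) Vpos]
      gamma_mixture_laplace_deriv_neg[OF prob meas(2) Vpos] gamma_mixture_laplace_at_0[OF prob meas(2) Vpos] mono])
    fix a :: real and U :: "real measure" assume U: "thorin_pair a U"
      "\<And>s. 0 < s \<Longrightarrow> Re (gamma_mixture_laplace M V (Suc n) (of_real s)) = exp (- a * s + (LINT t:{0<..}|U. ln (t / (t + s))))"
    have "(LINT x|distr M borel (\<lambda>\<omega>. Y \<omega> * V \<omega>). exp (- s * x)) = exp (- a * s + (LINT t:{0<..}|U. ln (t / (t + s))))"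
      if s: "0 \<le> s" for s
    proof (cases "s = 0")
      case True
      interpret D: prob_space "distr M borel (\<lambda>\<omega>. Y \<omega> * V \<omega>)" by (rule prob_space_distr) simp
      have "(LINT t:{0<..}|U. ln (t / (t + 0))) = (LINT t|U. 0)"
        unfolding set_lebesgue_integral_def
        by (intro Bochner_Integration.integral_cong refl) (auto split: split_indicator)
      then show ?thesis using True D.prob_space by simp
    next
      case False
      then show ?thesis using laplace[OF s] U(2)[of s] s by simp
    qed
    moreover have "prob_space (distr M borel (\<lambda>\<omega>. Y \<omega> * V \<omega>))" by (rule prob_space_distr) simp
    moreover have "AE x in distr M borel (\<lambda>\<omega>. Y \<omega> * V \<omega>). 0 \<le> x"
      using Ypos Vpos by (subst AE_distr_iff) (auto elim: eventually_elim2)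
    ultimately show ?thesis unfolding GGC_def
      using U(1) unfolding thorin_pair_def by (intro conjI exI[of _ a] exI[of _ U]) auto
  qed
qed

section \<open>Products and quotients with hyperbolically monotone factors\<close>

lemma monotone_order_deriv_scale:
  assumes "monotone_order_deriv k h" "0 \<le> C"
  shows "monotone_order_deriv k (\<lambda>w. C * h w)"
proof -
  obtain D where D: "D 0 = h" "\<forall>j<k - 1. \<forall>w\<ge>2. (D j has_real_derivative D (Suc j) w) (at w within {2..})"
    "\<forall>j<k. \<forall>w\<ge>2. 0 \<le> (- 1) ^ j * D j w" "antimono_on {2..} (\<lambda>w. (- 1) ^ (k - 1) * D (k - 1) w)"
    using assms(1) unfolding monotone_order_deriv_def by blast
  have sgn: "(- 1) ^ j * (C * D j w) = C * ((- 1) ^ j * D j w)" for j w by simp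
  show ?thesis
    unfolding monotone_order_deriv_def sgn
  proof (intro exI[of _ "\<lambda>j w. C * D j w"] conjI allI impI)
    show "(\<lambda>w. C * D 0 w) = (\<lambda>w. C * h w)" using D(1) by simp
    show "((\<lambda>w. C * D j w) has_real_derivative C * D (Suc j) w) (at w within {2..})" if "j < k - 1" "2 \<le> w" for j w
      using D(2) that by (intro DERIV_cmult) auto
    show "0 \<le> (- 1) ^ j * (C * D j w)" if "j < k" "2 \<le> w" for j w
      unfolding sgn by (rule mult_nonneg_nonneg) (use D(3) that assms(2) in auto)
    show "antimono_on {2..} (\<lambda>w. (- 1) ^ (k - 1) * (C * D (k - 1) w))"
      unfolding sgn using D(4) assms(2) by (auto simp: monotone_on_def intro: mult_left_mono)
  qed
qed

lemma monotone_order_integral_scale: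
  assumes "monotone_order_integral k h" "0 \<le> C"
  shows "monotone_order_integral k (\<lambda>w. C * h w)"
proof -
  obtain c H where c: "0 \<le> c" and H[measurable_cong]: "sets H = sets borel" and
    h: "(\<forall>w\<ge>2. set_integrable H {w<..} (\<lambda>l. (l - w) ^ (k - 1)) \<and> h w = c + (LINT l:{w<..}|H. (l - w) ^ (k - 1))) \<or>
      (\<forall>w\<ge>2. set_integrable H {w..} (\<lambda>l. (l - w) ^ (k - 1)) \<and> h w = c + (LINT l:{w..}|H. (l - w) ^ (k - 1)))"
    using assms(1) unfolding monotone_order_integral_def by blast
  define H' where "H' = density H (\<lambda>_. ennreal C)"
  have *: "set_integrable H A g \<Longrightarrow> set_integrable H' A g" "(LINT l:A|H'. g l) = C * (LINT l:A|H. g l)"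
    if [measurable]: "A \<in> sets borel" "g \<in> borel_measurable borel" for A and g :: "real \<Rightarrow> real"
  proof -
    show "set_integrable H A g \<Longrightarrow> set_integrable H' A g"
      unfolding H'_def set_integrable_def using assms(2) by (subst integrable_density) auto
    have "(LINT l:A|H'. g l) = (LINT l|H. C *\<^sub>R (indicator A l *\<^sub>R g l))"
      unfolding H'_def set_lebesgue_integral_def using assms(2) by (intro integral_density) auto
    then show "(LINT l:A|H'. g l) = C * (LINT l:A|H. g l)" by (simp add: set_lebesgue_integral_def)
  qed
  show ?thesis unfolding monotone_order_integral_def
  proof (intro exI[of _ "C * c"] exI[of _ H'] conjI)
    show "0 \<le> C * c" using c assms(2) by simp
    show "sets H' = sets borel" by (simp add: H'_def H)
    show "(\<forall>w\<ge>2. set_integrable H' {w<..} (\<lambda>l. (l - w) ^ (k - 1)) \<and> C * h w = C * c + (LINT l:{w<..}|H'. (l - w) ^ (k - 1))) \<or>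
      (\<forall>w\<ge>2. set_integrable H' {w..} (\<lambda>l. (l - w) ^ (k - 1)) \<and> C * h w = C * c + (LINT l:{w..}|H'. (l - w) ^ (k - 1)))"
      using h by (auto simp: * distrib_left)
  qed
qed

text \<open>
The extra factor of \<open>f(u v) f(u / v)\<close> is \<open>u\<close> to the power \<open>2 m\<close>, constant in \<open>v\<close>.
\<close>
lemma HM_power_mult:
  assumes "HM k f"
  shows "HM k (\<lambda>x. x ^ m * f x)"
  unfolding HM_def
proof (intro conjI allI impI)
  show "0 \<le> x ^ m * f x" if "0 < x" for x using assms that by (auto simp: HM_def)
  fix u :: real assume u: "0 < u"
  obtain h where h: "\<And>v. 0 < v \<Longrightarrow> h (v + 1 / v) = f (u * v) * f (u / v)"
    "monotone_order_deriv k h \<or> monotone_order_integral k h"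
    using assms u unfolding HM_def by blast
  show "\<exists>h. (\<forall>v>0. h (v + 1 / v) = (u * v) ^ m * f (u * v) * ((u / v) ^ m * f (u / v))) \<and>
      (monotone_order_deriv k h \<or> monotone_order_integral k h)"
  proof (intro exI[of _ "\<lambda>w. (u ^ m * u ^ m) * h w"] conjI allI impI)
    show "monotone_order_deriv k (\<lambda>w. (u ^ m * u ^ m) * h w) \<or> monotone_order_integral k (\<lambda>w. (u ^ m * u ^ m) * h w)"
      using h(2) u monotone_order_deriv_scale monotone_order_integral_scale by (metis zero_le_square)
    fix v :: real assume v: "0 < v"
    show "(u ^ m * u ^ m) * h (v + 1 / v) = (u * v) ^ m * f (u * v) * ((u / v) ^ m * f (u / v))"
      unfolding h(1)[OF v] using v by (simp add: power_mult_distrib power_divide)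
  qed
qed

theorem theorem1:
  fixes M :: "'a measure" and X Y :: "'a \<Rightarrow> real" and k :: nat
  assumes "prob_space M"
    and "1 \<le> k"
    and "prob_space.indep_var M borel Y borel X"
    and "distributed M lborel Y (\<lambda>x. ennreal (gamma_density (real k) 1 x))"
    and "HM_distributed M k X"
  shows "GGC (distr M borel (\<lambda>\<omega>. Y \<omega> * X \<omega>)) \<and>
         GGC (distr M borel (\<lambda>\<omega>. Y \<omega> / X \<omega>))"
proof -
  interpret prob_space M by (rule assms(1))
  obtain n where k: "k = Suc n" using assms(2) by (cases k) auto
  obtain f0 where Xpos: "AE \<omega> in M. 0 < X \<omega>" and f0: "HM k f0"
    and dist: "distributed M lborel X (\<lambda>x. ennreal (if 0 < x then f0 x else 0))"
    using assms(5) unfolding HM_distributed_def by blast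
  define f where "f x = (if 0 < x then f0 x else 0)" for x
  have fnn: "0 \<le> f x" for x using f0 by (auto simp: HM_def f_def)
  have [measurable]: "X \<in> borel_measurable M" using distributed_measurable[OF dist] by simp
  have fm[measurable]: "f \<in> borel_measurable borel"
  proof -
    have "(\<lambda>x. enn2real (ennreal (f x))) \<in> borel_measurable borel"
      using distributed_borel_measurable[OF dist] by (simp add: f_def)
    then show ?thesis using fnn by simp
  qed
  have HM: "HM (Suc n) f"
    using f0 unfolding HM_def k[symmetric] by (auto simp: f_def)
  have distX: "distr M borel X = density lborel (\<lambda>x. ennreal (f x))"
    using distributed_distr_eq_density[OF dist] unfolding f_def by (metis distr_cong sets_lborel)
  have f_int: "integrable lborel f"
  proof (rule integrableI_nonneg)
    have "(\<integral>\<^sup>+x. ennreal (f x) \<partial>lborel) = emeasure (distr M borel X) UNIV"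
      unfolding distX by (simp add: emeasure_density)
    also have "\<dots> = 1" using emeasure_space_1 by (simp add: emeasure_distr)
    finally show "(\<integral>\<^sup>+x. ennreal (f x) \<partial>lborel) < \<infinity>" by simp
  qed (use fnn in auto)
  have expect: "(LINT \<omega>|M. g (X \<omega>)) = (LINT x|lborel. of_real (f x) * g x)"
    if [measurable]: "g \<in> borel_measurable borel" for g :: "real \<Rightarrow> complex"
  proof -
    have "(LINT \<omega>|M. g (X \<omega>)) = (LINT x|distr M borel X. g x)" by (rule integral_distr[symmetric]) measurable
    also have "\<dots> = (LINT x|lborel. f x *\<^sub>R g x)" unfolding distX using fnn by (intro integral_density) auto
    finally show ?thesis by (simp add: scaleR_conv_of_real)
  qed
  have "GGC (distr M borel (\<lambda>\<omega>. Y \<omega> * X \<omega>))"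
  proof (rule gamma_mixture_GGC[OF assms(1,3) assms(4)[unfolded k] Xpos])
    fix r \<theta> \<theta>' :: real assume r: "0 < r" and \<theta>: "0 \<le> \<theta>" "\<theta> \<le> \<theta>'" "\<theta>' < pi"
    have \<Phi>: "gamma_mixture_laplace M X (Suc n) z = (LINT x|lborel. of_real (f x) / (1 + z * of_real x) ^ Suc n)" for z
      unfolding gamma_mixture_laplace_def by (subst expect) simp_all
    show "norm (gamma_mixture_laplace M X (Suc n) (of_real r * cis \<theta>)) \<le> norm (gamma_mixture_laplace M X (Suc n) (of_real r * cis \<theta>'))"
      unfolding \<Phi>
    proof (rule HM_modulus_mono[OF HM fm _ _ r \<theta>])
      show "integrable lborel (\<lambda>x. f x / (1 + \<bar>x\<bar>) ^ Suc n)"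
      proof (rule Bochner_Integration.integrable_bound[OF f_int])
        show "AE x in lborel. norm (f x / (1 + \<bar>x\<bar>) ^ Suc n) \<le> norm (f x)"
        proof (rule AE_I2)
          fix x :: real
          have "1 \<le> (1 + \<bar>x\<bar>) ^ Suc n" by (intro one_le_power) simp
          then have "\<bar>f x\<bar> * 1 \<le> \<bar>f x\<bar> * (1 + \<bar>x\<bar>) ^ Suc n" by (intro mult_left_mono) auto
          moreover have "0 < (1 + \<bar>x\<bar>) ^ Suc n" by (intro zero_less_power) auto
          ultimately show "norm (f x / (1 + \<bar>x\<bar>) ^ Suc n) \<le> norm (f x)"
            by (simp add: power_abs divide_le_eq del: power_Suc)
        qed
      qed measurable
    qed (simp add: f_def)
  qed
  moreover have "GGC (distr M borel (\<lambda>\<omega>. Y \<omega> * (1 / X \<omega>)))"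
  proof (rule gamma_mixture_GGC[OF assms(1) _ assms(4)[unfolded k]])
    have "indep_var borel (id \<circ> Y) borel ((\<lambda>x. 1 / x) \<circ> X)"
      by (rule indep_var_compose[OF assms(3)]) measurable
    then show "indep_var borel Y borel (\<lambda>\<omega>. 1 / X \<omega>)" by (simp add: o_def)
    show "AE \<omega> in M. 0 < 1 / X \<omega>" using Xpos by eventually_elim simp
    fix r \<theta> \<theta>' :: real assume r: "0 < r" and \<theta>: "0 \<le> \<theta>" "\<theta> \<le> \<theta>'" "\<theta>' < pi"
    \<comment> \<open>\<open>1 / (1 + z / x) = (x / z) / (1 + x / z)\<close> turns the transform of \<open>1 / X\<close> into that of the weight \<open>g\<close> at \<open>1 / z\<close>, the conjugate of \<open>(1 / r) cis t\<close>.\<close>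
    define g where "g x = x ^ Suc n * f x" for x
    have HMg: "HM (Suc n) g" unfolding g_def by (rule HM_power_mult[OF HM])
    have gm[measurable]: "g \<in> borel_measurable borel" unfolding g_def[abs_def] by measurable
    define \<Phi> where "\<Phi> z = (LINT x|lborel. of_real (g x) / (1 + z * of_real x) ^ Suc n)" for z :: complex
    have inverse: "norm (gamma_mixture_laplace M (\<lambda>\<omega>. 1 / X \<omega>) (Suc n) (of_real r * cis t)) = 1 / r ^ Suc n * norm (\<Phi> (of_real (1 / r) * cis t))" for t
    proof -
      define z where "z = of_real r * cis t"
      have z: "z \<noteq> 0" "norm z = r" using r by (auto simp: z_def norm_mult)
      define y where "y = of_real (1 / r) * cis t"
      have yz: "cnj y = 1 / z" using r by (simp add: y_def z_def cis_cnj field_simps cis_mult)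
      have "gamma_mixture_laplace M (\<lambda>\<omega>. 1 / X \<omega>) (Suc n) z = (LINT x|lborel. of_real (f x) * (1 / (1 + z * of_real (1 / x)) ^ Suc n))"
        unfolding gamma_mixture_laplace_def by (subst expect) simp_all
      also have "\<dots> = (LINT x|lborel. (1 / z ^ Suc n) * cnj (of_real (g x) / (1 + y * of_real x) ^ Suc n))"
      proof (intro Bochner_Integration.integral_cong refl)
        fix x :: real
        show "of_real (f x) * (1 / (1 + z * of_real (1 / x)) ^ Suc n) = (1 / z ^ Suc n) * cnj (of_real (g x) / (1 + y * of_real x) ^ Suc n)"
        proof (cases "0 < x")
          case True
          have "1 + z * of_real (1 / x) = (z / of_real x) * (1 + cnj y * of_real x)"
            unfolding yz using z True by (simp add: field_simps)
          then show ?thesis using True z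
            by (simp add: g_def power_mult_distrib power_divide del: power_Suc)
        next
          case False
          then show ?thesis by (simp add: f_def g_def)
        qed
      qed
      also have "\<dots> = (1 / z ^ Suc n) * cnj (\<Phi> y)"
        unfolding \<Phi>_def Bochner_Integration.integral_cnj[symmetric] by (rule integral_mult_right_zero)
      finally show ?thesis using z by (simp add: norm_mult norm_divide norm_power z_def y_def del: power_Suc)
    qed
    have "norm (\<Phi> (of_real (1 / r) * cis \<theta>)) \<le> norm (\<Phi> (of_real (1 / r) * cis \<theta>'))"
      unfolding \<Phi>_def
    proof (rule HM_modulus_mono[OF HMg gm _ _ _ \<theta>])
      show "integrable lborel (\<lambda>x. g x / (1 + \<bar>x\<bar>) ^ Suc n)"
      proof (rule Bochner_Integration.integrable_bound[OF f_int])
        show "AE x in lborel. norm (g x / (1 + \<bar>x\<bar>) ^ Suc n) \<le> norm (f x)"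
        proof (rule AE_I2)
          fix x :: real
          have "\<bar>x\<bar> ^ Suc n \<le> (1 + \<bar>x\<bar>) ^ Suc n" by (intro power_mono) auto
          then have "\<bar>f x\<bar> * \<bar>x\<bar> ^ Suc n \<le> \<bar>f x\<bar> * (1 + \<bar>x\<bar>) ^ Suc n" by (intro mult_left_mono) auto
          moreover have "0 < (1 + \<bar>x\<bar>) ^ Suc n" by (intro zero_less_power) auto
          ultimately show "norm (g x / (1 + \<bar>x\<bar>) ^ Suc n) \<le> norm (f x)"
            by (simp add: g_def abs_mult power_abs divide_le_eq mult.commute del: power_Suc)
        qed
      qed measurable
      show "g x = 0" if "x \<le> 0" for x using that by (simp add: g_def f_def)
    qed (use r in simp)
    then show "norm (gamma_mixture_laplace M (\<lambda>\<omega>. 1 / X \<omega>) (Suc n) (of_real r * cis \<theta>)) \<le>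
        norm (gamma_mixture_laplace M (\<lambda>\<omega>. 1 / X \<omega>) (Suc n) (of_real r * cis \<theta>'))"
      unfolding inverse using r by (intro mult_left_mono) auto
  qed
  ultimately show ?thesis by simp
qed

end
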